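(* Let $H$ be a separable infinite-dimensional Hilbert space, and let $L(H)$ be the unital C*-algebra of bounded operators on $H$. Let $j\colon S^1\hookrightarrow D^2$ be the inclusion map of the unit circle into the unit disk. There is a unital $*$-homomorphism $\phi\colon C(S^1)\to C(D^2)\otimes L(H)$ such that $(j^\star\otimes\mathrm{id})(\phi(a)) = a\otimes 1_H$ for all $a\in C(S^1)$.
   Context: For a compact Hausdorff space $X$, $C(X)$ denotes the C*-algebra of continuous complex-valued functions on $X$; $j^\star\colon C(D^2)\to C(S^1)$ is the restriction homomorphism $a\mapsto a\circ j$. The symbol $\otimes$ denotes the minimal tensor product of C*-algebras, and $1_H$ is the identity operator on $H$. *)

theory Defs
  imports "HOL-Analysis.Analysis"
begin

section \<open>Complex Hilbert spaces\<close>

text \<open>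
  The inner product is conjugate-linear in its first argument. The real normed structure
  of a Hilbert space is that of its superclass, so that limits, closures and the operator norm
  are the library's.
\<close>

class complex_hilbert = banach +
  fixes scaleC :: "complex \<Rightarrow> 'a \<Rightarrow> 'a" (infixr "*\<^sub>C" 75)
    and cinner :: "'a \<Rightarrow> 'a \<Rightarrow> complex"
  assumes scaleC_add_right: "c *\<^sub>C (x + y) = c *\<^sub>C x + c *\<^sub>C y"
    and scaleC_add_left: "(c + d) *\<^sub>C x = c *\<^sub>C x + d *\<^sub>C x"
    and scaleC_scaleC: "c *\<^sub>C d *\<^sub>C x = (c * d) *\<^sub>C x"
    and scaleC_of_real: "complex_of_real r *\<^sub>C x = r *\<^sub>R x"
    and cinner_commute: "cinner x y = cnj (cinner y x)"
    and cinner_add_right: "cinner x (y + z) = cinner x y + cinner x z"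
    and cinner_scaleC_right: "cinner x (c *\<^sub>C y) = c * cinner x y"
    and cinner_self: "cinner x x = complex_of_real ((norm x)\<^sup>2)"

global_interpretation cvec: vector_space "scaleC :: complex \<Rightarrow> 'a \<Rightarrow> 'a::complex_hilbert"
proof
  fix x :: 'a
  show "1 *\<^sub>C x = x"
    using scaleC_of_real[of 1 x] by simp
qed (simp_all add: scaleC_add_right scaleC_add_left scaleC_scaleC)

definition infinite_dimensional :: "'h::complex_hilbert itself \<Rightarrow> bool" where
  "infinite_dimensional _ \<longleftrightarrow> \<not> (\<exists>B :: 'h set. finite B \<and> cvec.span B = UNIV)"

section \<open>The Hilbert spaces of square-summable families\<close>

typedef 'i ell2 = "{f :: 'i \<Rightarrow> complex. (\<lambda>i. (cmod (f i))\<^sup>2) summable_on UNIV}"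
  morphisms ell2_coeff Abs_ell2
  by (rule exI[of _ "\<lambda>_. 0"]) simp

setup_lifting type_definition_ell2

lemma sq_summable_add:
  fixes f g :: "'i \<Rightarrow> complex"
  assumes "(\<lambda>i. (cmod (f i))\<^sup>2) summable_on UNIV" "(\<lambda>i. (cmod (g i))\<^sup>2) summable_on UNIV"
  shows "(\<lambda>i. (cmod (f i + g i))\<^sup>2) summable_on UNIV"
proof (rule summable_on_comparison_test)
  show "(\<lambda>i. 2 * (cmod (f i))\<^sup>2 + 2 * (cmod (g i))\<^sup>2) summable_on UNIV"
    using assms by (intro summable_on_add summable_on_cmult_right)
  fix i
  have "(cmod (f i + g i))\<^sup>2 \<le> (cmod (f i) + cmod (g i))\<^sup>2"
    by (simp add: norm_triangle_ineq power_mono)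
  also have "\<dots> \<le> 2 * (cmod (f i))\<^sup>2 + 2 * (cmod (g i))\<^sup>2"
    using sum_squares_bound[of "cmod (f i)" "cmod (g i)"] by (simp add: power2_sum)
  finally show "(cmod (f i + g i))\<^sup>2 \<le> 2 * (cmod (f i))\<^sup>2 + 2 * (cmod (g i))\<^sup>2" .
qed auto

lemma sq_summable_cmult:
  fixes f :: "'i \<Rightarrow> complex"
  assumes "(\<lambda>i. (cmod (f i))\<^sup>2) summable_on UNIV"
  shows "(\<lambda>i. (cmod (c * f i))\<^sup>2) summable_on UNIV"
  using summable_on_cmult_right[OF assms, of "(cmod c)\<^sup>2"]
  by (simp add: norm_mult power_mult_distrib)

lemma sq_summable_inner:
  fixes f g :: "'i \<Rightarrow> complex"
  assumes "(\<lambda>i. (cmod (f i))\<^sup>2) summable_on UNIV" "(\<lambda>i. (cmod (g i))\<^sup>2) summable_on UNIV"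
  shows "(\<lambda>i. cnj (f i) * g i) summable_on UNIV"
proof -
  have "(\<lambda>i. norm (cnj (f i) * g i)) summable_on UNIV"
  proof (rule summable_on_comparison_test)
    show "(\<lambda>i. (cmod (f i))\<^sup>2 + (cmod (g i))\<^sup>2) summable_on UNIV"
      using assms by (intro summable_on_add)
    fix i
    show "norm (cnj (f i) * g i) \<le> (cmod (f i))\<^sup>2 + (cmod (g i))\<^sup>2"
      using sum_squares_bound[of "cmod (f i)" "cmod (g i)"]
        mult_nonneg_nonneg[OF norm_ge_zero[of "f i"] norm_ge_zero[of "g i"]]
      unfolding norm_mult complex_mod_cnj by linarith
  qed auto
  then show ?thesis
    by (rule abs_summable_summable)
qed

lemma ell2_summable: "(\<lambda>i. (cmod (ell2_coeff x i))\<^sup>2) summable_on UNIV"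
  using ell2_coeff[of x] by simp

lemma ell2_eqI: "(\<And>i. ell2_coeff x i = ell2_coeff y i) \<Longrightarrow> x = y"
  by (simp add: ell2_coeff_inject[symmetric] fun_eq_iff)

instantiation ell2 :: (type) real_normed_vector
begin

lift_definition zero_ell2 :: "'a ell2" is "\<lambda>_. 0" by simp

lift_definition plus_ell2 :: "'a ell2 \<Rightarrow> 'a ell2 \<Rightarrow> 'a ell2" is "\<lambda>f g i. f i + g i"
  by (rule sq_summable_add)

lift_definition uminus_ell2 :: "'a ell2 \<Rightarrow> 'a ell2" is "\<lambda>f i. - f i" by simp

lift_definition minus_ell2 :: "'a ell2 \<Rightarrow> 'a ell2 \<Rightarrow> 'a ell2" is "\<lambda>f g i. f i - g i"
proof -
  fix f g :: "'a \<Rightarrow> complex"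
  assume "(\<lambda>i. (cmod (f i))\<^sup>2) summable_on UNIV" "(\<lambda>i. (cmod (g i))\<^sup>2) summable_on UNIV"
  then show "(\<lambda>i. (cmod (f i - g i))\<^sup>2) summable_on UNIV"
    using sq_summable_add[of f "\<lambda>i. - g i"] by simp
qed

lift_definition scaleR_ell2 :: "real \<Rightarrow> 'a ell2 \<Rightarrow> 'a ell2" is "\<lambda>r f i. complex_of_real r * f i"
  by (rule sq_summable_cmult)

definition norm_ell2 :: "'a ell2 \<Rightarrow> real" where
  "norm_ell2 x = sqrt (\<Sum>\<^sub>\<infinity>i. (cmod (ell2_coeff x i))\<^sup>2)"

definition dist_ell2 :: "'a ell2 \<Rightarrow> 'a ell2 \<Rightarrow> real" where
  "dist_ell2 x y = norm (x - y)"

definition sgn_ell2 :: "'a ell2 \<Rightarrow> 'a ell2" where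
  "sgn_ell2 x = scaleR (inverse (norm x)) x"

definition uniformity_ell2 :: "('a ell2 \<times> 'a ell2) filter" where
  "uniformity_ell2 = (INF e\<in>{0<..}. principal {(x, y). dist x y < e})"

definition open_ell2 :: "'a ell2 set \<Rightarrow> bool" where
  "open_ell2 U = (\<forall>x\<in>U. eventually (\<lambda>(x', y). x' = x \<longrightarrow> y \<in> U) uniformity)"

lemma ell2_norm_leI:
  assumes "\<And>F. finite F \<Longrightarrow> L2_set (\<lambda>i. cmod (ell2_coeff x i)) F \<le> C"
  shows "norm x \<le> C"
proof -
  have C: "C \<ge> 0" using assms[of "{}"] by simp
  have "(\<Sum>\<^sub>\<infinity>i. (cmod (ell2_coeff x i))\<^sup>2) \<le> C\<^sup>2"
  proof (rule infsum_le_finite_sums[OF ell2_summable])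
    fix F :: "'a set" assume "finite F"
    from assms[OF this] show "(\<Sum>i\<in>F. (cmod (ell2_coeff x i))\<^sup>2) \<le> C\<^sup>2"
      unfolding L2_set_def by (rule sqrt_le_D)
  qed
  then show ?thesis
    unfolding norm_ell2_def using C by (rule real_le_lsqrt[rotated])
qed

lemma ell2_L2_set_le_norm:
  assumes "finite F"
  shows "L2_set (\<lambda>i. cmod (ell2_coeff x i)) F \<le> norm x"
  unfolding L2_set_def norm_ell2_def
  using finite_sum_le_infsum[OF ell2_summable assms] by simp

lemma ell2_coeff_le_norm: "cmod (ell2_coeff x i) \<le> norm x"
  using ell2_L2_set_le_norm[of "{i}" x] by simp

instance
proof
  fix x y z :: "'a ell2" and a b :: real
  show "x + y + z = x + (y + z)" by transfer (simp add: add.assoc)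
  show "x + y = y + x" by transfer (simp add: add.commute)
  show "0 + x = x" by transfer simp
  show "- x + x = 0" by transfer simp
  show "x - y = x + - y" by transfer simp
  show "a *\<^sub>R (x + y) = a *\<^sub>R x + a *\<^sub>R y" by transfer (simp add: algebra_simps)
  show "(a + b) *\<^sub>R x = a *\<^sub>R x + b *\<^sub>R x" by transfer (simp add: algebra_simps)
  show "a *\<^sub>R b *\<^sub>R x = (a * b) *\<^sub>R x" by transfer (simp add: algebra_simps)
  show "1 *\<^sub>R x = x" by transfer simp
  show "dist x y = norm (x - y)" by (rule dist_ell2_def)
  show "sgn x = scaleR (inverse (norm x)) x" by (rule sgn_ell2_def)
  show "uniformity = (INF e\<in>{0<..}. principal {(x :: 'a ell2, y). dist x y < e})"
    by (rule uniformity_ell2_def)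
  show "open U = (\<forall>x\<in>U. eventually (\<lambda>(x', y). x' = x \<longrightarrow> y \<in> U) uniformity)" for U :: "'a ell2 set"
    by (rule open_ell2_def)
  show "norm x = 0 \<longleftrightarrow> x = 0"
  proof
    assume "norm x = 0"
    then have "ell2_coeff x i = 0" for i
      using ell2_coeff_le_norm[of x i] by simp
    then show "x = 0"
      by (intro ell2_eqI) (simp add: zero_ell2.rep_eq)
  qed (simp add: norm_ell2_def zero_ell2.rep_eq)
  show "norm (x + y) \<le> norm x + norm y"
  proof (rule ell2_norm_leI)
    fix F :: "'a set" assume F: "finite F"
    have "L2_set (\<lambda>i. cmod (ell2_coeff (x + y) i)) F
        \<le> L2_set (\<lambda>i. cmod (ell2_coeff x i) + cmod (ell2_coeff y i)) F"
      by (rule L2_set_mono) (simp_all add: plus_ell2.rep_eq norm_triangle_ineq)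
    also have "\<dots> \<le> L2_set (\<lambda>i. cmod (ell2_coeff x i)) F + L2_set (\<lambda>i. cmod (ell2_coeff y i)) F"
      by (rule L2_set_triangle_ineq)
    also have "\<dots> \<le> norm x + norm y"
      by (intro add_mono ell2_L2_set_le_norm F)
    finally show "L2_set (\<lambda>i. cmod (ell2_coeff (x + y) i)) F \<le> norm x + norm y" .
  qed
  show "norm (a *\<^sub>R x) = \<bar>a\<bar> * norm x"
    unfolding norm_ell2_def
    by (simp add: scaleR_ell2.rep_eq norm_mult power_mult_distrib infsum_cmult_right' real_sqrt_mult)
qed

end

instance ell2 :: (type) banach
proof
  fix X :: "nat \<Rightarrow> 'a ell2"
  assume X: "Cauchy X"
  have coeff: "cmod (ell2_coeff (X m) i - ell2_coeff (X n) i) \<le> dist (X m) (X n)" for m n i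
    using ell2_coeff_le_norm[of "X m - X n" i] by (simp add: minus_ell2.rep_eq dist_norm)
  have "Cauchy (\<lambda>n. ell2_coeff (X n) i)" for i
    using X coeff unfolding Cauchy_def dist_norm[where 'a = complex] by (meson le_less_trans)
  then have "\<exists>l. (\<lambda>n. ell2_coeff (X n) i) \<longlonglongrightarrow> l" for i
    by (simp add: Cauchy_convergent convergentD)
  then obtain f where f: "\<And>i. (\<lambda>n. ell2_coeff (X n) i) \<longlonglongrightarrow> f i" by metis
  have tail: "L2_set (\<lambda>i. cmod (ell2_coeff (X m) i - f i)) F \<le> e"
    if F: "finite F" and e: "\<And>n. n \<ge> N \<Longrightarrow> dist (X m) (X n) \<le> e" for F m N e
  proof (rule LIMSEQ_le_const2)
    show "(\<lambda>n. L2_set (\<lambda>i. cmod (ell2_coeff (X m) i - ell2_coeff (X n) i)) F)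
        \<longlonglongrightarrow> L2_set (\<lambda>i. cmod (ell2_coeff (X m) i - f i)) F"
      unfolding L2_set_def by (intro tendsto_intros f)
    show "\<exists>N. \<forall>n\<ge>N. L2_set (\<lambda>i. cmod (ell2_coeff (X m) i - ell2_coeff (X n) i)) F \<le> e"
      using ell2_L2_set_le_norm[OF F, of "X m - X n" for n] e
      by (auto simp: minus_ell2.rep_eq dist_norm intro!: exI[of _ N] intro: order_trans)
  qed
  have cauchy: "\<exists>N. \<forall>m\<ge>N. \<forall>n\<ge>N. dist (X m) (X n) \<le> e" if "e > 0" for e
    using X that unfolding Cauchy_def by (meson less_imp_le)
  have sq: "(\<lambda>i. (cmod (f i))\<^sup>2) summable_on UNIV"
  proof -
    obtain N where N: "\<And>n. n \<ge> N \<Longrightarrow> dist (X N) (X n) \<le> 1"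
      using cauchy[of 1] by auto
    have "(\<lambda>i. (cmod (ell2_coeff (X N) i - f i))\<^sup>2) summable_on UNIV"
    proof (rule nonneg_bdd_above_summable_on)
      show "bdd_above (sum (\<lambda>i. (cmod (ell2_coeff (X N) i - f i))\<^sup>2) ` {F. F \<subseteq> UNIV \<and> finite F})"
      proof (rule bdd_aboveI2)
        fix F :: "'a set" assume "F \<in> {F. F \<subseteq> UNIV \<and> finite F}"
        then have "L2_set (\<lambda>i. cmod (ell2_coeff (X N) i - f i)) F \<le> 1"
          using tail N by blast
        then show "(\<Sum>i\<in>F. (cmod (ell2_coeff (X N) i - f i))\<^sup>2) \<le> 1"
          unfolding L2_set_def by simp
      qed
    qed simp
    then have "(\<lambda>i. (cmod (ell2_coeff (X N) i + (-1) * (ell2_coeff (X N) i - f i)))\<^sup>2) summable_on UNIV"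
      by (intro sq_summable_add sq_summable_cmult ell2_summable)
    then show ?thesis by simp
  qed
  define x where "x = Abs_ell2 f"
  have x: "ell2_coeff x = f"
    unfolding x_def using sq by (simp add: Abs_ell2_inverse)
  have "X \<longlonglongrightarrow> x"
  proof (rule LIMSEQ_I)
    fix r :: real assume "r > 0"
    then obtain N where N: "\<And>m n. m \<ge> N \<Longrightarrow> n \<ge> N \<Longrightarrow> dist (X m) (X n) \<le> r / 2"
      using cauchy[of "r / 2"] by auto
    have "norm (X m - x) \<le> r / 2" if "m \<ge> N" for m
    proof (rule ell2_norm_leI)
      fix F :: "'a set" assume "finite F"
      from tail[OF this N[OF that]] show "L2_set (\<lambda>i. cmod (ell2_coeff (X m - x) i)) F \<le> r / 2"
        by (simp add: minus_ell2.rep_eq x)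
    qed
    then show "\<exists>N. \<forall>n\<ge>N. norm (X n - x) < r"
      using \<open>r > 0\<close> by (intro exI[of _ N] allI impI) (rule le_less_trans[of _ "r / 2"], simp_all)
  qed
  then show "convergent X"
    by (rule convergentI)
qed

instantiation ell2 :: (type) complex_hilbert
begin

lift_definition scaleC_ell2 :: "complex \<Rightarrow> 'a ell2 \<Rightarrow> 'a ell2" is "\<lambda>c f i. c * f i"
  by (rule sq_summable_cmult)

definition cinner_ell2 :: "'a ell2 \<Rightarrow> 'a ell2 \<Rightarrow> complex" where
  "cinner_ell2 x y = (\<Sum>\<^sub>\<infinity>i. cnj (ell2_coeff x i) * ell2_coeff y i)"

instance
proof
  fix x y z :: "'a ell2" and c d :: complex and r :: real
  note s = sq_summable_inner[OF ell2_summable ell2_summable]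
  show "c *\<^sub>C (x + y) = c *\<^sub>C x + c *\<^sub>C y" by transfer (simp add: algebra_simps)
  show "(c + d) *\<^sub>C x = c *\<^sub>C x + d *\<^sub>C x" by transfer (simp add: algebra_simps)
  show "c *\<^sub>C d *\<^sub>C x = (c * d) *\<^sub>C x" by transfer (simp add: algebra_simps)
  show "complex_of_real r *\<^sub>C x = r *\<^sub>R x" by transfer simp
  show "cinner x y = cnj (cinner y x)"
    unfolding cinner_ell2_def by (simp add: mult.commute flip: infsum_cnj)
  show "cinner x (y + z) = cinner x y + cinner x z"
    unfolding cinner_ell2_def by (simp add: plus_ell2.rep_eq distrib_left infsum_add s)
  show "cinner x (c *\<^sub>C y) = c * cinner x y"
    unfolding cinner_ell2_def
    by (simp add: scaleC_ell2.rep_eq mult.left_commute infsum_cmult_right')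
  have "(norm x)\<^sup>2 = (\<Sum>\<^sub>\<infinity>i. (cmod (ell2_coeff x i))\<^sup>2)"
    unfolding norm_ell2_def by (simp add: infsum_nonneg)
  moreover have "cnj z * z = complex_of_real ((cmod z)\<^sup>2)" for z
    by (metis complex_norm_square mult.commute)
  ultimately show "cinner x x = complex_of_real ((norm x)\<^sup>2)"
    unfolding cinner_ell2_def
    by (simp only: infsumI[OF has_sum_of_real[OF has_sum_infsum[OF ell2_summable[of x]]]])
qed

end

text \<open>
  The Hilbert space tensor product of \<open>\<ell>\<^sup>2(I)\<close> and \<open>\<ell>\<^sup>2(J)\<close> is realised as \<open>\<ell>\<^sup>2(I \<times> J)\<close>.
\<close>

lift_definition tensor_vec :: "'i ell2 \<Rightarrow> 'j ell2 \<Rightarrow> ('i \<times> 'j) ell2" (infixr "\<otimes>\<^sub>v" 70)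
  is "\<lambda>f g (i, j). f i * g j"
proof -
  fix f :: "'i \<Rightarrow> complex" and g :: "'j \<Rightarrow> complex"
  assume "(\<lambda>i. (cmod (f i))\<^sup>2) summable_on UNIV" "(\<lambda>j. (cmod (g j))\<^sup>2) summable_on UNIV"
  then have "(\<lambda>(i, j). (cmod (f i))\<^sup>2 * (cmod (g j))\<^sup>2) summable_on UNIV \<times> UNIV"
    by (intro summable_on_SigmaI[where g = "\<lambda>i. (cmod (f i))\<^sup>2 * (\<Sum>\<^sub>\<infinity>j. (cmod (g j))\<^sup>2)"])
       (auto intro!: has_sum_cmult_right summable_on_cmult_left has_sum_infsum)
  then show "(\<lambda>p. (cmod (case p of (i, j) \<Rightarrow> f i * g j))\<^sup>2) summable_on UNIV"
    by (simp add: case_prod_unfold norm_mult power_mult_distrib)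
qed

section \<open>Unital C*-algebras and their homomorphisms\<close>

text \<open>
  Only the unital *-algebra structure is recorded. This loses nothing for C*-algebras, whose norm
  is determined by that structure: *-homomorphisms are contractive and injective ones are isometric.
\<close>

record 'a star_algebra =
  carrier :: "'a set"
  add :: "'a \<Rightarrow> 'a \<Rightarrow> 'a"
  scale :: "complex \<Rightarrow> 'a \<Rightarrow> 'a"
  mult :: "'a \<Rightarrow> 'a \<Rightarrow> 'a"
  star :: "'a \<Rightarrow> 'a"
  unit :: 'a

definition unital_star_hom :: "'a star_algebra \<Rightarrow> 'b star_algebra \<Rightarrow> ('a \<Rightarrow> 'b) \<Rightarrow> bool" where
  "unital_star_hom A B \<phi> \<longleftrightarrow>
     (\<forall>a\<in>carrier A. \<phi> a \<in> carrier B) \<and>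
     (\<forall>a\<in>carrier A. \<forall>b\<in>carrier A. \<phi> (add A a b) = add B (\<phi> a) (\<phi> b)) \<and>
     (\<forall>c. \<forall>a\<in>carrier A. \<phi> (scale A c a) = scale B c (\<phi> a)) \<and>
     (\<forall>a\<in>carrier A. \<forall>b\<in>carrier A. \<phi> (mult A a b) = mult B (\<phi> a) (\<phi> b)) \<and>
     (\<forall>a\<in>carrier A. \<phi> (star A a) = star B (\<phi> a)) \<and>
     \<phi> (unit A) = unit B"

text \<open>
  Continuous functions on \<open>X\<close> are represented by functions that are \<open>undefined\<close> off \<open>X\<close>, so that
  equality in \<open>C(X)\<close> is equality of functions on \<open>X\<close>.
\<close>

definition Cont :: "'x::topological_space set \<Rightarrow> ('x \<Rightarrow> complex) star_algebra" where
  "Cont X = \<lparr> carrier = {f \<in> extensional X. continuous_on X f},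
     add = (\<lambda>f g. \<lambda>x\<in>X. f x + g x),
     scale = (\<lambda>c f. \<lambda>x\<in>X. c * f x),
     mult = (\<lambda>f g. \<lambda>x\<in>X. f x * g x),
     star = (\<lambda>f. \<lambda>x\<in>X. cnj (f x)),
     unit = (\<lambda>x\<in>X. 1) \<rparr>"

definition pullback :: "'x set \<Rightarrow> ('x \<Rightarrow> 'y) \<Rightarrow> ('y \<Rightarrow> complex) \<Rightarrow> ('x \<Rightarrow> complex)" where
  "pullback X h a = (\<lambda>x\<in>X. a (h x))"

text \<open>
  Elements of \<open>'h \<Rightarrow>\<^sub>L 'h\<close> are the bounded real-linear operators, normed by the operator norm.
\<close>

definition adjoint_op :: "('h::complex_hilbert \<Rightarrow>\<^sub>L 'h) \<Rightarrow> ('h \<Rightarrow>\<^sub>L 'h)" where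
  "adjoint_op T = (THE S. \<forall>x y. cinner (blinfun_apply S x) y = cinner x (blinfun_apply T y))"

definition Lop :: "('h::complex_hilbert \<Rightarrow>\<^sub>L 'h) star_algebra" where
  "Lop = \<lparr> carrier = {T. \<forall>c x. blinfun_apply T (c *\<^sub>C x) = c *\<^sub>C blinfun_apply T x},
     add = (+),
     scale = (\<lambda>c T. Blinfun (\<lambda>x. c *\<^sub>C blinfun_apply T x)),
     mult = (o\<^sub>L),
     star = adjoint_op,
     unit = id_blinfun \<rparr>"

section \<open>Minimal tensor products\<close>

text \<open>
  A faithful unital representation of a unital C*-algebra. Every nonzero unital C*-algebra with
  elements in an infinite type \<open>'a\<close> has one on \<open>\<ell>\<^sup>2('a)\<close>, since a separating family of cyclic
  representations takes up a Hilbert space of dimension at most the cardinality of \<open>'a\<close>, which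
  multiples make exactly that cardinality. Up to isomorphism, the spatial (= minimal) tensor product
  does not depend on the choice.
\<close>

definition faithful_rep :: "'a star_algebra \<Rightarrow> ('a \<Rightarrow> ('i ell2 \<Rightarrow>\<^sub>L 'i ell2)) \<Rightarrow> bool" where
  "faithful_rep A \<pi> \<longleftrightarrow> unital_star_hom A Lop \<pi> \<and> inj_on \<pi> (carrier A)"

definition rep :: "'a star_algebra \<Rightarrow> 'a \<Rightarrow> ('a ell2 \<Rightarrow>\<^sub>L 'a ell2)" where
  "rep A = (SOME \<pi>. faithful_rep A \<pi>)"

definition tensor_op ::
    "('i ell2 \<Rightarrow>\<^sub>L 'i ell2) \<Rightarrow> ('j ell2 \<Rightarrow>\<^sub>L 'j ell2) \<Rightarrow> (('i \<times> 'j) ell2 \<Rightarrow>\<^sub>L ('i \<times> 'j) ell2)" where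
  "tensor_op S T = (THE R. R \<in> carrier Lop \<and>
     (\<forall>x y. blinfun_apply R (x \<otimes>\<^sub>v y) = blinfun_apply S x \<otimes>\<^sub>v blinfun_apply T y))"

definition tensor_elem ::
    "'a star_algebra \<Rightarrow> 'b star_algebra \<Rightarrow> 'a \<Rightarrow> 'b \<Rightarrow> (('a \<times> 'b) ell2 \<Rightarrow>\<^sub>L ('a \<times> 'b) ell2)" where
  "tensor_elem A B a b = tensor_op (rep A a) (rep B b)"

text \<open>
  The norm closure of the algebraic tensor product, that is of the finite sums of elementary tensors,
  inside \<open>L(\<ell>\<^sup>2('a) \<otimes> \<ell>\<^sup>2('b))\<close>.
\<close>

definition min_tensor ::
    "'a star_algebra \<Rightarrow> 'b star_algebra \<Rightarrow> (('a \<times> 'b) ell2 \<Rightarrow>\<^sub>L ('a \<times> 'b) ell2) star_algebra"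
    (infixr "\<otimes>\<^sub>m\<^sub>i\<^sub>n" 70) where
  "A \<otimes>\<^sub>m\<^sub>i\<^sub>n B = Lop\<lparr> carrier := closure
     {\<Sum>k<n. tensor_elem A B (a k) (b k) | (n::nat) a b. \<forall>k<n. a k \<in> carrier A \<and> b k \<in> carrier B} \<rparr>"

text \<open>
  The homomorphism \<open>f \<otimes> g : A \<otimes> B \<rightarrow> A' \<otimes> B'\<close>, which is the unique continuous one
  with \<open>a \<otimes> b \<mapsto> f a \<otimes> g b\<close>.
\<close>

definition tensor_hom ::
    "'a star_algebra \<Rightarrow> 'b star_algebra \<Rightarrow> 'c star_algebra \<Rightarrow> 'd star_algebra \<Rightarrow>
     ('a \<Rightarrow> 'c) \<Rightarrow> ('b \<Rightarrow> 'd) \<Rightarrow>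
     (('a \<times> 'b) ell2 \<Rightarrow>\<^sub>L ('a \<times> 'b) ell2) \<Rightarrow> (('c \<times> 'd) ell2 \<Rightarrow>\<^sub>L ('c \<times> 'd) ell2)" where
  "tensor_hom A B A' B' f g = (THE \<Phi>.
     \<Phi> \<in> extensional (carrier (A \<otimes>\<^sub>m\<^sub>i\<^sub>n B)) \<and>
     unital_star_hom (A \<otimes>\<^sub>m\<^sub>i\<^sub>n B) (A' \<otimes>\<^sub>m\<^sub>i\<^sub>n B') \<Phi> \<and>
     continuous_on (carrier (A \<otimes>\<^sub>m\<^sub>i\<^sub>n B)) \<Phi> \<and>
     (\<forall>a\<in>carrier A. \<forall>b\<in>carrier B. \<Phi> (tensor_elem A B a b) = tensor_elem A' B' (f a) (g b)))"

section \<open>The circle and the disk\<close>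

abbreviation S1 :: "complex set" where "S1 \<equiv> sphere 0 1"

abbreviation D2 :: "complex set" where "D2 \<equiv> cball 0 1"

text \<open>The restriction homomorphism \<open>a \<mapsto> a \<circ> j\<close>, with \<open>j\<close> the inclusion of the circle.\<close>

definition jstar :: "(complex \<Rightarrow> complex) \<Rightarrow> (complex \<Rightarrow> complex)" where
  "jstar = pullback S1 (\<lambda>z. z)"

end

theory Submission
  imports Defs
begin

text \<open>
  A unital *-homomorphism out of \<open>C(S\<^sup>1)\<close> is a unitary element, so the theorem asks for a unitary
  \<open>u\<close> of \<open>C(D\<^sup>2) \<otimes> L(H)\<close> that restricts to \<open>z \<otimes> 1\<close> on the circle. If \<open>H\<close> is the direct sum of the
  ranges of two isometries \<open>p\<close> and \<open>q\<close>, then \<open>diag(z, 1/z)\<close> extends over the disk by the rotation with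
  rows \<open>(z, -s)\<close> and \<open>(s, cnj z)\<close>, where \<open>s = (1 - |z|\<^sup>2)\<^sup>1\<^sup>/\<^sup>2\<close>. Decompose \<open>H\<close> into three infinite-dimensional
  summands. Since any two infinite-dimensional summands are isometric, the loop which is \<open>1/z\<close> on one
  of the three and \<open>z\<close> on the other two extends, and the product of these three loops is \<open>z\<close> on \<open>H\<close>.

  The norm of \<open>\<Sum> a\<^sub>k \<otimes> b\<^sub>k\<close> in \<open>C(X) \<otimes> L(H)\<close> dominates the norms of its values \<open>\<Sum> a\<^sub>k(x) b\<^sub>k\<close>, by
  approximate eigenvectors, and for \<open>X = S\<^sup>1\<close> it is their supremum: on the sums of
  \<open>w\<^sup>-\<^sup>j U\<^sup>j x\<close> over \<open>j < N\<close> a unitary \<open>U\<close> acts almost as the scalar \<open>w\<close>, and their squared norms are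
  \<open>N \<parallel>x\<parallel>\<^sup>2\<close> on average over \<open>w\<close>. Hence restriction to the circle extends to the minimal tensor
  products for any choice of faithful representations. The same vectors bound Laurent polynomials in \<open>u\<close> by their supremum on the circle
  and so provide the functional calculus \<open>f \<mapsto> f(u)\<close>.
\<close>

section \<open>Adjoints\<close>

text \<open>For H of finite dimension n > 0 no such unitary exists: its determinant would be a
  nonvanishing function on the disk with boundary value z^n, of winding number n. A rotation
  therefore has to pair z with 1/z, and only infinite dimension lets the unequal shares of one and
  two summands balance. Every factor has exponent +1 or -1 on each summand, so a product equal to z
  needs an odd number of factors; a single one would leave no summand for 1/z, hence three.

  The formal obstacle is that \<open>rep\<close> is an arbitrary choice, known only to be faithful.
  An element of the tensor product is then an operator without visible values at points, and a sum
  of elementary tensors does not determine its presentation. The map in \<open>tensor_hom\<close>,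
  given by a definite description, is available only once the norm over the circle has been bounded
  by the norm over the disk for all finite sums.\<close>

lemma cinner_add_left: "cinner (x + y) z = cinner x z + cinner y (z::'h::complex_hilbert)"
  by (metis cinner_add_right cinner_commute complex_cnj_add)

lemma cinner_scaleC_left: "cinner (c *\<^sub>C x) (y::'h::complex_hilbert) = cnj c * cinner x y"
  by (metis cinner_commute cinner_scaleC_right complex_cnj_mult)

lemma cinner_zero_right [simp]: "cinner (x::'h::complex_hilbert) 0 = 0"
  by (metis add_cancel_right_left cinner_add_right)

lemma cinner_zero_left [simp]: "cinner 0 (x::'h::complex_hilbert) = 0"
  by (metis cinner_commute cinner_zero_right complex_cnj_zero)

lemma cinner_minus_right [simp]: "cinner (x::'h::complex_hilbert) (- y) = - cinner x y"
  using cinner_scaleC_right[of x "-1" y] by simp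

lemma cinner_minus_left [simp]: "cinner (- x) (y::'h::complex_hilbert) = - cinner x y"
  using cinner_scaleC_left[of "-1" x y] by simp

lemma cinner_diff_right: "cinner (x::'h::complex_hilbert) (y - z) = cinner x y - cinner x z"
  using cinner_add_right[of x y "- z"] by simp

lemma cinner_diff_left: "cinner (x - y) (z::'h::complex_hilbert) = cinner x z - cinner y z"
  using cinner_add_left[of x "- y" z] by simp

lemma cinner_sum_right: "cinner (x::'h::complex_hilbert) (\<Sum>i\<in>I. f i) = (\<Sum>i\<in>I. cinner x (f i))"
  by (induction I rule: infinite_finite_induct) (simp_all add: cinner_add_right)

lemma cinner_sum_left: "cinner (\<Sum>i\<in>I. f i) (x::'h::complex_hilbert) = (\<Sum>i\<in>I. cinner (f i) x)"
  by (induction I rule: infinite_finite_induct) (simp_all add: cinner_add_left)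

lemma scaleC_sum_right: "c *\<^sub>C (\<Sum>i\<in>I. f i) = (\<Sum>i\<in>I. c *\<^sub>C (f i :: 'h::complex_hilbert))"
  by (simp add: cvec.scale_sum_right)

lemma norm_scaleC [simp]: "norm (c *\<^sub>C (x::'h::complex_hilbert)) = cmod c * norm x"
proof -
  have "complex_of_real ((norm (c *\<^sub>C x))\<^sup>2) = cnj c * c * complex_of_real ((norm x)\<^sup>2)"
    unfolding cinner_self[symmetric] by (simp add: cinner_scaleC_left cinner_scaleC_right)
  also have "\<dots> = complex_of_real ((cmod c * norm x)\<^sup>2)"
    by (simp add: complex_norm_square power_mult_distrib mult.commute flip: of_real_power)
  finally have "(norm (c *\<^sub>C x))\<^sup>2 = (cmod c * norm x)\<^sup>2"
    by (simp only: of_real_eq_iff)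
  then show ?thesis by simp
qed

lemma power2_norm_add:
  "(norm (x + y :: 'h::complex_hilbert))\<^sup>2 = (norm x)\<^sup>2 + (norm y)\<^sup>2 + 2 * Re (cinner x y)"
proof -
  have "complex_of_real ((norm (x + y))\<^sup>2) =
      complex_of_real ((norm x)\<^sup>2) + complex_of_real ((norm y)\<^sup>2) + (cinner x y + cnj (cinner x y))"
    unfolding cinner_self[symmetric] cinner_commute[of y x, symmetric]
    by (simp add: cinner_add_left cinner_add_right)
  then show ?thesis
    by (metis (no_types, lifting) complex_add_cnj of_real_add of_real_eq_iff)
qed

lemma parallelogram:
  "(norm (x + y))\<^sup>2 + (norm (x - y))\<^sup>2 = 2 * (norm x)\<^sup>2 + 2 * (norm (y :: 'h::complex_hilbert))\<^sup>2"
  using power2_norm_add[of x y] power2_norm_add[of x "- y"] by simp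

text \<open>The norm belongs to the class, so Cauchy-Schwarz is read off backwards from the triangle
  inequality by expanding the squared norm of x + y.\<close>

lemma Re_cinner_le: "Re (cinner x y) \<le> norm x * norm (y :: 'h::complex_hilbert)"
proof -
  have "(norm (x + y))\<^sup>2 \<le> (norm x + norm y)\<^sup>2"
    by (simp add: norm_triangle_ineq power_mono)
  then show ?thesis
    by (simp add: power2_norm_add power2_sum)
qed

lemma cmod_cinner_le: "cmod (cinner x y) \<le> norm x * norm (y :: 'h::complex_hilbert)"
proof (cases "cinner x y = 0")
  case False
  \<comment> \<open>A unit scalar turns y so that its inner product with x becomes real and
    nonnegative, which reduces the claim to real parts.\<close>
  define c where "c = cnj (cinner x y) / cmod (cinner x y)"
  have c: "cmod c = 1" using False by (simp add: c_def norm_divide)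
  have "c * cinner x y = complex_of_real (cmod (cinner x y))"
    using False by (simp add: c_def complex_norm_square[symmetric] mult.commute power2_eq_square)
  then have "cmod (cinner x y) = Re (cinner x (c *\<^sub>C y))"
    by (simp add: cinner_scaleC_right)
  also have "\<dots> \<le> norm x * norm y"
    using Re_cinner_le[of x "c *\<^sub>C y"] c by simp
  finally show ?thesis .
qed simp

section \<open>The Riesz representation theorem\<close>

lemma cinner_ext: "(\<And>z. cinner z x = cinner z y) \<Longrightarrow> x = (y :: 'h::complex_hilbert)"
  using cinner_self[of "x - y"] by (simp add: cinner_diff_right)

lemma bounded_linear_cinner: "bounded_linear (cinner (x :: 'h::complex_hilbert))"
proof (rule bounded_linear_intro)
  show "cinner x (r *\<^sub>R y) = r *\<^sub>R cinner x y" for r y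
    by (metis cinner_scaleC_right scaleC_of_real scaleR_conv_of_real)
  show "norm (cinner x y) \<le> norm y * norm x" for y
    using cmod_cinner_le[of x y] by (simp add: mult.commute)
qed (rule cinner_add_right)

lemma bounded_linear_scaleC: "bounded_linear (\<lambda>x :: 'h::complex_hilbert. c *\<^sub>C x)"
proof (rule bounded_linear_intro)
  show "c *\<^sub>C (r *\<^sub>R y) = r *\<^sub>R (c *\<^sub>C y)" for r and y :: 'h
    by (metis mult.commute scaleC_of_real scaleC_scaleC)
  show "norm (c *\<^sub>C y) \<le> norm y * cmod c" for y :: 'h
    by (simp add: mult.commute)
qed (rule scaleC_add_right)

lemmas scaleC_scaleR = linear_simps(5)[OF bounded_linear_scaleC]

text \<open>A vector x0 of least norm m on the affine hyperplane f = 1 is orthogonal to the kernel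
  of f, and f is the inner product with x0 / m^2. Completeness provides x0, since the parallelogram
  law makes a minimising sequence Cauchy.\<close>

theorem riesz_representation:
  fixes f :: "'h::complex_hilbert \<Rightarrow> complex"
  assumes f: "bounded_linear f" and fC: "\<And>c x. f (c *\<^sub>C x) = c * f x"
  shows "\<exists>y. \<forall>x. f x = cinner y x"
proof (cases "\<exists>x. f x \<noteq> 0")
  case False
  then show ?thesis by (intro exI[of _ 0]) simp
next
  case True
  interpret f: bounded_linear f by (rule f)
  note f_scaleR = linear_simps(5)[OF f]
  define S where "S = {x. f x = 1}"
  from True obtain x1 where "f x1 \<noteq> 0" by blast
  then have "inverse (f x1) *\<^sub>C x1 \<in> S" by (simp add: S_def fC)
  then have Sne: "norm ` S \<noteq> {}" by blast
  define m where "m = Inf (norm ` S)"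
  have bdd: "bdd_below (norm ` S)" by (rule bdd_belowI2[of _ 0]) simp
  have m_le: "m \<le> norm x" if "x \<in> S" for x
    unfolding m_def using bdd that by (intro cInf_lower) auto
  have m0: "0 \<le> m"
    unfolding m_def using Sne by (intro cInf_greatest) auto
  have "\<exists>x\<in>S. norm x < m + 1 / real (Suc n)" for n
  proof -
    have "m < m + 1 / real (Suc n)" by simp
    then obtain r where "r \<in> norm ` S" "r < m + 1 / real (Suc n)"
      using cInf_lessD[OF Sne] unfolding m_def by blast
    then show ?thesis by blast
  qed
  then obtain X where XS: "\<And>n. X n \<in> S" and Xm: "\<And>n. norm (X n) < m + 1 / real (Suc n)"
    by metis
  \<comment> \<open>The midpoint of two points of S lies in S, so its norm is at least m; the
    parallelogram law turns this into a bound on their distance.\<close>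
  have near: "(norm (x - y))\<^sup>2 \<le> 2 * ((norm x)\<^sup>2 - m\<^sup>2) + 2 * ((norm y)\<^sup>2 - m\<^sup>2)"
    if "x \<in> S" "y \<in> S" for x y
  proof -
    have "(1/2) *\<^sub>R (x + y) \<in> S" using that by (simp add: S_def f_scaleR f.add scaleR_conv_of_real)
    then have "2 * m \<le> norm (x + y)" using m_le by fastforce
    then have "(2 * m)\<^sup>2 \<le> (norm (x + y))\<^sup>2" using m0 by (intro power_mono) auto
    then show ?thesis using parallelogram[of x y] by (simp add: power_mult_distrib)
  qed
  have gap: "(norm (X n))\<^sup>2 - m\<^sup>2 \<le> (2 * m + 1) * (1 / real (Suc n))" for n
  proof -
    define t where "t = 1 / real (Suc n)"
    have t: "0 \<le> t" "t \<le> 1" by (simp_all add: t_def)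
    have "(norm (X n))\<^sup>2 \<le> (m + t)\<^sup>2"
      using Xm[of n] by (intro power_mono) (auto simp: t_def)
    moreover have "t * t \<le> t" using t by (simp add: mult_left_le)
    ultimately show ?thesis unfolding t_def[symmetric]
      by (simp add: power2_eq_square algebra_simps)
  qed
  have "Cauchy X"
  proof (rule metric_CauchyI)
    fix e :: real assume "e > 0"
    then have "0 < e\<^sup>2 / (4 * (2 * m + 1))" using m0 by simp
    then obtain N where N: "1 / real (Suc N) < e\<^sup>2 / (4 * (2 * m + 1))"
      using nat_approx_posE by blast
    have gapN: "(norm (X n))\<^sup>2 - m\<^sup>2 < e\<^sup>2 / 4" if "n \<ge> N" for n
    proof -
      have "1 / real (Suc n) \<le> 1 / real (Suc N)" using that by (simp add: frac_le)
      also note N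
      finally have "(2 * m + 1) * (1 / real (Suc n)) < (2 * m + 1) * (e\<^sup>2 / (4 * (2 * m + 1)))"
        using m0 by (intro mult_strict_left_mono) auto
      also have "\<dots> = e\<^sup>2 / 4" using m0 by (simp add: field_simps add_eq_0_iff)
      finally show ?thesis using gap[of n] by linarith
    qed
    have "dist (X i) (X j) < e" if "i \<ge> N" "j \<ge> N" for i j
    proof -
      note near[OF XS XS, of i j]
      also have "2 * ((norm (X i))\<^sup>2 - m\<^sup>2) + 2 * ((norm (X j))\<^sup>2 - m\<^sup>2)
          < 2 * (e\<^sup>2 / 4) + 2 * (e\<^sup>2 / 4)"
        by (intro add_strict_mono mult_strict_left_mono gapN that) auto
      finally have "(norm (X i - X j))\<^sup>2 < e\<^sup>2" by simp
      then show ?thesis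
        unfolding dist_norm using \<open>e > 0\<close> by (simp add: power_less_imp_less_base)
    qed
    then show "\<exists>M. \<forall>i\<ge>M. \<forall>j\<ge>M. dist (X i) (X j) < e" by blast
  qed
  then obtain x0 where lim: "X \<longlonglongrightarrow> x0" by (metis Cauchy_convergent convergentD)
  have "(\<lambda>n. f (X n)) \<longlonglongrightarrow> f x0" using lim by (rule f.tendsto)
  then have fx0: "f x0 = 1" using XS by (simp add: S_def LIMSEQ_const_iff)
  have "norm x0 \<le> m + 0"
  proof (rule LIMSEQ_le)
    show "(\<lambda>n. norm (X n)) \<longlonglongrightarrow> norm x0" using lim by (rule tendsto_norm)
    show "(\<lambda>n. m + 1 / real (Suc n)) \<longlonglongrightarrow> m + 0"
      by (intro tendsto_add tendsto_const) (rule LIMSEQ_Suc, rule lim_1_over_n)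
    show "\<exists>N. \<forall>n\<ge>N. norm (X n) \<le> m + 1 / real (Suc n)" using Xm by (meson less_imp_le)
  qed
  then have x0m: "norm x0 = m" using m_le[of x0] fx0 by (simp add: S_def)
  have m_pos: "m > 0" using fx0 x0m m0 f.zero by (metis less_eq_real_def norm_eq_zero zero_neq_one)
  have orth: "Re (cinner x0 z) = 0" if z: "f z = 0" for z
  proof (rule ccontr)
    assume ne: "Re (cinner x0 z) \<noteq> 0"
    define r where "r = Re (cinner x0 z)"
    have "z \<noteq> 0" using ne by auto
    \<comment> \<open>This t minimises the quadratic polynomial that gives the squared norm of x0 +
      t z, so the minimality of x0 forces r = 0.\<close>
    define t where "t = - r / (norm z)\<^sup>2"
    have "x0 + t *\<^sub>R z \<in> S" using fx0 z by (simp add: S_def f.add f_scaleR)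
    then have "m\<^sup>2 \<le> (norm (x0 + t *\<^sub>R z))\<^sup>2" using m_le m0 by (intro power_mono) auto
    also have "\<dots> = m\<^sup>2 + t\<^sup>2 * (norm z)\<^sup>2 + 2 * (t * r)"
      unfolding power2_norm_add x0m r_def
      by (simp add: power_mult_distrib linear_simps(5)[OF bounded_linear_cinner])
    also have "t\<^sup>2 * (norm z)\<^sup>2 + 2 * (t * r) = - (r\<^sup>2 / (norm z)\<^sup>2)"
      using \<open>z \<noteq> 0\<close> by (simp add: t_def power2_eq_square field_simps)
    then have "m\<^sup>2 + t\<^sup>2 * (norm z)\<^sup>2 + 2 * (t * r) = m\<^sup>2 - r\<^sup>2 / (norm z)\<^sup>2" by linarith
    finally have "r\<^sup>2 / (norm z)\<^sup>2 \<le> 0" by simp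
    moreover have "r\<^sup>2 / (norm z)\<^sup>2 > 0" using ne \<open>z \<noteq> 0\<close> by (simp add: r_def)
    ultimately show False by simp
  qed
  have orth': "cinner x0 z = 0" if z: "f z = 0" for z
  proof (rule complex_eqI)
    show "Re (cinner x0 z) = Re 0" using orth[OF z] by simp
    have "f (\<i> *\<^sub>C z) = 0" using z by (simp add: fC)
    from orth[OF this] show "Im (cinner x0 z) = Im 0" by (simp add: cinner_scaleC_right)
  qed
  have "f x = cinner (complex_of_real (1 / m\<^sup>2) *\<^sub>C x0) x" for x
  proof -
    have "f (x - f x *\<^sub>C x0) = 0" by (simp add: f.diff fC fx0)
    from orth'[OF this] have "cinner x0 x = f x * complex_of_real (m\<^sup>2)"
      by (simp add: cinner_diff_right cinner_scaleC_right cinner_self x0m)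
    then show ?thesis using m_pos by (simp add: cinner_scaleC_left)
  qed
  then show ?thesis by blast
qed

section \<open>The algebra of bounded complex linear operators\<close>

lemma Lop_simps:
  "add Lop = (+)" "mult Lop = (o\<^sub>L)" "star Lop = adjoint_op" "unit Lop = id_blinfun"
  by (simp_all add: Lop_def)

lemma Lop_iff: "T \<in> carrier Lop \<longleftrightarrow> (\<forall>c x. blinfun_apply T (c *\<^sub>C x) = c *\<^sub>C blinfun_apply T x)"
  by (simp add: Lop_def)

lemma Lop_scaleC: "T \<in> carrier Lop \<Longrightarrow> blinfun_apply T (c *\<^sub>C x) = c *\<^sub>C blinfun_apply T x"
  by (simp add: Lop_iff)

lemma scale_Lop_apply [simp]: "blinfun_apply (scale Lop c T) x = c *\<^sub>C blinfun_apply T x"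
proof -
  have "bounded_linear (\<lambda>x. c *\<^sub>C blinfun_apply T x)"
    using bounded_linear_compose[OF bounded_linear_scaleC blinfun.bounded_linear_right] .
  then show ?thesis by (simp add: Lop_def bounded_linear_Blinfun_apply)
qed

lemma scale_Lop_of_real: "scale Lop (complex_of_real r) T = r *\<^sub>R T"
  by (rule blinfun_eqI) (simp add: scaleC_of_real blinfun.scaleR_left)

lemma scale_Lop_minus1 [simp]: "scale Lop (-1) T = - T"
  by (rule blinfun_eqI) (simp add: blinfun.minus_left)

lemma bounded_linear_scale_Lop: "bounded_linear (scale Lop c :: ('h::complex_hilbert \<Rightarrow>\<^sub>L 'h) \<Rightarrow> _)"
proof (rule bounded_linear_intro)
  show "scale Lop c (S + T) = scale Lop c S + scale Lop c T" for S T :: "'h \<Rightarrow>\<^sub>L 'h"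
    by (rule blinfun_eqI) (simp add: blinfun.add_left scaleC_add_right)
  show "scale Lop c (r *\<^sub>R T) = r *\<^sub>R scale Lop c T" for r and T :: "'h \<Rightarrow>\<^sub>L 'h"
    by (rule blinfun_eqI) (simp add: blinfun.scaleR_left scaleC_scaleR)
  show "norm (scale Lop c T) \<le> norm T * cmod c" for T :: "'h \<Rightarrow>\<^sub>L 'h"
  proof (rule norm_blinfun_bound)
    show "norm (blinfun_apply (scale Lop c T) x) \<le> norm T * cmod c * norm x" for x
      using mult_left_mono[OF norm_blinfun[of T x] norm_ge_zero[of c]] by (simp add: ac_simps)
  qed simp
qed

lemma Lop_add [intro]: "S \<in> carrier Lop \<Longrightarrow> T \<in> carrier Lop \<Longrightarrow> S + T \<in> carrier Lop"
  by (simp add: Lop_iff blinfun.add_left scaleC_add_right)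

lemma Lop_zero [intro, simp]: "0 \<in> carrier Lop"
  by (simp add: Lop_iff)

lemma Lop_sum [intro]: "(\<And>i. i \<in> I \<Longrightarrow> T i \<in> carrier Lop) \<Longrightarrow> (\<Sum>i\<in>I. T i) \<in> carrier Lop"
  by (induction I rule: infinite_finite_induct) auto

lemma Lop_minus [intro]: "T \<in> carrier Lop \<Longrightarrow> - T \<in> carrier Lop"
  by (simp add: Lop_iff blinfun.minus_left)

lemma Lop_diff [intro]: "S \<in> carrier Lop \<Longrightarrow> T \<in> carrier Lop \<Longrightarrow> S - T \<in> carrier Lop"
  using Lop_add[of S "- T"] by auto

lemma Lop_scale [intro]: "T \<in> carrier Lop \<Longrightarrow> scale Lop c T \<in> carrier Lop"
  by (simp add: Lop_iff scaleC_scaleC mult.commute)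

lemma Lop_compose [intro]: "S \<in> carrier Lop \<Longrightarrow> T \<in> carrier Lop \<Longrightarrow> S o\<^sub>L T \<in> carrier Lop"
  by (simp add: Lop_iff)

lemma Lop_id [intro, simp]: "id_blinfun \<in> carrier Lop"
  by (simp add: Lop_iff)

lemma closed_Lop: "closed (carrier Lop :: ('h::complex_hilbert \<Rightarrow>\<^sub>L 'h) set)"
proof -
  have eq: "(carrier Lop :: ('h \<Rightarrow>\<^sub>L 'h) set) =
      (\<Inter>c. \<Inter>x. {T. blinfun_apply T (c *\<^sub>C x) - c *\<^sub>C blinfun_apply T x = 0})"
    by (auto simp: Lop_iff)
  have cont: "continuous_on UNIV (\<lambda>T :: 'h \<Rightarrow>\<^sub>L 'h. blinfun_apply T (c *\<^sub>C x) - c *\<^sub>C blinfun_apply T x)"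
    for c x
    by (intro continuous_intros bounded_linear.continuous_on[OF bounded_linear_scaleC])
  show ?thesis
    unfolding eq by (intro closed_INT ballI closed_Collect_eq cont continuous_on_const)
qed

text \<open>\<open>adjoint_op\<close> is a definite description, and nondegeneracy of the inner
  product makes its solution unique. Adjoints are computed below by exhibiting a candidate.\<close>

lemma adjoint_op_eqI:
  assumes "\<And>x y. cinner (blinfun_apply S x) y = cinner x (blinfun_apply T y)"
  shows "adjoint_op T = S"
  unfolding adjoint_op_def
proof (rule the_equality)
  show "\<forall>x y. cinner (blinfun_apply S x) y = cinner x (blinfun_apply T y)" using assms by blast
  fix R assume "\<forall>x y. cinner (blinfun_apply R x) y = cinner x (blinfun_apply T y)"
  then show "R = S"
    by (intro blinfun_eqI cinner_ext) (metis assms cinner_commute)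
qed

text \<open>Riesz, applied to the functional that sends y to the inner product of x and T y, yields
  the value of the adjoint at x. Complex linearity of T makes this functional complex linear, and
  testing it at that value bounds the norm.\<close>

lemma adjoint_op_cinner:
  fixes T :: "'h::complex_hilbert \<Rightarrow>\<^sub>L 'h"
  assumes T: "T \<in> carrier Lop"
  shows "cinner (blinfun_apply (adjoint_op T) x) y = cinner x (blinfun_apply T y)"
proof -
  have "\<exists>s. \<forall>y. cinner x (blinfun_apply T y) = cinner s y" for x
  proof (rule riesz_representation)
    show "bounded_linear (\<lambda>y. cinner x (blinfun_apply T y))"
      by (rule bounded_linear_compose[OF bounded_linear_cinner blinfun.bounded_linear_right])
  qed (simp add: Lop_scaleC[OF T] cinner_scaleC_right)
  then obtain s where s: "\<And>x y. cinner (s x) y = cinner x (blinfun_apply T y)" by metis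
  have s': "cinner y (s x) = cinner (blinfun_apply T y) x" for x y
    by (metis s cinner_commute)
  have "bounded_linear s"
  proof (rule bounded_linear_intro)
    show "s (x + y) = s x + s y" for x y
      by (rule cinner_ext) (simp add: s' cinner_add_right)
    show "s (r *\<^sub>R x) = r *\<^sub>R s x" for r x
      by (rule cinner_ext) (simp add: s' cinner_scaleC_right flip: scaleC_of_real)
    show "norm (s x) \<le> norm x * norm T" for x
    proof (cases "s x = 0")
      case False
      have "(norm (s x))\<^sup>2 = cmod (cinner x (blinfun_apply T (s x)))"
        by (simp add: cinner_self norm_power flip: s of_real_power)
      also have "\<dots> \<le> norm x * (norm T * norm (s x))"
        by (rule order_trans[OF cmod_cinner_le]) (intro mult_left_mono norm_blinfun norm_ge_zero)
      finally show ?thesis using False by (simp add: power2_eq_square)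
    qed simp
  qed
  then have *: "cinner (blinfun_apply (Blinfun s) x) y = cinner x (blinfun_apply T y)" for x y
    by (simp add: bounded_linear_Blinfun_apply s)
  show ?thesis unfolding adjoint_op_eqI[of "Blinfun s" T, OF *] by (rule *)
qed

lemma cinner_adjoint_op:
  "T \<in> carrier Lop \<Longrightarrow> cinner x (blinfun_apply (adjoint_op T) y) = cinner (blinfun_apply T x) y"
  by (metis adjoint_op_cinner cinner_commute)

lemma Lop_adjoint [intro]: "T \<in> carrier Lop \<Longrightarrow> adjoint_op T \<in> carrier Lop"
  unfolding Lop_iff[of "adjoint_op T"]
  by (intro allI cinner_ext) (simp add: cinner_adjoint_op cinner_scaleC_right)

lemma adjoint_adjoint [simp]: "T \<in> carrier Lop \<Longrightarrow> adjoint_op (adjoint_op T) = T"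
  by (rule adjoint_op_eqI) (simp add: cinner_adjoint_op)

lemma adjoint_compose:
  "S \<in> carrier Lop \<Longrightarrow> T \<in> carrier Lop \<Longrightarrow> adjoint_op (S o\<^sub>L T) = adjoint_op T o\<^sub>L adjoint_op S"
  by (rule adjoint_op_eqI) (simp add: adjoint_op_cinner)

lemma adjoint_add:
  "S \<in> carrier Lop \<Longrightarrow> T \<in> carrier Lop \<Longrightarrow> adjoint_op (S + T) = adjoint_op S + adjoint_op T"
  by (rule adjoint_op_eqI) (simp add: adjoint_op_cinner blinfun.add_left cinner_add_left cinner_add_right)

lemma adjoint_diff:
  "S \<in> carrier Lop \<Longrightarrow> T \<in> carrier Lop \<Longrightarrow> adjoint_op (S - T) = adjoint_op S - adjoint_op T"
  by (rule adjoint_op_eqI) (simp add: adjoint_op_cinner blinfun.diff_left cinner_diff_left cinner_diff_right)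

lemma adjoint_scale:
  "T \<in> carrier Lop \<Longrightarrow> adjoint_op (scale Lop c T) = scale Lop (cnj c) (adjoint_op T)"
  by (rule adjoint_op_eqI) (simp add: adjoint_op_cinner cinner_scaleC_left cinner_scaleC_right)

lemma adjoint_id [simp]: "adjoint_op id_blinfun = id_blinfun"
  by (rule adjoint_op_eqI) simp

lemma norm_adjoint_le:
  assumes T: "T \<in> carrier Lop"
  shows "norm (adjoint_op T) \<le> norm T"
proof (rule norm_blinfun_bound)
  fix x
  let ?s = "blinfun_apply (adjoint_op T) x"
  show "norm ?s \<le> norm T * norm x"
  proof (cases "?s = 0")
    case False
    have "(norm ?s)\<^sup>2 = cmod (cinner x (blinfun_apply T ?s))"
      by (simp add: cinner_self norm_power flip: adjoint_op_cinner[OF T] of_real_power)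
    also have "\<dots> \<le> norm x * (norm T * norm ?s)"
      by (rule order_trans[OF cmod_cinner_le]) (intro mult_left_mono norm_blinfun norm_ge_zero)
    finally show ?thesis using False by (simp add: power2_eq_square mult.commute)
  qed simp
qed simp

lemma power2_norm_apply:
  "T \<in> carrier Lop \<Longrightarrow>
    complex_of_real ((norm (blinfun_apply T x))\<^sup>2) = cinner x (blinfun_apply (adjoint_op T o\<^sub>L T) x)"
  by (simp add: cinner_adjoint_op cinner_self)

lemma isometry_norm:
  assumes "U \<in> carrier Lop" "adjoint_op U o\<^sub>L U = id_blinfun"
  shows "norm (blinfun_apply U x) = norm x"
proof -
  have "complex_of_real ((norm (blinfun_apply U x))\<^sup>2) = complex_of_real ((norm x)\<^sup>2)"
    by (simp only: power2_norm_apply[OF assms(1)] assms(2) id_blinfun.rep_eq id_apply cinner_self)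
  then show ?thesis by (simp only: of_real_eq_iff) simp
qed

lemma tendsto_adjoint:
  assumes "T \<longlonglongrightarrow> T'" "\<And>n. T n \<in> carrier Lop"
  shows "(\<lambda>n. adjoint_op (T n)) \<longlonglongrightarrow> adjoint_op T'"
proof -
  have T': "T' \<in> carrier Lop"
    using closed_sequentially[OF closed_Lop] assms by blast
  have "(\<lambda>n. norm (T n - T')) \<longlonglongrightarrow> 0"
    using assms(1) by (simp add: LIM_zero tendsto_norm_zero)
  then have "(\<lambda>n. adjoint_op (T n) - adjoint_op T') \<longlonglongrightarrow> 0"
  proof (rule Lim_null_comparison[rotated], intro always_eventually allI)
    show "norm (adjoint_op (T n) - adjoint_op T') \<le> norm (T n - T')" for n
      using norm_adjoint_le[of "T n - T'"] assms(2)[of n] T' by (auto simp: adjoint_diff)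
  qed
  then show ?thesis by (simp add: LIM_zero_iff)
qed

section \<open>Operators on square-summable families\<close>

lemma ell2_coeff_Abs: "(\<lambda>i. (cmod (f i))\<^sup>2) summable_on UNIV \<Longrightarrow> ell2_coeff (Abs_ell2 f) = f"
  by (simp add: Abs_ell2_inverse)

lemmas ell2_coeff_simps = zero_ell2.rep_eq plus_ell2.rep_eq uminus_ell2.rep_eq minus_ell2.rep_eq
  scaleR_ell2.rep_eq scaleC_ell2.rep_eq

lemma has_sum_norm_ell2: "((\<lambda>i. (cmod (ell2_coeff x i))\<^sup>2) has_sum (norm x)\<^sup>2) UNIV"
  unfolding norm_ell2_def using has_sum_infsum[OF ell2_summable[of x]]
  by (simp add: infsum_nonneg)

lemma has_sum_cinner_ell2:
  "((\<lambda>i. cnj (ell2_coeff x i) * ell2_coeff y i) has_sum cinner x y) UNIV"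
  unfolding cinner_ell2_def by (rule has_sum_infsum[OF sq_summable_inner[OF ell2_summable ell2_summable]])

definition ket :: "'i \<Rightarrow> 'i ell2" where
  "ket i = Abs_ell2 (\<lambda>j. if j = i then 1 else 0)"

lemma ell2_coeff_ket: "ell2_coeff (ket i) j = (if j = i then 1 else 0)"
proof -
  have "(\<lambda>j. (cmod (if j = i then 1 else 0))\<^sup>2) summable_on UNIV"
    by (rule finite_nonzero_values_imp_summable_on, rule finite_subset[of _ "{i}"]) auto
  then show ?thesis by (simp add: ket_def ell2_coeff_Abs)
qed

lemma cinner_ket: "cinner (ket i) x = ell2_coeff x i"
proof -
  have "((\<lambda>j. cnj (ell2_coeff (ket i) j) * ell2_coeff x j) has_sum ell2_coeff x i) UNIV"
    by (rule has_sum_cong_neutral[THEN iffD1, OF _ _ _ has_sum_finiteI[of "{i}" _ "\<lambda>_. ell2_coeff x i"]])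
      (auto simp: ell2_coeff_ket)
  then show ?thesis using has_sum_cinner_ell2 has_sum_unique by blast
qed

lemma id_blinfun_compose [simp]: "id_blinfun o\<^sub>L T = T" "T o\<^sub>L id_blinfun = T"
  by (simp_all add: blinfun_eqI)

lemma compose_eqD:
  "S o\<^sub>L T = S' o\<^sub>L T' \<Longrightarrow> blinfun_apply S (blinfun_apply T x) = blinfun_apply S' (blinfun_apply T' x)"
  by (metis blinfun_apply_blinfun_compose)

lemma compose_idD: "S o\<^sub>L T = id_blinfun \<Longrightarrow> blinfun_apply S (blinfun_apply T x) = x"
  by (metis blinfun_apply_blinfun_compose id_blinfun.rep_eq id_apply)

lemma norm_ket [simp]: "norm (ket i) = 1"
proof -
  have "complex_of_real ((norm (ket i))\<^sup>2) = complex_of_real 1"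
    unfolding cinner_self[symmetric] cinner_ket by (simp add: ell2_coeff_ket)
  then have "(norm (ket i))\<^sup>2 = 1" unfolding of_real_eq_iff .
  then show ?thesis by (simp add: power2_eq_1_iff) (smt (verit) norm_ge_zero)
qed

text \<open>The i-th coefficient of the adjoint of S at y is the inner product of
  \<open>S (ket i)\<close> with y. Agreement on basis vectors thus makes the adjoints equal
  coefficient by coefficient.\<close>

lemma Lop_eq_ket:
  assumes "S \<in> carrier Lop" "T \<in> carrier Lop"
    and "\<And>i. blinfun_apply S (ket i) = blinfun_apply T (ket i)"
  shows "S = (T :: 'i ell2 \<Rightarrow>\<^sub>L 'i ell2)"
proof -
  have "adjoint_op S = adjoint_op T"
    by (intro blinfun_eqI ell2_eqI) (simp add: cinner_adjoint_op assms flip: cinner_ket)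
  then show ?thesis by (metis adjoint_adjoint assms(1,2))
qed

text \<open>
  A bijection \<open>e : J \<times> I \<rightarrow> K\<close> turns \<open>\<ell>\<^sup>2(K)\<close> into the direct sum of \<open>J\<close> copies of \<open>\<ell>\<^sup>2(I)\<close>, and
  \<open>amplify e S\<close> is \<open>S\<close> acting on each copy.
\<close>

definition slice :: "('j \<times> 'i \<Rightarrow> 'k) \<Rightarrow> 'j \<Rightarrow> 'k ell2 \<Rightarrow> 'i ell2" where
  "slice e j x = Abs_ell2 (\<lambda>i. ell2_coeff x (e (j, i)))"

definition amplify :: "('j \<times> 'i \<Rightarrow> 'k) \<Rightarrow> ('i ell2 \<Rightarrow>\<^sub>L 'i ell2) \<Rightarrow> ('k ell2 \<Rightarrow>\<^sub>L 'k ell2)" where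
  "amplify e S = Blinfun (\<lambda>x. THE y. \<forall>j. slice e j y = blinfun_apply S (slice e j x))"

context
  fixes e :: "'j \<times> 'i \<Rightarrow> 'k"
  assumes e: "bij e"
begin

lemma has_sum_bij: "(f has_sum s) UNIV \<longleftrightarrow> ((\<lambda>p. f (e p)) has_sum s) (UNIV \<times> UNIV)"
  using has_sum_reindex_bij_betw[OF e, of f s] by simp

lemma ell2_coeff_slice [simp]: "ell2_coeff (slice e j x) i = ell2_coeff x (e (j, i))"
proof -
  have "(\<lambda>p. (cmod (ell2_coeff x (e p)))\<^sup>2) summable_on UNIV \<times> UNIV"
    by (rule has_sum_imp_summable[OF has_sum_bij[THEN iffD1, OF has_sum_norm_ell2]])
  then have "(\<lambda>i. (cmod (ell2_coeff x (e (j, i))))\<^sup>2) summable_on UNIV"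
    using summable_on_SigmaD1[of "\<lambda>j i. (cmod (ell2_coeff x (e (j, i))))\<^sup>2" UNIV "\<lambda>_. UNIV"]
    by (simp add: case_prod_unfold)
  then show ?thesis by (simp add: slice_def ell2_coeff_Abs)
qed

lemma slice_eqI: "(\<And>j. slice e j x = slice e j y) \<Longrightarrow> x = y"
  by (rule ell2_eqI) (metis bij_pointE e ell2_coeff_slice surj_pair)

lemma slice_add: "slice e j (x + y) = slice e j x + slice e j y"
  by (rule ell2_eqI) (simp add: ell2_coeff_simps)

lemma slice_scaleC: "slice e j (c *\<^sub>C x) = c *\<^sub>C slice e j x"
  by (rule ell2_eqI) (simp add: ell2_coeff_simps)

lemma slice_scaleR: "slice e j (r *\<^sub>R x) = r *\<^sub>R slice e j x"
  by (rule ell2_eqI) (simp add: ell2_coeff_simps)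

lemma has_sum_norm_slice: "((\<lambda>j. (norm (slice e j x))\<^sup>2) has_sum (norm x)\<^sup>2) UNIV"
proof (rule has_sum_SigmaD)
  show "((\<lambda>p. (cmod (ell2_coeff x (e p)))\<^sup>2) has_sum (norm x)\<^sup>2) (UNIV \<times> UNIV)"
    by (rule has_sum_bij[THEN iffD1, OF has_sum_norm_ell2])
  show "((\<lambda>i. (cmod (ell2_coeff x (e (j, i))))\<^sup>2) has_sum (norm (slice e j x))\<^sup>2) UNIV" for j
    using has_sum_norm_ell2[of "slice e j x"] by simp
qed

lemma has_sum_cinner_slice: "((\<lambda>j. cinner (slice e j x) (slice e j y)) has_sum cinner x y) UNIV"
proof (rule has_sum_SigmaD)
  show "((\<lambda>p. cnj (ell2_coeff x (e p)) * ell2_coeff y (e p)) has_sum cinner x y) (UNIV \<times> UNIV)"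
    by (rule has_sum_bij[THEN iffD1, OF has_sum_cinner_ell2])
  show "((\<lambda>i. cnj (ell2_coeff x (e (j, i))) * ell2_coeff y (e (j, i))) has_sum
      cinner (slice e j x) (slice e j y)) UNIV" for j
    using has_sum_cinner_ell2[of "slice e j x" "slice e j y"] by simp
qed

text \<open>With \<open>slice_eqI\<close> this identifies vectors with families of slices whose
  norms are square-summable, so that the description in \<open>amplify\<close> has a
  solution.\<close>

lemma slices_exist:
  assumes "(\<lambda>j. (norm (g j))\<^sup>2) summable_on UNIV"
  shows "\<exists>y. \<forall>j. slice e j y = g j"
proof -
  define f where "f k = (case inv e k of (j, i) \<Rightarrow> ell2_coeff (g j) i)" for k
  have f: "f (e (j, i)) = ell2_coeff (g j) i" for i j
    using e by (simp add: f_def bij_is_inj inv_f_f)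
  have "(\<lambda>p. (cmod (f (e p)))\<^sup>2) summable_on UNIV \<times> UNIV"
    by (rule summable_on_SigmaI[OF _ assms]) (auto simp: f has_sum_norm_ell2)
  then have "(\<lambda>k. (cmod (f k))\<^sup>2) summable_on UNIV"
    using has_sum_bij[of "\<lambda>k. (cmod (f k))\<^sup>2"] unfolding summable_on_def by blast
  then have "ell2_coeff (Abs_ell2 f) = f" by (rule ell2_coeff_Abs)
  then have "slice e j (Abs_ell2 f) = g j" for j
    by (intro ell2_eqI) (simp add: f)
  then show ?thesis by blast
qed

text \<open>Stated for any map y that acts as S on each slice: it first shows that the map described
  in \<open>amplify\<close> is bounded, and later bounds the norm of \<open>amplify\<close>
  itself.\<close>

lemma bounded_linear_amplify:
  assumes y: "\<And>x j. slice e j (y x) = blinfun_apply S (slice e j x)"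
  shows "norm (y x) \<le> norm S * norm x" and "bounded_linear y"
proof -
  show le: "norm (y x) \<le> norm S * norm x" for x
  proof (rule power2_le_imp_le)
    show "(norm (y x))\<^sup>2 \<le> (norm S * norm x)\<^sup>2"
    proof (rule has_sum_mono[OF has_sum_norm_slice])
      show "((\<lambda>j. (norm S)\<^sup>2 * (norm (slice e j x))\<^sup>2) has_sum (norm S * norm x)\<^sup>2) UNIV"
        unfolding power_mult_distrib by (intro has_sum_cmult_right has_sum_norm_slice)
      show "(norm (slice e j (y x)))\<^sup>2 \<le> (norm S)\<^sup>2 * (norm (slice e j x))\<^sup>2" for j
        unfolding y power_mult_distrib[symmetric] by (intro power_mono norm_blinfun) simp
    qed
  qed simp
  show "bounded_linear y"
  proof (rule bounded_linear_intro)
    show "y (u + v) = y u + y v" for u v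
      by (rule slice_eqI) (simp add: y slice_add blinfun.add_right)
    show "y (r *\<^sub>R u) = r *\<^sub>R y u" for r u
      by (rule slice_eqI) (simp add: y slice_scaleR blinfun.scaleR_right)
    show "norm (y u) \<le> norm u * norm S" for u
      using le[of u] by (simp add: mult.commute)
  qed
qed

lemma slice_amplify [simp]: "slice e j (blinfun_apply (amplify e S) x) = blinfun_apply S (slice e j x)"
proof -
  have "\<exists>y. \<forall>j. slice e j y = blinfun_apply S (slice e j x)" for x
  proof (rule slices_exist, rule summable_on_comparison_test)
    show "(\<lambda>j. (norm S)\<^sup>2 * (norm (slice e j x))\<^sup>2) summable_on UNIV"
      using has_sum_norm_slice[of x] by (intro summable_on_cmult_right) (auto simp: summable_on_def)
    show "(norm (blinfun_apply S (slice e j x)))\<^sup>2 \<le> (norm S)\<^sup>2 * (norm (slice e j x))\<^sup>2" for j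
      unfolding power_mult_distrib[symmetric] by (intro power_mono norm_blinfun) simp
  qed simp
  then obtain y where y: "\<And>x j. slice e j (y x) = blinfun_apply S (slice e j x)" by metis
  have "(\<lambda>x. THE y. \<forall>j. slice e j y = blinfun_apply S (slice e j x)) = y"
    by (intro ext the_equality) (auto simp: y intro: slice_eqI)
  then have "blinfun_apply (amplify e S) = y"
    unfolding amplify_def using bounded_linear_amplify(2)[OF y]
    by (simp add: bounded_linear_Blinfun_apply)
  then show ?thesis by (simp add: y)
qed

lemma norm_amplify_le: "norm (amplify e S) \<le> norm S"
  by (rule norm_blinfun_bound) (simp_all add: bounded_linear_amplify(1))

lemma amplify_Lop [intro]: "S \<in> carrier Lop \<Longrightarrow> amplify e S \<in> carrier Lop"
  unfolding Lop_iff[of "amplify e S"]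
  by (intro allI slice_eqI) (simp add: slice_scaleC Lop_scaleC)

lemma amplify_add: "amplify e (S + T) = amplify e S + amplify e T"
  by (intro blinfun_eqI slice_eqI) (simp add: slice_add blinfun.add_left)

lemma amplify_scale: "amplify e (scale Lop c T) = scale Lop c (amplify e T)"
  by (intro blinfun_eqI slice_eqI) (simp add: slice_scaleC)

lemma amplify_compose: "amplify e (S o\<^sub>L T) = amplify e S o\<^sub>L amplify e T"
  by (intro blinfun_eqI slice_eqI) simp

lemma amplify_id: "amplify e id_blinfun = id_blinfun"
  by (intro blinfun_eqI slice_eqI) simp

lemma amplify_adjoint:
  assumes "S \<in> carrier Lop"
  shows "amplify e (adjoint_op S) = adjoint_op (amplify e S)"
proof (rule adjoint_op_eqI[symmetric])
  fix x y
  have "((\<lambda>j. cinner (slice e j x) (blinfun_apply S (slice e j y))) has_sum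
      cinner (blinfun_apply (amplify e (adjoint_op S)) x) y) UNIV"
    using has_sum_cinner_slice[of "blinfun_apply (amplify e (adjoint_op S)) x" y]
    by (simp add: adjoint_op_cinner[OF assms])
  moreover have "((\<lambda>j. cinner (slice e j x) (blinfun_apply S (slice e j y))) has_sum
      cinner x (blinfun_apply (amplify e S) y)) UNIV"
    using has_sum_cinner_slice[of x "blinfun_apply (amplify e S) y"] by simp
  ultimately show "cinner (blinfun_apply (amplify e (adjoint_op S)) x) y =
      cinner x (blinfun_apply (amplify e S) y)"
    by (rule has_sum_unique)
qed

lemma inj_amplify: "inj (amplify e)"
proof (rule injI, rule blinfun_eqI)
  fix S T :: "'i ell2 \<Rightarrow>\<^sub>L 'i ell2" and x :: "'i ell2"
  assume eq: "amplify e S = amplify e T"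
  fix j0 :: 'j
  have "(\<lambda>j. (norm (if j = j0 then x else 0))\<^sup>2) summable_on UNIV"
    by (rule finite_nonzero_values_imp_summable_on, rule finite_subset[of _ "{j0}"]) auto
  from slices_exist[OF this] obtain y where "\<forall>j. slice e j y = (if j = j0 then x else 0)" ..
  then have y: "slice e j0 y = x" by simp
  have "slice e j0 (blinfun_apply (amplify e S) y) = slice e j0 (blinfun_apply (amplify e T) y)"
    by (simp add: eq)
  then show "blinfun_apply S x = blinfun_apply T x" by (simp add: y)
qed

end

subsection \<open>Tensor products of operators\<close>

lemma bij_swap: "bij (prod.swap :: 'j \<times> 'i \<Rightarrow> 'i \<times> 'j)"
  by (simp add: bij_def inj_on_def)

lemma ell2_coeff_tensor [simp]: "ell2_coeff (x \<otimes>\<^sub>v y) (i, j) = ell2_coeff x i * ell2_coeff y j"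
  by (simp add: tensor_vec.rep_eq)

lemma slice_id_tensor: "slice id i (x \<otimes>\<^sub>v y) = ell2_coeff x i *\<^sub>C y"
  by (rule ell2_eqI) (simp add: bij_id ell2_coeff_simps)

lemma slice_swap_tensor: "slice prod.swap j (x \<otimes>\<^sub>v y) = ell2_coeff y j *\<^sub>C x"
  by (rule ell2_eqI) (simp add: bij_swap ell2_coeff_simps)

lemma ket_tensor: "ket (i, j) = ket i \<otimes>\<^sub>v ket j"
  by (rule ell2_eqI) (auto simp: ell2_coeff_ket split: prod.splits if_splits)

lemma norm_tensor_vec [simp]: "norm (x \<otimes>\<^sub>v y) = norm x * norm y"
proof -
  have "((\<lambda>i. (norm (slice id i (x \<otimes>\<^sub>v y)))\<^sup>2) has_sum (norm (x \<otimes>\<^sub>v y))\<^sup>2) UNIV"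
    by (rule has_sum_norm_slice[OF bij_id])
  moreover have "((\<lambda>i. (norm (slice id i (x \<otimes>\<^sub>v y)))\<^sup>2) has_sum ((norm x)\<^sup>2 * (norm y)\<^sup>2)) UNIV"
    unfolding slice_id_tensor norm_scaleC power_mult_distrib
    by (intro has_sum_cmult_left has_sum_norm_ell2)
  ultimately have "(norm (x \<otimes>\<^sub>v y))\<^sup>2 = (norm x * norm y)\<^sup>2"
    unfolding power_mult_distrib by (rule has_sum_unique)
  then show ?thesis by simp
qed

lemma tensor_vec_add_right: "x \<otimes>\<^sub>v (y + z) = x \<otimes>\<^sub>v y + x \<otimes>\<^sub>v z"
  by (rule ell2_eqI) (auto simp: ell2_coeff_simps algebra_simps split: prod.splits)

lemma tensor_vec_add_left: "(x + y) \<otimes>\<^sub>v z = x \<otimes>\<^sub>v z + y \<otimes>\<^sub>v z"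
  by (rule ell2_eqI) (auto simp: ell2_coeff_simps algebra_simps split: prod.splits)

lemma tensor_vec_diff_left: "(x - y) \<otimes>\<^sub>v z = x \<otimes>\<^sub>v z - y \<otimes>\<^sub>v z"
  by (rule ell2_eqI) (auto simp: ell2_coeff_simps algebra_simps split: prod.splits)

lemma tensor_vec_scale_right: "x \<otimes>\<^sub>v (c *\<^sub>C y) = c *\<^sub>C (x \<otimes>\<^sub>v y)"
  by (rule ell2_eqI) (auto simp: ell2_coeff_simps algebra_simps split: prod.splits)

lemma tensor_vec_scale_left: "(c *\<^sub>C x) \<otimes>\<^sub>v y = c *\<^sub>C (x \<otimes>\<^sub>v y)"
  by (rule ell2_eqI) (auto simp: ell2_coeff_simps algebra_simps split: prod.splits)

lemma tensor_vec_sum_right: "x \<otimes>\<^sub>v (\<Sum>i\<in>I. f i) = (\<Sum>i\<in>I. x \<otimes>\<^sub>v f i)"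
  \<comment> \<open>The instance with scalar 0 is \<open>x \<otimes>\<^sub>v 0 = 0\<close>, the case
    of the empty sum.\<close>
  using tensor_vec_scale_right[of x 0 0]
  by (induction I rule: infinite_finite_induct) (simp_all add: tensor_vec_add_right)

lemma Lop_eq_tensor:
  assumes "R \<in> carrier Lop" "R' \<in> carrier Lop"
    and "\<And>x y. blinfun_apply R (x \<otimes>\<^sub>v y) = blinfun_apply R' (x \<otimes>\<^sub>v y)"
  shows "R = R'"
proof (rule Lop_eq_ket[OF assms(1,2)])
  fix p show "blinfun_apply R (ket p) = blinfun_apply R' (ket p)"
    by (cases p) (simp add: ket_tensor assms(3))
qed

lemma amplify_id_tensor:
  assumes "T \<in> carrier Lop"
  shows "blinfun_apply (amplify id T) (x \<otimes>\<^sub>v y) = x \<otimes>\<^sub>v blinfun_apply T y"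
  by (rule slice_eqI[OF bij_id]) (simp add: bij_id slice_id_tensor Lop_scaleC assms)

lemma amplify_swap_tensor:
  assumes "S \<in> carrier Lop"
  shows "blinfun_apply (amplify prod.swap S) (x \<otimes>\<^sub>v y) = blinfun_apply S x \<otimes>\<^sub>v y"
  by (rule slice_eqI[OF bij_swap]) (simp add: bij_swap slice_swap_tensor Lop_scaleC assms)

text \<open>The two factors of (S tensor 1)(1 tensor T) are amplifications: slicing along
  \<open>id\<close> fixes the first index, so that T acts on each slice, and slicing along
  \<open>prod.swap\<close> fixes the second. This shows that the operator described in
  \<open>tensor_op\<close> exists.\<close>

lemma tensor_op_amplify:
  assumes "S \<in> carrier Lop" "T \<in> carrier Lop"
  shows "tensor_op S T = amplify prod.swap S o\<^sub>L amplify id T"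
  unfolding tensor_op_def
proof (rule the_equality)
  let ?R = "amplify prod.swap S o\<^sub>L amplify id T"
  have R: "?R \<in> carrier Lop"
    using assms by (intro Lop_compose amplify_Lop bij_id bij_swap)
  have R': "blinfun_apply ?R (x \<otimes>\<^sub>v y) = blinfun_apply S x \<otimes>\<^sub>v blinfun_apply T y" for x y
    by (simp add: amplify_id_tensor amplify_swap_tensor assms)
  show "?R \<in> carrier Lop \<and> (\<forall>x y. blinfun_apply ?R (x \<otimes>\<^sub>v y) = blinfun_apply S x \<otimes>\<^sub>v blinfun_apply T y)"
    using R R' by blast
  show "Q = ?R" if "Q \<in> carrier Lop \<and>
      (\<forall>x y. blinfun_apply Q (x \<otimes>\<^sub>v y) = blinfun_apply S x \<otimes>\<^sub>v blinfun_apply T y)" for Q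
    using that R R' by (intro Lop_eq_tensor) auto
qed

lemma tensor_op_Lop [intro]: "S \<in> carrier Lop \<Longrightarrow> T \<in> carrier Lop \<Longrightarrow> tensor_op S T \<in> carrier Lop"
  by (auto simp: tensor_op_amplify intro: bij_id bij_swap)

lemma tensor_op_apply:
  "S \<in> carrier Lop \<Longrightarrow> T \<in> carrier Lop \<Longrightarrow>
    blinfun_apply (tensor_op S T) (x \<otimes>\<^sub>v y) = blinfun_apply S x \<otimes>\<^sub>v blinfun_apply T y"
  by (simp add: tensor_op_amplify amplify_id_tensor amplify_swap_tensor)

lemma tensor_op_compose:
  assumes "S \<in> carrier Lop" "T \<in> carrier Lop" "S' \<in> carrier Lop" "T' \<in> carrier Lop"
  shows "tensor_op S T o\<^sub>L tensor_op S' T' = tensor_op (S o\<^sub>L S') (T o\<^sub>L T')"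
  using assms by (intro Lop_eq_tensor) (auto simp: tensor_op_apply Lop_compose)

lemma tensor_op_add_left:
  assumes "S \<in> carrier Lop" "T \<in> carrier Lop" "S' \<in> carrier Lop"
  shows "tensor_op (S + S') T = tensor_op S T + tensor_op S' T"
  using assms by (intro Lop_eq_tensor) (auto simp: tensor_op_apply blinfun.add_left tensor_vec_add_left Lop_add)

lemma tensor_op_add_right:
  assumes "S \<in> carrier Lop" "T \<in> carrier Lop" "T' \<in> carrier Lop"
  shows "tensor_op S (T + T') = tensor_op S T + tensor_op S T'"
  using assms by (intro Lop_eq_tensor) (auto simp: tensor_op_apply blinfun.add_left tensor_vec_add_right Lop_add)

lemma tensor_op_scale_left:
  assumes "S \<in> carrier Lop" "T \<in> carrier Lop"
  shows "tensor_op (scale Lop c S) T = scale Lop c (tensor_op S T)"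
  using assms by (intro Lop_eq_tensor) (auto simp: tensor_op_apply tensor_vec_scale_left Lop_scale)

lemma tensor_op_scale_right:
  assumes "S \<in> carrier Lop" "T \<in> carrier Lop"
  shows "tensor_op S (scale Lop c T) = scale Lop c (tensor_op S T)"
  using assms by (intro Lop_eq_tensor) (auto simp: tensor_op_apply tensor_vec_scale_right Lop_scale)

lemma tensor_op_id [simp]: "tensor_op id_blinfun id_blinfun = id_blinfun"
  by (simp add: tensor_op_amplify amplify_id[OF bij_id] amplify_id[OF bij_swap])

lemma tensor_op_adjoint:
  assumes "S \<in> carrier Lop" "T \<in> carrier Lop"
  shows "adjoint_op (tensor_op S T) = tensor_op (adjoint_op S) (adjoint_op T)"
proof -
  have "adjoint_op (tensor_op S T) = amplify id (adjoint_op T) o\<^sub>L amplify prod.swap (adjoint_op S)"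
    using assms bij_id bij_swap
    by (simp add: tensor_op_amplify adjoint_compose amplify_Lop amplify_adjoint)
  also have "\<dots> = tensor_op (adjoint_op S) (adjoint_op T)"
    using assms by (intro Lop_eq_tensor)
      (auto simp: tensor_op_apply amplify_id_tensor amplify_swap_tensor Lop_adjoint intro: bij_id bij_swap)
  finally show ?thesis .
qed

lemma norm_tensor_op_id_le: "T \<in> carrier Lop \<Longrightarrow> norm (tensor_op id_blinfun T) \<le> norm T"
  by (simp add: tensor_op_amplify amplify_id[OF bij_swap] norm_amplify_le[OF bij_id])

section \<open>Faithful representations\<close>

definition multop :: "('i \<Rightarrow> complex) \<Rightarrow> ('i ell2 \<Rightarrow>\<^sub>L 'i ell2)" where
  "multop m = Blinfun (\<lambda>x. Abs_ell2 (\<lambda>i. m i * ell2_coeff x i))"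

lemma ell2_coeff_multop [simp]:
  assumes "bounded (range m)"
  shows "ell2_coeff (blinfun_apply (multop m) x) i = m i * ell2_coeff x i"
proof -
  obtain K where K: "\<And>i. cmod (m i) \<le> K"
    using assms by (auto simp: bounded_iff)
  have le: "(cmod (m i * ell2_coeff x i))\<^sup>2 \<le> K\<^sup>2 * (cmod (ell2_coeff x i))\<^sup>2" for x i
    using K by (simp add: norm_mult power_mult_distrib mult_right_mono power_mono)
  have sq: "(\<lambda>i. (cmod (m i * ell2_coeff x i))\<^sup>2) summable_on UNIV" for x
    by (rule summable_on_comparison_test[OF summable_on_cmult_right[OF ell2_summable] le]) auto
  define f where "f x = Abs_ell2 (\<lambda>i. m i * ell2_coeff x i)" for x
  have f: "ell2_coeff (f x) i = m i * ell2_coeff x i" for x i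
    by (simp add: f_def ell2_coeff_Abs[OF sq])
  have K0: "0 \<le> K" using K[of undefined] norm_ge_zero order_trans by blast
  have "bounded_linear f"
  proof (rule bounded_linear_intro)
    show "norm (f x) \<le> norm x * K" for x
    proof (rule power2_le_imp_le)
      have "((\<lambda>i. K\<^sup>2 * (cmod (ell2_coeff x i))\<^sup>2) has_sum (K\<^sup>2 * (norm x)\<^sup>2)) UNIV"
        by (intro has_sum_cmult_right has_sum_norm_ell2)
      then show "(norm (f x))\<^sup>2 \<le> (norm x * K)\<^sup>2"
        using has_sum_mono[OF has_sum_norm_ell2[of "f x"]] le[of _ x]
        by (simp add: f power_mult_distrib mult.commute)
    qed (simp add: K0)
  qed (auto intro!: ell2_eqI simp: f ell2_coeff_simps algebra_simps)
  then show ?thesis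
    by (simp add: multop_def bounded_linear_Blinfun_apply f flip: f_def)
qed

lemma multop_Lop [intro]: "bounded (range m) \<Longrightarrow> multop m \<in> carrier Lop"
  by (auto simp: Lop_iff ell2_coeff_simps intro!: ell2_eqI)

lemma multop_adjoint:
  assumes m: "bounded (range m)"
  shows "adjoint_op (multop m) = multop (\<lambda>i. cnj (m i))"
proof (rule adjoint_op_eqI)
  fix x y
  have m': "bounded (range (\<lambda>i. cnj (m i)))" using m by (simp add: bounded_iff)
  show "cinner (blinfun_apply (multop (\<lambda>i. cnj (m i))) x) y = cinner x (blinfun_apply (multop m) y)"
    unfolding cinner_ell2_def by (simp add: m m' mult.assoc mult.left_commute)
qed

lemma Cont_simps:
  "carrier (Cont X) = {f \<in> extensional X. continuous_on X f}"
  "add (Cont X) = (\<lambda>f g. \<lambda>x\<in>X. f x + g x)"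
  "scale (Cont X) = (\<lambda>c f. \<lambda>x\<in>X. c * f x)"
  "mult (Cont X) = (\<lambda>f g. \<lambda>x\<in>X. f x * g x)"
  "star (Cont X) = (\<lambda>f. \<lambda>x\<in>X. cnj (f x))"
  "unit (Cont X) = (\<lambda>x\<in>X. 1)"
  by (simp_all add: Cont_def)

lemma Cont_I: "continuous_on X f \<Longrightarrow> restrict f X \<in> carrier (Cont X)"
  by (simp add: Cont_simps cong: continuous_on_cong)

lemma Cont_continuous: "f \<in> carrier (Cont X) \<Longrightarrow> continuous_on X f"
  by (simp add: Cont_simps)

lemma Cont_eqI:
  "f \<in> carrier (Cont X) \<Longrightarrow> g \<in> carrier (Cont X) \<Longrightarrow> (\<And>x. x \<in> X \<Longrightarrow> f x = g x) \<Longrightarrow> f = g"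
  by (auto simp: Cont_simps intro: extensionalityI)

text \<open>\<open>rep\<close> has to act on l2 indexed by the type of functions on X. A point is
  coded by its indicator function, and a function acts diagonally by its values at the coded
  points.\<close>

lemma exists_faithful_rep_Cont:
  fixes X :: "'x::topological_space set"
  assumes X: "compact X" "X \<noteq> {}"
  shows "\<exists>\<pi>. faithful_rep (Cont X) (\<pi> :: ('x \<Rightarrow> complex) \<Rightarrow> (('x \<Rightarrow> complex) ell2 \<Rightarrow>\<^sub>L _))"
proof -
  define h :: "'x \<Rightarrow> ('x \<Rightarrow> complex)" where "h x y = (if y = x then 1 else 0)" for x y
  have h: "inj_on h X"
    by (rule inj_onI) (metis h_def zero_neq_one)
  obtain x0 where x0: "x0 \<in> X" using X by blast
  \<comment> \<open>Indices that code no point repeat the evaluation at x0, so the unit acts as the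
    identity on every coordinate.\<close>
  define p where "p f = (if f \<in> h ` X then inv_into X h f else x0)" for f
  have pX: "p f \<in> X" for f by (auto simp: p_def x0 inv_into_into)
  have ph: "p (h x) = x" if "x \<in> X" for x using that h by (simp add: p_def)
  define \<pi> where "\<pi> a = multop (\<lambda>f. a (p f))" for a
  have bd: "bounded (range (\<lambda>f. a (p f)))" if "continuous_on X a" for a :: "'x \<Rightarrow> complex"
  proof (rule bounded_subset)
    show "bounded (a ` X)"
      using that X by (intro compact_imp_bounded compact_continuous_image)
  qed (use pX in auto)
  have c: "ell2_coeff (blinfun_apply (\<pi> a) x) f = a (p f) * ell2_coeff x f" if "continuous_on X a" for a x f
    using bd[OF that] by (simp add: \<pi>_def)
  have cont: "continuous_on X (\<lambda>x\<in>X. f x) \<longleftrightarrow> continuous_on X f" for f :: "'x \<Rightarrow> complex"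
    by (rule continuous_on_cong) auto
  have "unital_star_hom (Cont X) Lop \<pi>"
    unfolding unital_star_hom_def Cont_simps Lop_simps
  proof (intro conjI ballI allI)
    fix a b :: "'x \<Rightarrow> complex" and k
    assume "a \<in> {f \<in> extensional X. continuous_on X f}"
    then have a: "continuous_on X a" by simp
    show "\<pi> a \<in> carrier Lop" using bd[OF a] by (auto simp: \<pi>_def)
    show "\<pi> (\<lambda>x\<in>X. k * a x) = scale Lop k (\<pi> a)"
      using a by (intro blinfun_eqI ell2_eqI)
        (simp add: c cont continuous_intros pX ell2_coeff_simps mult.assoc)
    show "\<pi> (\<lambda>x\<in>X. cnj (a x)) = adjoint_op (\<pi> a)"
      using multop_adjoint[OF bd[OF a]] by (simp add: \<pi>_def pX)
    assume "b \<in> {f \<in> extensional X. continuous_on X f}"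
    then have b: "continuous_on X b" by simp
    show "\<pi> (\<lambda>x\<in>X. a x + b x) = \<pi> a + \<pi> b"
      using a b by (intro blinfun_eqI ell2_eqI)
        (simp add: c cont continuous_intros pX ell2_coeff_simps blinfun.add_left algebra_simps)
    show "\<pi> (\<lambda>x\<in>X. a x * b x) = \<pi> a o\<^sub>L \<pi> b"
      using a b by (intro blinfun_eqI ell2_eqI) (simp add: c cont continuous_intros pX mult.assoc)
  next
    show "\<pi> (\<lambda>x\<in>X. 1) = id_blinfun"
      by (intro blinfun_eqI ell2_eqI) (simp add: c cont pX)
  qed
  moreover have "inj_on \<pi> (carrier (Cont X))"
  proof (rule inj_onI)
    fix a b assume ab: "a \<in> carrier (Cont X)" "b \<in> carrier (Cont X)" "\<pi> a = \<pi> b"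
    show "a = b"
    proof (rule Cont_eqI[OF ab(1,2)])
      fix x assume x: "x \<in> X"
      have "ell2_coeff (blinfun_apply (\<pi> a) (ket (h x))) (h x) = ell2_coeff (blinfun_apply (\<pi> b) (ket (h x))) (h x)"
        by (simp add: ab(3))
      then show "a x = b x" using ab(1,2) x by (simp add: c Cont_continuous ph ell2_coeff_ket)
    qed
  qed
  ultimately show ?thesis unfolding faithful_rep_def by blast
qed

lemma rep_Cont:
  fixes X :: "'x::topological_space set"
  assumes "compact X" "X \<noteq> {}"
  shows "faithful_rep (Cont X) (rep (Cont X))"
  unfolding rep_def by (rule someI_ex[of "faithful_rep (Cont X)"]) (rule exists_faithful_rep_Cont[OF assms])

subsection \<open>Orthonormal bases\<close>

text \<open>
  The operator \<open>W\<close> sends a vector to its coefficients in a maximal orthonormal family, and Riesz'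
  theorem yields its inverse \<open>V\<close> without summing any series.
\<close>

theorem ell2_isomorphism:
  assumes sep: "separable_space (euclidean :: 'h::complex_hilbert topology)"
    and inf: "infinite_dimensional TYPE('h)"
  shows "\<exists>W V. (\<forall>x::'h. blinfun_apply V (blinfun_apply W x) = x) \<and>
    (\<forall>y::nat ell2. blinfun_apply W (blinfun_apply V y) = y) \<and>
    (\<forall>x y. cinner (blinfun_apply V y) x = cinner y (blinfun_apply W x))"
proof -
  define ons where "ons E \<longleftrightarrow> (\<forall>x\<in>E. cinner x x = 1) \<and> (\<forall>x\<in>E. \<forall>y\<in>E. x \<noteq> y \<longrightarrow> cinner x y = 0)"
    for E :: "'h set"
  have "\<exists>M\<in>Collect ons. \<forall>X\<in>Collect ons. M \<subseteq> X \<longrightarrow> X = M"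
  proof (rule subset_Zorn')
    fix C assume "subset.chain (Collect ons) C"
    then have C: "\<And>E. E \<in> C \<Longrightarrow> ons E" "\<And>E F. E \<in> C \<Longrightarrow> F \<in> C \<Longrightarrow> E \<subseteq> F \<or> F \<subseteq> E"
      by (auto simp: subset.chain_def)
    have "cinner x y = 0" if "E \<in> C" "x \<in> E" "F \<in> C" "y \<in> F" "x \<noteq> y" for x y E F
      using C(1)[OF that(1)] C(1)[OF that(3)] C(2)[OF that(1,3)] that unfolding ons_def by blast
    then show "\<Union>C \<in> Collect ons" using C(1) unfolding ons_def by blast
  qed
  then obtain E where E: "ons E" and maxE: "\<And>F. ons F \<Longrightarrow> E \<subseteq> F \<Longrightarrow> F = E" by blast
  have tot: "d = 0" if d: "\<And>x. x \<in> E \<Longrightarrow> cinner x d = 0" for d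
  proof (rule ccontr)
    assume "d \<noteq> 0"
    define u where "u = (1 / norm d) *\<^sub>R d"
    have "norm u = 1" using \<open>d \<noteq> 0\<close> by (simp add: u_def)
    then have u1: "cinner u u = 1" by (simp add: cinner_self)
    have u0: "cinner x u = 0" if "x \<in> E" for x
      using d[OF that] by (simp add: u_def linear_simps(5)[OF bounded_linear_cinner])
    have u0': "cinner u x = 0" if "x \<in> E" for x
      using u0[OF that] cinner_commute[of u x] by simp
    have "ons (insert u E)"
      using E u1 u0 u0' unfolding ons_def by auto
    then have "u \<in> E" using maxE by blast
    then show False using u0 u1 by force
  qed
  have normE: "norm x = 1" if "x \<in> E" for x
  proof -
    have "complex_of_real ((norm x)\<^sup>2) = complex_of_real 1"
      using E that unfolding ons_def cinner_self[symmetric] by simp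
    then have "(norm x)\<^sup>2 = 1" unfolding of_real_eq_iff .
    then show ?thesis by (simp add: power2_eq_1_iff) (smt (verit) norm_ge_zero)
  qed
  have infE: "infinite E"
  proof
    assume fin: "finite E"
    have "x \<in> cvec.span E" for x
    proof -
      have "x - (\<Sum>e\<in>E. cinner e x *\<^sub>C e) = 0"
      proof (rule tot)
        fix f assume f: "f \<in> E"
        have "(\<Sum>e\<in>E. cinner e x * cinner f e) = (\<Sum>e\<in>E. if e = f then cinner f x else 0)"
          using E f unfolding ons_def by (intro sum.cong) auto
        then show "cinner f (x - (\<Sum>e\<in>E. cinner e x *\<^sub>C e)) = 0"
          using fin f by (simp add: cinner_diff_right cinner_sum_right cinner_scaleC_right)
      qed
      then have "x = (\<Sum>e\<in>E. cinner e x *\<^sub>C e)" by simp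
      also have "\<dots> \<in> cvec.span E"
        by (intro cvec.span_sum cvec.span_scale cvec.span_base)
      finally show ?thesis .
    qed
    then have "cvec.span E = UNIV" by blast
    then show False using inf fin unfolding infinite_dimensional_def by blast
  qed
  have "countable E"
  proof -
    obtain D :: "'h set" where D: "countable D" "closure D = UNIV"
      using sep unfolding separable_space_def by auto
    have "\<exists>d\<in>D. dist d x < 1/2" for x
    proof -
      have "x \<in> closure D" using D(2) by simp
      then show ?thesis unfolding closure_approachable by (meson half_gt_zero_iff zero_less_one)
    qed
    then obtain d where d: "\<And>x. d x \<in> D" "\<And>x. dist (d x) x < 1/2" by metis
    \<comment> \<open>Orthonormal vectors are at distance sqrt 2, so two of them cannot share an
      approximation within 1/2 from the countable dense set.\<close>
    have inj: "inj_on d E"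
    proof (rule inj_onI, rule ccontr)
      fix x y assume xy: "x \<in> E" "y \<in> E" "d x = d y" "x \<noteq> y"
      have "norm (x - y) < 1"
        using dist_triangle_half_r[of "d x" x 1 y] d(2)[of x] d(2)[of y] xy(3)
        by (simp add: dist_norm)
      then have "(norm (x - y))\<^sup>2 < 1" by (simp add: power_less_one_iff)
      moreover have "cinner x y = 0" using E xy unfolding ons_def by blast
      then have "(norm (x - y))\<^sup>2 = 2"
        using power2_norm_add[of x "- y"] normE xy by simp
      ultimately show False by simp
    qed
    have "d ` E \<subseteq> D" using d(1) by blast
    then have "countable (d ` E)" using D(1) by (rule countable_subset)
    then show ?thesis using inj by (rule countable_image_inj_on)
  qed
  then obtain e :: "nat \<Rightarrow> 'h" where e: "bij_betw e UNIV E"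
    using infE by (metis bij_betw_from_nat_into)
  have eE: "e n \<in> E" for n using e by (auto simp: bij_betw_def)
  have ee: "cinner (e m) (e n) = (if m = n then 1 else 0)" for m n
  proof -
    have "e m \<noteq> e n" if "m \<noteq> n" using e that by (auto simp: bij_betw_def inj_def)
    then show ?thesis using E eE unfolding ons_def by auto
  qed
  have bessel: "(\<Sum>n\<in>F. (cmod (cinner (e n) x))\<^sup>2) \<le> (norm x)\<^sup>2" if "finite F" for F x
  proof -
    define s where "s = (\<Sum>n\<in>F. cinner (e n) x *\<^sub>C e n)"
    have es: "cinner (e m) s = cinner (e m) x" if "m \<in> F" for m
    proof -
      have "cinner (e m) s = (\<Sum>n\<in>F. if m = n then cinner (e n) x else 0)"
        unfolding s_def cinner_sum_right by (intro sum.cong) (auto simp: cinner_scaleC_right ee)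
      then show ?thesis using \<open>finite F\<close> that by simp
    qed
    have sx: "cinner s z = (\<Sum>n\<in>F. cnj (cinner (e n) x) * cinner (e n) z)" for z
      by (simp add: s_def cinner_sum_left cinner_scaleC_left)
    have "cinner s (x - s) = 0"
      unfolding sx by (intro sum.neutral) (simp add: cinner_diff_right es)
    then have "(norm x)\<^sup>2 = (norm s)\<^sup>2 + (norm (x - s))\<^sup>2"
      using power2_norm_add[of s "x - s"] by simp
    moreover have "complex_of_real ((norm s)\<^sup>2) = complex_of_real (\<Sum>n\<in>F. (cmod (cinner (e n) x))\<^sup>2)"
      unfolding cinner_self[symmetric] sx of_real_sum
      by (intro sum.cong refl) (simp add: es complex_norm_square mult.commute del: of_real_power)
    ultimately show ?thesis unfolding of_real_eq_iff by simp
  qed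
  have sq: "(\<lambda>n. (cmod (cinner (e n) x))\<^sup>2) summable_on UNIV" for x
    by (rule nonneg_bdd_above_summable_on) (auto intro!: bdd_aboveI2 bessel)
  define W where "W x = Abs_ell2 (\<lambda>n. cinner (e n) x)" for x
  have W: "ell2_coeff (W x) n = cinner (e n) x" for x n
    unfolding W_def using ell2_coeff_Abs[OF sq] by simp
  have WC: "W (c *\<^sub>C x) = c *\<^sub>C W x" for c x
    by (rule ell2_eqI) (simp add: W ell2_coeff_simps cinner_scaleC_right)
  have Wbl: "bounded_linear W"
  proof (rule bounded_linear_intro)
    show "W (x + y) = W x + W y" for x y
      by (rule ell2_eqI) (simp add: W ell2_coeff_simps cinner_add_right)
    show "W (r *\<^sub>R x) = r *\<^sub>R W x" for r x
      using WC[of "complex_of_real r"] by (simp add: scaleC_of_real)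
    show "norm (W x) \<le> norm x * 1" for x
      by (rule order_trans[OF ell2_norm_leI[of _ "norm x"]])
        (auto simp: L2_set_def W real_sqrt_le_iff intro!: real_le_lsqrt bessel)
  qed
  have "\<exists>v. \<forall>x. cinner y (W x) = cinner v x" for y
    by (rule riesz_representation)
      (auto intro: bounded_linear_compose[OF bounded_linear_cinner Wbl] simp: WC cinner_scaleC_right)
  then obtain V where V: "\<And>x y. cinner (V y) x = cinner y (W x)" by metis
  have WVy: "W (V y) = y" for y
  proof (rule ell2_eqI)
    fix n
    have ket: "W (e n) = ket n" by (rule ell2_eqI) (auto simp: W ee ell2_coeff_ket)
    have "ell2_coeff (W (V y)) n = cnj (cinner (V y) (e n))" by (simp add: W flip: cinner_commute)
    also have "\<dots> = cinner (ket n) y" by (simp add: V ket flip: cinner_commute)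
    finally show "ell2_coeff (W (V y)) n = ell2_coeff y n" by (simp add: cinner_ket)
  qed
  have VWx: "V (W x) = x" for x
  proof -
    interpret W: bounded_linear W by (rule Wbl)
    \<comment> \<open>W kills this vector, so all its coefficients with respect to E vanish and
      maximality of E applies.\<close>
    have "V (W x) - x = 0"
    proof (rule tot)
      fix f assume "f \<in> E"
      then obtain n where n: "f = e n" using e by (auto simp: bij_betw_def)
      have "W (V (W x) - x) = 0" by (simp add: W.diff WVy)
      then show "cinner f (V (W x) - x) = 0" by (simp add: n zero_ell2.rep_eq flip: W)
    qed
    then show ?thesis by simp
  qed
  have "bounded_linear V"
  proof (rule bounded_linear_intro)
    have V': "cinner x (V y) = cinner (W x) y" for x y
      by (metis V cinner_commute)
    show "V (x + y) = V x + V y" for x y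
      by (rule cinner_ext) (simp add: V' cinner_add_right)
    show "V (r *\<^sub>R y) = r *\<^sub>R V y" for r y
      by (rule cinner_ext) (simp add: V' linear_simps(5)[OF bounded_linear_cinner])
    show "norm (V y) \<le> norm y * 1" for y
    proof -
      have "complex_of_real ((norm (V y))\<^sup>2) = complex_of_real ((norm y)\<^sup>2)"
        unfolding cinner_self[symmetric] V WVy ..
      then have "(norm (V y))\<^sup>2 = (norm y)\<^sup>2" unfolding of_real_eq_iff .
      then show ?thesis by simp
    qed
  qed
  then show ?thesis
    using Wbl V WVy VWx
    by (intro exI[of _ "Blinfun W"] exI[of _ "Blinfun V"]) (simp add: bounded_linear_Blinfun_apply)
qed

section \<open>Transport of operators between H and l2 over the natural numbers\<close>

locale ell2_iso =
  fixes W :: "'h::complex_hilbert \<Rightarrow>\<^sub>L nat ell2" and V :: "nat ell2 \<Rightarrow>\<^sub>L 'h"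
  assumes VW [simp]: "blinfun_apply V (blinfun_apply W x) = x"
    and WV [simp]: "blinfun_apply W (blinfun_apply V y) = y"
    and cinner_V: "cinner (blinfun_apply V y) x = cinner y (blinfun_apply W x)"
begin

lemma cinner_W: "cinner (blinfun_apply W x) y = cinner x (blinfun_apply V y)"
  by (metis cinner_V cinner_commute)

text \<open>By type W is only real linear; complex linearity follows because W is the adjoint of
  V.\<close>

lemma W_scaleC: "blinfun_apply W (c *\<^sub>C x) = c *\<^sub>C blinfun_apply W x"
  by (rule cinner_ext) (simp add: cinner_scaleC_right flip: cinner_V)

lemma V_scaleC: "blinfun_apply V (c *\<^sub>C x) = c *\<^sub>C blinfun_apply V x"
  by (rule cinner_ext) (simp add: cinner_scaleC_right flip: cinner_W)

lemma star_hom_to: "unital_star_hom Lop Lop (\<lambda>T. W o\<^sub>L T o\<^sub>L V)"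
  unfolding unital_star_hom_def Lop_simps
proof (intro conjI ballI allI)
  fix S T :: "'h \<Rightarrow>\<^sub>L 'h" and c
  assume S: "S \<in> carrier Lop"
  show "W o\<^sub>L S o\<^sub>L V \<in> carrier Lop"
    using S by (simp add: Lop_iff W_scaleC V_scaleC)
  show "W o\<^sub>L scale Lop c S o\<^sub>L V = scale Lop c (W o\<^sub>L S o\<^sub>L V)"
    by (rule blinfun_eqI) (simp add: W_scaleC)
  show "W o\<^sub>L adjoint_op S o\<^sub>L V = adjoint_op (W o\<^sub>L S o\<^sub>L V)"
    by (rule adjoint_op_eqI[symmetric]) (simp add: cinner_W adjoint_op_cinner[OF S] cinner_V)
qed (auto intro!: blinfun_eqI simp: blinfun.add_left blinfun.add_right)

lemma star_hom_from: "unital_star_hom Lop Lop (\<lambda>T. V o\<^sub>L T o\<^sub>L W)"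
  unfolding unital_star_hom_def Lop_simps
proof (intro conjI ballI allI)
  fix S T :: "nat ell2 \<Rightarrow>\<^sub>L nat ell2" and c
  assume S: "S \<in> carrier Lop"
  show "V o\<^sub>L S o\<^sub>L W \<in> carrier Lop"
    using S by (simp add: Lop_iff W_scaleC V_scaleC)
  show "V o\<^sub>L scale Lop c S o\<^sub>L W = scale Lop c (V o\<^sub>L S o\<^sub>L W)"
    by (rule blinfun_eqI) (simp add: V_scaleC)
  show "V o\<^sub>L adjoint_op S o\<^sub>L W = adjoint_op (V o\<^sub>L S o\<^sub>L W)"
    by (rule adjoint_op_eqI[symmetric]) (simp add: cinner_W adjoint_op_cinner[OF S] cinner_V)
qed (auto intro!: blinfun_eqI simp: blinfun.add_left blinfun.add_right)

lemma infinite_Lop_type: "infinite (UNIV :: ('h \<Rightarrow>\<^sub>L 'h) set)"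
proof -
  have "inj (\<lambda>r. r *\<^sub>R (id_blinfun :: 'h \<Rightarrow>\<^sub>L 'h))"
  proof (rule injI)
    fix r s assume "r *\<^sub>R (id_blinfun :: 'h \<Rightarrow>\<^sub>L 'h) = s *\<^sub>R id_blinfun"
    then have "blinfun_apply (r *\<^sub>R id_blinfun) x = blinfun_apply (s *\<^sub>R id_blinfun) x" for x :: 'h
      by (rule arg_cong[where f = "\<lambda>T. blinfun_apply T x"])
    then have "r *\<^sub>R blinfun_apply V (ket 0) = s *\<^sub>R blinfun_apply V (ket 0)"
      by (simp add: blinfun.scaleR_left)
    moreover have "blinfun_apply V (ket 0) \<noteq> 0"
    proof
      assume "blinfun_apply V (ket 0) = 0"
      then have "blinfun_apply W 0 = ket 0" by (metis WV)
      then have "ell2_coeff (ket (0::nat)) 0 = ell2_coeff 0 (0::nat)" by (metis blinfun.zero_right)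
      then show False by (simp add: ell2_coeff_ket zero_ell2.rep_eq)
    qed
    ultimately show "r = s" by simp
  qed
  then show ?thesis
    using infinite_UNIV_char_0 finite_imageD finite_subset subset_UNIV by metis
qed

text \<open>The representation has to act on l2 indexed by the operator type. That type is infinite,
  hence in bijection with its product with \<open>nat\<close>, which makes this space a direct sum
  of copies of l2 over \<open>nat\<close>; T acts on each copy as
  \<open>W o\<^sub>L T o\<^sub>L V\<close>.\<close>

lemma rep_Lop: "faithful_rep (Lop :: ('h \<Rightarrow>\<^sub>L 'h) star_algebra) (rep Lop)"
  unfolding rep_def
proof (rule someI_ex[of "faithful_rep Lop"])
  have "\<exists>e. bij_betw e ((UNIV :: ('h \<Rightarrow>\<^sub>L 'h) set) \<times> (UNIV :: nat set)) (UNIV :: ('h \<Rightarrow>\<^sub>L 'h) set)"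
    unfolding card_of_ordIso using infinite_Lop_type
    by (intro card_of_Times_infinite_simps(1)) (auto simp flip: infinite_iff_card_of_nat)
  then obtain e :: "('h \<Rightarrow>\<^sub>L 'h) \<times> nat \<Rightarrow> ('h \<Rightarrow>\<^sub>L 'h)" where e: "bij e" by auto
  define \<pi> where "\<pi> T = amplify e (W o\<^sub>L T o\<^sub>L V)" for T
  note W = star_hom_to[unfolded unital_star_hom_def Lop_simps]
  have "unital_star_hom Lop Lop \<pi>"
    unfolding unital_star_hom_def Lop_simps \<pi>_def using W e
    by (auto simp: amplify_add amplify_scale amplify_compose amplify_adjoint amplify_id intro!: amplify_Lop)
  moreover have "inj_on \<pi> (carrier Lop)"
  proof (rule inj_onI)
    fix S T assume "\<pi> S = \<pi> T"
    then have "W o\<^sub>L S o\<^sub>L V = W o\<^sub>L T o\<^sub>L V"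
      using inj_amplify[OF e] by (auto simp: \<pi>_def dest: injD)
    then have "V o\<^sub>L (W o\<^sub>L S o\<^sub>L V) o\<^sub>L W = V o\<^sub>L (W o\<^sub>L T o\<^sub>L V) o\<^sub>L W" by simp
    moreover have "V o\<^sub>L (W o\<^sub>L R o\<^sub>L V) o\<^sub>L W = R" for R
      by (rule blinfun_eqI) simp
    ultimately show "S = T" by simp
  qed
  ultimately show "\<exists>\<pi> :: ('h \<Rightarrow>\<^sub>L 'h) \<Rightarrow> (('h \<Rightarrow>\<^sub>L 'h) ell2 \<Rightarrow>\<^sub>L _). faithful_rep Lop \<pi>"
    unfolding faithful_rep_def by blast
qed

end

section \<open>Extension of contractive homomorphisms\<close>

text \<open>Sums of elementary tensors have many presentations, so the homomorphism to be extended
  is given as a relation. Contractivity, applied to differences, makes it single-valued and carries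
  Cauchy sequences to Cauchy sequences. The locale serves both restriction to the circle and the
  functional calculus.\<close>

locale contractive_star_graph =
  fixes G :: "(('h::complex_hilbert \<Rightarrow>\<^sub>L 'h) \<times> ('k::complex_hilbert \<Rightarrow>\<^sub>L 'k)) set"
  assumes G_Lop: "(S, T) \<in> G \<Longrightarrow> S \<in> carrier Lop \<and> T \<in> carrier Lop"
    and G_id: "(id_blinfun, id_blinfun) \<in> G"
    and G_add: "(S, T) \<in> G \<Longrightarrow> (S', T') \<in> G \<Longrightarrow> (S + S', T + T') \<in> G"
    and G_scale: "(S, T) \<in> G \<Longrightarrow> (scale Lop c S, scale Lop c T) \<in> G"
    and G_compose: "(S, T) \<in> G \<Longrightarrow> (S', T') \<in> G \<Longrightarrow> (S o\<^sub>L S', T o\<^sub>L T') \<in> G"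
    and G_adjoint: "(S, T) \<in> G \<Longrightarrow> (adjoint_op S, adjoint_op T) \<in> G"
    and G_norm: "(S, T) \<in> G \<Longrightarrow> norm T \<le> norm S"
begin

lemma closure_iff:
  "(S, T) \<in> closure G \<longleftrightarrow> (\<exists>s t. (\<forall>n. (s n, t n) \<in> G) \<and> s \<longlonglongrightarrow> S \<and> t \<longlonglongrightarrow> T)"
proof
  assume "(S, T) \<in> closure G"
  then obtain p where p: "\<And>n. p n \<in> G" "p \<longlonglongrightarrow> (S, T)"
    unfolding closure_sequential by blast
  then show "\<exists>s t. (\<forall>n. (s n, t n) \<in> G) \<and> s \<longlonglongrightarrow> S \<and> t \<longlonglongrightarrow> T"
    using tendsto_fst[OF p(2)] tendsto_snd[OF p(2)]
    by (intro exI[of _ "fst \<circ> p"] exI[of _ "snd \<circ> p"]) (simp add: o_def)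
next
  assume "\<exists>s t. (\<forall>n. (s n, t n) \<in> G) \<and> s \<longlonglongrightarrow> S \<and> t \<longlonglongrightarrow> T"
  then obtain s t where "\<And>n. (s n, t n) \<in> G" "s \<longlonglongrightarrow> S" "t \<longlonglongrightarrow> T" by blast
  then show "(S, T) \<in> closure G"
    unfolding closure_sequential by (intro exI[of _ "\<lambda>n. (s n, t n)"]) (auto intro: tendsto_Pair)
qed

lemma closure_I:
  "(\<And>n. (s n, t n) \<in> G) \<Longrightarrow> s \<longlonglongrightarrow> S \<Longrightarrow> t \<longlonglongrightarrow> T \<Longrightarrow> (S, T) \<in> closure G"
  unfolding closure_iff by blast

text \<open>The operations are continuous and the norm estimate survives limits. Interpreting the
  locale a second time at the closure gives the algebraic laws of the extended map.\<close>

lemma closure_graph: "contractive_star_graph (closure G)"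
proof
  fix S S' T T' c
  show "(id_blinfun, id_blinfun) \<in> closure G" using G_id closure_subset by blast
  assume "(S, T) \<in> closure G"
  then obtain s t where st: "\<And>n. (s n, t n) \<in> G" "s \<longlonglongrightarrow> S" "t \<longlonglongrightarrow> T"
    unfolding closure_iff by blast
  have sL: "s n \<in> carrier Lop" and tL: "t n \<in> carrier Lop" for n
    using G_Lop[OF st(1)] by blast+
  show "S \<in> carrier Lop \<and> T \<in> carrier Lop"
    using closed_sequentially[OF closed_Lop, of s] closed_sequentially[OF closed_Lop, of t] sL tL st(2,3)
    by simp
  show "(scale Lop c S, scale Lop c T) \<in> closure G"
    by (rule closure_I[OF G_scale[OF st(1)]])
      (rule bounded_linear.tendsto[OF bounded_linear_scale_Lop], rule st)+
  show "(adjoint_op S, adjoint_op T) \<in> closure G"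
    by (rule closure_I[OF G_adjoint[OF st(1)] tendsto_adjoint tendsto_adjoint]) (rule st sL tL)+
  show "norm T \<le> norm S"
    by (rule LIMSEQ_le[OF tendsto_norm[OF st(3)] tendsto_norm[OF st(2)]]) (use G_norm[OF st(1)] in blast)
  assume "(S', T') \<in> closure G"
  then obtain s' t' where st': "\<And>n. (s' n, t' n) \<in> G" "s' \<longlonglongrightarrow> S'" "t' \<longlonglongrightarrow> T'"
    unfolding closure_iff by blast
  show "(S + S', T + T') \<in> closure G"
    by (rule closure_I[OF G_add[OF st(1) st'(1)] tendsto_add tendsto_add]) (rule st st')+
  show "(S o\<^sub>L S', T o\<^sub>L T') \<in> closure G"
    by (rule closure_I[OF G_compose[OF st(1) st'(1)]])
      (rule bounded_bilinear.tendsto[OF bounded_bilinear_blinfun_compose], rule st st', rule st st')+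
qed

lemma G_diff: "(S, T) \<in> G \<Longrightarrow> (S', T') \<in> G \<Longrightarrow> (S - S', T - T') \<in> G"
  using G_add[OF _ G_scale[of S' T' "-1"]] by simp

lemma closure_fst_snd:
  assumes "(S, T) \<in> closure G"
  shows "S \<in> closure (fst ` G)" and "T \<in> closure (snd ` G)"
proof -
  obtain s t where "\<forall>n. (s n, t n) \<in> G" "s \<longlonglongrightarrow> S" "t \<longlonglongrightarrow> T"
    using assms unfolding closure_iff by blast
  then show "S \<in> closure (fst ` G)" "T \<in> closure (snd ` G)"
    unfolding closure_sequential by force+
qed

lemma ex1_closure:
  assumes "S \<in> closure (fst ` G)"
  shows "\<exists>!T. (S, T) \<in> closure G"
proof (rule ex_ex1I)
  obtain s where s: "\<And>n. s n \<in> fst ` G" "s \<longlonglongrightarrow> S"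
    using assms unfolding closure_sequential by blast
  then have "\<exists>T. (s n, T) \<in> G" for n by force
  then obtain t where t: "\<And>n. (s n, t n) \<in> G" by metis
  have "Cauchy t"
  proof (rule metric_CauchyI)
    fix e :: real assume "e > 0"
    then obtain N where N: "\<And>m n. m \<ge> N \<Longrightarrow> n \<ge> N \<Longrightarrow> dist (s m) (s n) < e"
      using LIMSEQ_imp_Cauchy[OF s(2)] unfolding Cauchy_def by metis
    have "dist (t m) (t n) \<le> dist (s m) (s n)" for m n
      unfolding dist_norm by (rule G_norm[OF G_diff[OF t t]])
    then show "\<exists>M. \<forall>m\<ge>M. \<forall>n\<ge>M. dist (t m) (t n) < e"
      using N by (meson le_less_trans)
  qed
  then obtain T where "t \<longlonglongrightarrow> T" by (metis Cauchy_convergent convergentD)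
  then show "\<exists>T. (S, T) \<in> closure G"
    unfolding closure_iff using t s(2) by blast
next
  interpret cl: contractive_star_graph "closure G" by (rule closure_graph)
  fix T T' assume "(S, T) \<in> closure G" "(S, T') \<in> closure G"
  from cl.G_norm[OF cl.G_diff[OF this]] show "T = T'" by simp
qed

definition hom :: "('h \<Rightarrow>\<^sub>L 'h) \<Rightarrow> ('k \<Rightarrow>\<^sub>L 'k)" where
  "hom = (\<lambda>S\<in>closure (fst ` G). THE T. (S, T) \<in> closure G)"

lemma hom_graph: "S \<in> closure (fst ` G) \<Longrightarrow> (S, hom S) \<in> closure G"
  using theI'[OF ex1_closure] by (simp add: hom_def)

lemma hom_eq: "(S, T) \<in> closure G \<Longrightarrow> hom S = T"
  using hom_graph ex1_closure closure_fst_snd(1) by blast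

lemma hom_base: "(S, T) \<in> G \<Longrightarrow> hom S = T"
  using hom_eq closure_subset by blast

lemma hom_extensional: "hom \<in> extensional (closure (fst ` G))"
  by (simp add: hom_def)

lemma unital_star_hom_hom:
  "unital_star_hom (Lop\<lparr>carrier := closure (fst ` G)\<rparr>) (Lop\<lparr>carrier := closure (snd ` G)\<rparr>) hom"
proof -
  interpret cl: contractive_star_graph "closure G" by (rule closure_graph)
  show ?thesis
    unfolding unital_star_hom_def
    by (simp add: Lop_simps closure_fst_snd(2)[OF hom_graph] hom_eq[OF cl.G_add[OF hom_graph hom_graph]]
        hom_eq[OF cl.G_scale[OF hom_graph]] hom_eq[OF cl.G_compose[OF hom_graph hom_graph]]
        hom_eq[OF cl.G_adjoint[OF hom_graph]] hom_eq[OF cl.G_id])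
qed

lemma continuous_on_hom: "continuous_on (closure (fst ` G)) hom"
proof (rule continuous_onI)
  interpret cl: contractive_star_graph "closure G" by (rule closure_graph)
  fix S and e :: real assume S: "S \<in> closure (fst ` G)" and "e > 0"
  have "dist (hom S') (hom S) \<le> dist S' S" if "S' \<in> closure (fst ` G)" for S'
    unfolding dist_norm by (rule cl.G_norm[OF cl.G_diff[OF hom_graph[OF that] hom_graph[OF S]]])
  then show "\<exists>d>0. \<forall>S'\<in>closure (fst ` G). dist S' S < d \<longrightarrow> dist (hom S') (hom S) \<le> e"
    using \<open>e > 0\<close> by (intro exI[of _ e]) force
qed

lemma subalgebra:
  assumes "S \<in> closure (fst ` G)" "S' \<in> closure (fst ` G)"
  shows "S \<in> carrier Lop" "S + S' \<in> closure (fst ` G)" "scale Lop c S \<in> closure (fst ` G)"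
    "S o\<^sub>L S' \<in> closure (fst ` G)" "adjoint_op S \<in> closure (fst ` G)"
proof -
  interpret cl: contractive_star_graph "closure G" by (rule closure_graph)
  note g = hom_graph[OF assms(1)] hom_graph[OF assms(2)]
  show "S \<in> carrier Lop" using cl.G_Lop[OF g(1)] by blast
  show "S + S' \<in> closure (fst ` G)" by (rule closure_fst_snd(1)[OF cl.G_add[OF g]])
  show "scale Lop c S \<in> closure (fst ` G)" by (rule closure_fst_snd(1)[OF cl.G_scale[OF g(1)]])
  show "S o\<^sub>L S' \<in> closure (fst ` G)" by (rule closure_fst_snd(1)[OF cl.G_compose[OF g]])
  show "adjoint_op S \<in> closure (fst ` G)" by (rule closure_fst_snd(1)[OF cl.G_adjoint[OF g(1)]])
qed

end

section \<open>Minimal tensor products\<close>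

lemma adjoint_zero [simp]: "adjoint_op 0 = 0"
  by (rule adjoint_op_eqI) simp

lemma Lop_real_combination:
  "X \<in> carrier Lop \<Longrightarrow> Y \<in> carrier Lop \<Longrightarrow> r *\<^sub>R X + Y \<in> carrier Lop"
  by (auto simp flip: scale_Lop_of_real)

lemma adjoint_real_combination:
  "X \<in> carrier Lop \<Longrightarrow> Y \<in> carrier Lop \<Longrightarrow>
    adjoint_op (r *\<^sub>R X + Y) = r *\<^sub>R adjoint_op X + adjoint_op Y"
  by (simp add: adjoint_add adjoint_scale Lop_scale flip: scale_Lop_of_real)

lemma continuous_on_closure_eq:
  fixes f g :: "'x::first_countable_topology \<Rightarrow> 'y::t2_space"
  assumes "continuous_on (closure S) f" "continuous_on (closure S) g"
    and "\<And>x. x \<in> S \<Longrightarrow> f x = g x" and x: "x \<in> closure S"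
  shows "f x = g x"
proof -
  obtain s where s: "\<And>n. s n \<in> S" "s \<longlonglongrightarrow> x"
    using x unfolding closure_sequential by blast
  have "\<forall>\<^sub>F n in sequentially. s n \<in> closure S"
    using s(1) closure_subset[of S] by (intro always_eventually allI) blast
  then have "(\<lambda>n. f (s n)) \<longlonglongrightarrow> f x" "(\<lambda>n. g (s n)) \<longlonglongrightarrow> g x"
    using assms(1,2) s(2) x by (auto intro: continuous_on_tendsto_compose)
  then show ?thesis using assms(3) s(1) LIMSEQ_unique by simp
qed

text \<open>The record \<open>star_algebra\<close> carries no axioms, and
  \<open>unital_star_hom\<close> does not say that its source is closed under the
  operations.\<close>

definition star_closed :: "'a star_algebra \<Rightarrow> bool" where
  "star_closed A \<longleftrightarrow> unit A \<in> carrier A \<and>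
     (\<forall>a\<in>carrier A. \<forall>b\<in>carrier A. add A a b \<in> carrier A \<and> mult A a b \<in> carrier A) \<and>
     (\<forall>c. \<forall>a\<in>carrier A. scale A c a \<in> carrier A) \<and> (\<forall>a\<in>carrier A. star A a \<in> carrier A)"

lemma star_closed_Lop: "star_closed Lop"
  by (auto simp: star_closed_def Lop_simps)

lemma star_closed_Cont: "star_closed (Cont X)"
  unfolding star_closed_def Cont_simps
  by (auto cong: continuous_on_cong intro!: continuous_intros)

section \<open>Elementary tensors in faithful representations\<close>

locale faithful_pair =
  fixes A :: "'a star_algebra" and B :: "'b star_algebra"
  assumes A: "star_closed A" "faithful_rep A (rep A)"
    and B: "star_closed B" "faithful_rep B (rep B)"
begin

lemma hom_A: "unital_star_hom A Lop (rep A)" and hom_B: "unital_star_hom B Lop (rep B)"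
  using A B by (simp_all add: faithful_rep_def)

lemmas rep_A = hom_A[unfolded unital_star_hom_def Lop_simps]
lemmas rep_B = hom_B[unfolded unital_star_hom_def Lop_simps]

abbreviation te :: "'a \<Rightarrow> 'b \<Rightarrow> (('a \<times> 'b) ell2 \<Rightarrow>\<^sub>L ('a \<times> 'b) ell2)" where
  "te \<equiv> tensor_elem A B"

lemma te_Lop: "a \<in> carrier A \<Longrightarrow> b \<in> carrier B \<Longrightarrow> te a b \<in> carrier Lop"
  using rep_A rep_B by (auto simp: tensor_elem_def)

lemma te_apply:
  "a \<in> carrier A \<Longrightarrow> b \<in> carrier B \<Longrightarrow>
    blinfun_apply (te a b) (x \<otimes>\<^sub>v y) = blinfun_apply (rep A a) x \<otimes>\<^sub>v blinfun_apply (rep B b) y"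
  using rep_A rep_B by (auto simp: tensor_elem_def tensor_op_apply)

lemma te_scale_left:
  "a \<in> carrier A \<Longrightarrow> b \<in> carrier B \<Longrightarrow> te (scale A c a) b = scale Lop c (te a b)"
  using rep_A rep_B by (auto simp: tensor_elem_def tensor_op_scale_left)

lemma te_mult:
  "a \<in> carrier A \<Longrightarrow> a' \<in> carrier A \<Longrightarrow> b \<in> carrier B \<Longrightarrow> b' \<in> carrier B \<Longrightarrow>
    te (mult A a a') (mult B b b') = te a b o\<^sub>L te a' b'"
  using rep_A rep_B by (auto simp: tensor_elem_def tensor_op_compose)

lemma te_star:
  "a \<in> carrier A \<Longrightarrow> b \<in> carrier B \<Longrightarrow> te (star A a) (star B b) = adjoint_op (te a b)"
  using rep_A rep_B by (auto simp: tensor_elem_def tensor_op_adjoint)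

lemma te_unit: "te (unit A) (unit B) = id_blinfun"
  using rep_A rep_B by (auto simp: tensor_elem_def)

end

section \<open>Existence and uniqueness of f tensor id\<close>

lemma span_eq_finite_sums:
  fixes E :: "'v::real_vector set"
  assumes E: "\<And>r p. p \<in> E \<Longrightarrow> r *\<^sub>R p \<in> E"
  shows "span E = {\<Sum>k<n. p k | (n::nat) p. \<forall>k<n. p k \<in> E}"
proof
  show "{\<Sum>k<n. p k | (n::nat) p. \<forall>k<n. p k \<in> E} \<subseteq> span E"
    by (auto intro: span_sum span_base)
  show "span E \<subseteq> {\<Sum>k<n. p k | (n::nat) p. \<forall>k<n. p k \<in> E}"
  proof
    fix x assume "x \<in> span E"
    then show "x \<in> {\<Sum>k<n. p k | (n::nat) p. \<forall>k<n. p k \<in> E}"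
    proof (induction rule: span_induct_alt)
      case base
      show ?case by (auto intro!: exI[of _ 0])
    next
      case (step c x y)
      then obtain n p where p: "y = (\<Sum>k<n. p k)" "\<forall>k<n::nat. p k \<in> E" by blast
      have "c *\<^sub>R x + y = (\<Sum>k<Suc n. (p(n := c *\<^sub>R x)) k)" by (simp add: p(1) add.commute)
      moreover have "\<forall>k<Suc n. (p(n := c *\<^sub>R x)) k \<in> E" using p(2) E step by (simp add: less_Suc_eq)
      ultimately show ?case by blast
    qed
  qed
qed

text \<open>\<open>contractive\<close> is the analytic input: it makes the assignment on finite sums
  well defined and lets it extend to the norm closure.\<close>

locale tensor_map =
  AB: faithful_pair A B + A'B: faithful_pair A' B
  for A :: "'a star_algebra" and B :: "'b star_algebra" and A' :: "'c star_algebra" +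
  fixes f :: "'a \<Rightarrow> 'c"
  assumes f: "unital_star_hom A A' f"
    and contractive: "\<And>(n::nat) a b. (\<And>k. k < n \<Longrightarrow> a k \<in> carrier A \<and> b k \<in> carrier B) \<Longrightarrow>
      norm (\<Sum>k<n. tensor_elem A' B (f (a k)) (b k)) \<le> norm (\<Sum>k<n. tensor_elem A B (a k) (b k))"
begin

definition elementary where
  "elementary = {(tensor_elem A B a b, tensor_elem A' B (f a) b) | a b. a \<in> carrier A \<and> b \<in> carrier B}"

lemmas f_hom = f[unfolded unital_star_hom_def]

text \<open>A scalar can be absorbed into a. Hence the real span of the elementary pairs consists of
  finite sums without coefficients, which is the form of the carrier in \<open>min_tensor\<close>,
  and it is closed under complex scalars too.\<close>

lemma scale_elementary: "(S, T) \<in> elementary \<Longrightarrow> (scale Lop c S, scale Lop c T) \<in> elementary"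
proof -
  assume "(S, T) \<in> elementary"
  then obtain a b where ab: "a \<in> carrier A" "b \<in> carrier B"
    and ST: "S = tensor_elem A B a b" "T = tensor_elem A' B (f a) b"
    unfolding elementary_def by blast
  have "(scale Lop c S, scale Lop c T) =
      (tensor_elem A B (scale A c a) b, tensor_elem A' B (f (scale A c a)) b)"
    using f_hom ab by (simp add: ST AB.te_scale_left A'B.te_scale_left)
  moreover have "scale A c a \<in> carrier A" using AB.A(1) ab unfolding star_closed_def by blast
  ultimately show ?thesis unfolding elementary_def using ab by blast
qed

lemma span_elementary: "span elementary = {\<Sum>k<n. p k | (n::nat) p. \<forall>k<n. p k \<in> elementary}"
proof (rule span_eq_finite_sums)
  show "r *\<^sub>R p \<in> elementary" if "p \<in> elementary" for r p
    using scale_elementary[of "fst p" "snd p" "complex_of_real r"] that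
    by (cases p) (simp add: scale_Lop_of_real)
qed

lemma span_elementary':
  "p \<in> span elementary \<longleftrightarrow> (\<exists>(n::nat) a b. (\<forall>k<n. a k \<in> carrier A \<and> b k \<in> carrier B) \<and>
    p = (\<Sum>k<n. tensor_elem A B (a k) (b k), \<Sum>k<n. tensor_elem A' B (f (a k)) (b k)))"
proof
  assume "p \<in> span elementary"
  then obtain n q where q: "p = (\<Sum>k<n. q k)" "\<forall>k<n::nat. q k \<in> elementary"
    unfolding span_elementary by blast
  then have "\<forall>k. \<exists>a b. k < n \<longrightarrow> a \<in> carrier A \<and> b \<in> carrier B \<and>
      q k = (tensor_elem A B a b, tensor_elem A' B (f a) b)"
    unfolding elementary_def by blast
  then obtain a b where ab: "\<And>k. k < n \<Longrightarrow> a k \<in> carrier A \<and> b k \<in> carrier B \<and>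
      q k = (tensor_elem A B (a k) (b k), tensor_elem A' B (f (a k)) (b k))"
    by metis
  then have "p = (\<Sum>k<n. tensor_elem A B (a k) (b k), \<Sum>k<n. tensor_elem A' B (f (a k)) (b k))"
    unfolding q(1) by (simp add: prod_eq_iff fst_sum snd_sum)
  then show "\<exists>(n::nat) a b. (\<forall>k<n. a k \<in> carrier A \<and> b k \<in> carrier B) \<and>
    p = (\<Sum>k<n. tensor_elem A B (a k) (b k), \<Sum>k<n. tensor_elem A' B (f (a k)) (b k))"
    using ab by blast
next
  assume "\<exists>(n::nat) a b. (\<forall>k<n. a k \<in> carrier A \<and> b k \<in> carrier B) \<and>
    p = (\<Sum>k<n. tensor_elem A B (a k) (b k), \<Sum>k<n. tensor_elem A' B (f (a k)) (b k))"
  then obtain n :: nat and a b where ab: "\<forall>k<n. a k \<in> carrier A \<and> b k \<in> carrier B"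
    "p = (\<Sum>k<n. tensor_elem A B (a k) (b k), \<Sum>k<n. tensor_elem A' B (f (a k)) (b k))"
    by blast
  have "p = (\<Sum>k<n. (tensor_elem A B (a k) (b k), tensor_elem A' B (f (a k)) (b k)))"
    by (simp add: ab(2) prod_eq_iff fst_sum snd_sum)
  also have "\<dots> \<in> span elementary"
    using ab(1) by (intro span_sum span_base) (auto simp: elementary_def)
  finally show "p \<in> span elementary" .
qed

lemma fst_span: "closure (fst ` span elementary) = carrier (A \<otimes>\<^sub>m\<^sub>i\<^sub>n B)"
proof -
  have "fst ` span elementary =
     {\<Sum>k<n. tensor_elem A B (a k) (b k) | (n::nat) a b. \<forall>k<n. a k \<in> carrier A \<and> b k \<in> carrier B}"
    (is "_ = ?R")
  proof (intro equalityI subsetI)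
    fix x assume "x \<in> fst ` span elementary"
    then obtain p where "p \<in> span elementary" "x = fst p" by blast
    then obtain n :: nat and a b where "\<forall>k<n. a k \<in> carrier A \<and> b k \<in> carrier B"
      and "x = (\<Sum>k<n. tensor_elem A B (a k) (b k))"
      unfolding span_elementary' by auto
    then show "x \<in> ?R" by blast
  next
    fix x assume "x \<in> ?R"
    then obtain n :: nat and a b where "\<forall>k<n. a k \<in> carrier A \<and> b k \<in> carrier B"
      "x = (\<Sum>k<n. tensor_elem A B (a k) (b k))" by blast
    then have "(x, \<Sum>k<n. tensor_elem A' B (f (a k)) (b k)) \<in> span elementary"
      unfolding span_elementary' by blast
    then show "x \<in> fst ` span elementary" by force
  qed
  then show ?thesis by (simp add: min_tensor_def)
qed

lemma snd_span: "closure (snd ` span elementary) \<subseteq> carrier (A' \<otimes>\<^sub>m\<^sub>i\<^sub>n B)"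
proof -
  have "snd ` span elementary \<subseteq>
     {\<Sum>k<n. tensor_elem A' B (a k) (b k) | (n::nat) a b. \<forall>k<n. a k \<in> carrier A' \<and> b k \<in> carrier B}"
  proof
    fix x assume "x \<in> snd ` span elementary"
    then obtain p where "p \<in> span elementary" "x = snd p" by blast
    then obtain n :: nat and a b where ab: "\<forall>k<n. a k \<in> carrier A \<and> b k \<in> carrier B"
      and x: "x = (\<Sum>k<n. tensor_elem A' B (f (a k)) (b k))"
      unfolding span_elementary' by auto
    have "\<forall>k<n. f (a k) \<in> carrier A' \<and> b k \<in> carrier B" using f_hom ab by blast
    then show "x \<in> {\<Sum>k<n. tensor_elem A' B (a k) (b k) | (n::nat) a b.
        \<forall>k<n. a k \<in> carrier A' \<and> b k \<in> carrier B}"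
      unfolding x by (intro CollectI exI[of _ n] exI[of _ "\<lambda>k. f (a k)"] exI[of _ b]) simp
  qed
  then show ?thesis by (auto simp: min_tensor_def dest: closure_mono)
qed

lemma elementary_ops:
  assumes "p \<in> elementary" "q \<in> elementary"
  shows "(fst p o\<^sub>L fst q, snd p o\<^sub>L snd q) \<in> elementary"
    and "(adjoint_op (fst p), adjoint_op (snd p)) \<in> elementary"
    and "fst p \<in> carrier Lop \<and> snd p \<in> carrier Lop"
proof -
  obtain a b a' b' where p: "p = (tensor_elem A B a b, tensor_elem A' B (f a) b)" "a \<in> carrier A" "b \<in> carrier B"
    and q: "q = (tensor_elem A B a' b', tensor_elem A' B (f a') b')" "a' \<in> carrier A" "b' \<in> carrier B"
    using assms unfolding elementary_def by blast
  note A = AB.A(1)[unfolded star_closed_def] and B = AB.B(1)[unfolded star_closed_def]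
  have "(fst p o\<^sub>L fst q, snd p o\<^sub>L snd q) =
      (tensor_elem A B (mult A a a') (mult B b b'), tensor_elem A' B (f (mult A a a')) (mult B b b'))"
    using p q f_hom by (auto simp: AB.te_mult A'B.te_mult)
  then show "(fst p o\<^sub>L fst q, snd p o\<^sub>L snd q) \<in> elementary"
    unfolding elementary_def using p q A B by blast
  have "(adjoint_op (fst p), adjoint_op (snd p)) =
      (tensor_elem A B (star A a) (star B b), tensor_elem A' B (f (star A a)) (star B b))"
    using p f_hom by (auto simp: AB.te_star A'B.te_star)
  then show "(adjoint_op (fst p), adjoint_op (snd p)) \<in> elementary"
    unfolding elementary_def using p A B by blast
  show "fst p \<in> carrier Lop \<and> snd p \<in> carrier Lop"
    using p f_hom by (auto intro: AB.te_Lop A'B.te_Lop)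
qed

sublocale graph: contractive_star_graph "span elementary"
proof
  have Lop: "fst p \<in> carrier Lop \<and> snd p \<in> carrier Lop" if "p \<in> span elementary" for p
    using that
  proof (induction rule: span_induct_alt)
    case (step c x y)
    then show ?case
      using elementary_ops(3)[of x x] by (auto simp: Lop_real_combination)
  qed auto
  fix S S' T T' c
  show "(id_blinfun, id_blinfun) \<in> span elementary"
  proof (rule span_base)
    have "(id_blinfun, id_blinfun) = (tensor_elem A B (unit A) (unit B), tensor_elem A' B (f (unit A)) (unit B))"
      using f_hom by (simp add: AB.te_unit A'B.te_unit)
    then show "(id_blinfun, id_blinfun) \<in> elementary"
      unfolding elementary_def using AB.A(1) AB.B(1) unfolding star_closed_def by blast
  qed
  assume ST: "(S, T) \<in> span elementary"
  show "S \<in> carrier Lop \<and> T \<in> carrier Lop" using Lop[OF ST] by simp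
  have "(scale Lop c (fst p), scale Lop c (snd p)) \<in> span elementary" if "p \<in> span elementary" for p
    using that
  proof (induction rule: span_induct_alt)
    case base
    show ?case by (simp add: linear_simps(3)[OF bounded_linear_scale_Lop] span_zero flip: zero_prod_def)
  next
    case (step r x y)
    have "(scale Lop c (fst x), scale Lop c (snd x)) \<in> span elementary"
      using scale_elementary[of "fst x" "snd x"] step(1) by (simp add: span_base)
    from span_add[OF span_scale[OF this, of r] step(2)] show ?case
      by (simp add: linear_simps(1,5)[OF bounded_linear_scale_Lop])
  qed
  from this[OF ST] show "(scale Lop c S, scale Lop c T) \<in> span elementary" by simp
  have "fst p \<in> carrier Lop \<and> snd p \<in> carrier Lop \<and> (adjoint_op (fst p), adjoint_op (snd p)) \<in> span elementary"
    if "p \<in> span elementary" for p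
    using that
  proof (induction rule: span_induct_alt)
    case base
    show ?case by (simp add: adjoint_zero span_zero flip: zero_prod_def)
  next
    case (step r x y)
    note x = elementary_ops(3)[OF step(1) step(1)]
    have "(adjoint_op (fst x), adjoint_op (snd x)) \<in> span elementary"
      using elementary_ops(2)[OF step(1) step(1)] by (rule span_base)
    from span_add[OF span_scale[OF this, of r]] step(2) show ?case
      using x by (auto simp: adjoint_real_combination Lop_real_combination)
  qed
  from this[OF ST] show "(adjoint_op S, adjoint_op T) \<in> span elementary" by simp
  show "norm T \<le> norm S"
  proof -
    obtain n :: nat and a b where "\<forall>k<n. a k \<in> carrier A \<and> b k \<in> carrier B"
      "(S, T) = (\<Sum>k<n. tensor_elem A B (a k) (b k), \<Sum>k<n. tensor_elem A' B (f (a k)) (b k))"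
      using ST unfolding span_elementary' by blast
    then show ?thesis using contractive[of n a b] by simp
  qed
  assume ST': "(S', T') \<in> span elementary"
  show "(S + S', T + T') \<in> span elementary" using span_add[OF ST ST'] by simp
  \<comment> \<open>Products are handled by two inductions: an elementary pair times a member of the
    span, then two members of the span.\<close>
  have 1: "(fst p o\<^sub>L fst q, snd p o\<^sub>L snd q) \<in> span elementary" if "p \<in> elementary" "q \<in> span elementary" for p q
    using that(2)
  proof (induction rule: span_induct_alt)
    case base
    show ?case by (simp add: bounded_bilinear.zero_right[OF bounded_bilinear_blinfun_compose] span_zero flip: zero_prod_def)
  next
    case (step r x y)
    have "(fst p o\<^sub>L fst x, snd p o\<^sub>L snd x) \<in> span elementary"
      using elementary_ops(1)[OF that(1) step(1)] by (rule span_base)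
    from span_add[OF span_scale[OF this, of r] step(2)] show ?case
      by (simp add: bounded_bilinear.add_right[OF bounded_bilinear_blinfun_compose] bounded_bilinear.scaleR_right[OF bounded_bilinear_blinfun_compose])
  qed
  have "(fst p o\<^sub>L fst q, snd p o\<^sub>L snd q) \<in> span elementary" if "p \<in> span elementary" "q \<in> span elementary" for p q
    using that(1)
  proof (induction rule: span_induct_alt)
    case base
    show ?case by (simp add: bounded_bilinear.zero_left[OF bounded_bilinear_blinfun_compose] span_zero flip: zero_prod_def)
  next
    case (step r x y)
    from span_add[OF span_scale[OF 1[OF step(1) that(2)], of r] step(2)] show ?case
      by (simp add: bounded_bilinear.add_left[OF bounded_bilinear_blinfun_compose] bounded_bilinear.scaleR_left[OF bounded_bilinear_blinfun_compose])
  qed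
  from this[OF ST ST'] show "(S o\<^sub>L S', T o\<^sub>L T') \<in> span elementary" by simp
qed

lemma graph_hom:
  "unital_star_hom (A \<otimes>\<^sub>m\<^sub>i\<^sub>n B) (A' \<otimes>\<^sub>m\<^sub>i\<^sub>n B) graph.hom"
  using graph.unital_star_hom_hom snd_span
  unfolding fst_span unital_star_hom_def min_tensor_def by auto

lemma graph_hom_te:
  "a \<in> carrier A \<Longrightarrow> b \<in> carrier B \<Longrightarrow> graph.hom (tensor_elem A B a b) = tensor_elem A' B (f a) b"
  by (rule graph.hom_base) (auto intro!: span_base simp: elementary_def)

text \<open>A competitor agrees with \<open>graph.hom\<close> on elementary tensors, by additivity
  on finite sums, and by continuity on their closure; off the carrier both are
  \<open>undefined\<close>.\<close>

lemma tensor_hom_eq: "tensor_hom A B A' B f (\<lambda>b. b) = graph.hom"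
  unfolding tensor_hom_def
proof (rule the_equality, intro conjI ballI)
  show "graph.hom \<in> extensional (carrier (A \<otimes>\<^sub>m\<^sub>i\<^sub>n B))"
    "continuous_on (carrier (A \<otimes>\<^sub>m\<^sub>i\<^sub>n B)) graph.hom"
    using graph.hom_extensional graph.continuous_on_hom by (simp_all add: fst_span)
  show "unital_star_hom (A \<otimes>\<^sub>m\<^sub>i\<^sub>n B) (A' \<otimes>\<^sub>m\<^sub>i\<^sub>n B) graph.hom" by (rule graph_hom)
  show "graph.hom (tensor_elem A B a b) = tensor_elem A' B (f a) b" if "a \<in> carrier A" "b \<in> carrier B" for a b
    using that by (rule graph_hom_te)
next
  fix \<Phi> assume \<Phi>: "\<Phi> \<in> extensional (carrier (A \<otimes>\<^sub>m\<^sub>i\<^sub>n B)) \<and>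
       unital_star_hom (A \<otimes>\<^sub>m\<^sub>i\<^sub>n B) (A' \<otimes>\<^sub>m\<^sub>i\<^sub>n B) \<Phi> \<and>
       continuous_on (carrier (A \<otimes>\<^sub>m\<^sub>i\<^sub>n B)) \<Phi> \<and>
       (\<forall>a\<in>carrier A. \<forall>b\<in>carrier B. \<Phi> (tensor_elem A B a b) = tensor_elem A' B (f a) b)"
  have sub: "fst ` span elementary \<subseteq> carrier (A \<otimes>\<^sub>m\<^sub>i\<^sub>n B)" 
    using closure_subset[of "fst ` span elementary"] by (simp add: fst_span)
  have add: "\<Phi> (S + T) = \<Phi> S + \<Phi> T" if "S \<in> carrier (A \<otimes>\<^sub>m\<^sub>i\<^sub>n B)" "T \<in> carrier (A \<otimes>\<^sub>m\<^sub>i\<^sub>n B)" for S T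
    using \<Phi> that unfolding unital_star_hom_def by (simp add: min_tensor_def Lop_simps)
  have "\<Phi> (fst p) = snd p" if "p \<in> span elementary" for p
  proof -
    obtain n q where q: "p = (\<Sum>k<n. q k)" "\<forall>k<n::nat. q k \<in> elementary"
      using \<open>p \<in> span elementary\<close> unfolding span_elementary by blast
    have zero: "0 \<in> carrier (A \<otimes>\<^sub>m\<^sub>i\<^sub>n B)" using sub span_zero[of elementary] by force
    \<comment> \<open>Membership in the span is part of the induction because the competitor is
      known to be additive only on the carrier.\<close>
    have "(\<Sum>k<m. q k) \<in> span elementary \<and> \<Phi> (fst (\<Sum>k<m. q k)) = snd (\<Sum>k<m. q k)" if "m \<le> n" for m
      using that
    proof (induction m)
      case 0
      then show ?case using add[OF zero zero] by (simp add: span_zero)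
    next
      case (Suc m)
      then have qm: "q m \<in> elementary" and IH: "(\<Sum>k<m. q k) \<in> span elementary"
        "\<Phi> (fst (\<Sum>k<m. q k)) = snd (\<Sum>k<m. q k)"
        using q(2) by auto
      have "\<Phi> (fst (q m)) = snd (q m)" using qm \<Phi> unfolding elementary_def by auto
      moreover have "fst (q m) \<in> carrier (A \<otimes>\<^sub>m\<^sub>i\<^sub>n B)" "fst (\<Sum>k<m. q k) \<in> carrier (A \<otimes>\<^sub>m\<^sub>i\<^sub>n B)"
        using sub qm IH(1) span_base by blast+
      ultimately show ?case using IH add span_add[OF IH(1) span_base[OF qm]] by simp
    qed
    then show ?thesis using q(1) by blast
  qed
  then have agree: "\<Phi> S = graph.hom S" if "S \<in> fst ` span elementary" for S
    using that graph.hom_base by force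
  have cont: "continuous_on (closure (fst ` span elementary)) \<Phi>" using \<Phi> by (simp add: fst_span)
  show "\<Phi> = graph.hom"
  proof (rule extensionalityI)
    show "\<Phi> \<in> extensional (closure (fst ` span elementary))" using \<Phi> by (simp add: fst_span)
    show "\<Phi> S = graph.hom S" if "S \<in> closure (fst ` span elementary)" for S
      by (rule continuous_on_closure_eq[OF cont graph.continuous_on_hom agree that])
  qed (rule graph.hom_extensional)
qed

end

section \<open>Representations of algebras of continuous functions\<close>

locale cont_rep =
  fixes X :: "'x::topological_space set" and \<pi> :: "('x \<Rightarrow> complex) \<Rightarrow> ('h::complex_hilbert \<Rightarrow>\<^sub>L 'h)"
  assumes hom: "unital_star_hom (Cont X) Lop \<pi>"
begin

lemmas hom' = hom[unfolded unital_star_hom_def Lop_simps]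

lemma rep_Lop: "f \<in> carrier (Cont X) \<Longrightarrow> \<pi> f \<in> carrier Lop"
  using hom' by blast

lemma rep_add: "f \<in> carrier (Cont X) \<Longrightarrow> g \<in> carrier (Cont X) \<Longrightarrow> \<pi> (add (Cont X) f g) = \<pi> f + \<pi> g"
  using hom' by blast

lemma rep_scale: "f \<in> carrier (Cont X) \<Longrightarrow> \<pi> (scale (Cont X) c f) = scale Lop c (\<pi> f)"
  using hom' by blast

lemma rep_mult: "f \<in> carrier (Cont X) \<Longrightarrow> g \<in> carrier (Cont X) \<Longrightarrow> \<pi> (mult (Cont X) f g) = \<pi> f o\<^sub>L \<pi> g"
  using hom' by blast

lemma rep_star: "f \<in> carrier (Cont X) \<Longrightarrow> \<pi> (star (Cont X) f) = adjoint_op (\<pi> f)"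
  using hom' by blast

lemma rep_unit: "\<pi> (unit (Cont X)) = id_blinfun"
  using hom' by blast

end

lemmas star_closed_ContD = star_closed_Cont[unfolded star_closed_def]

lemma Cont_closed [intro]:
  "unit (Cont X) \<in> carrier (Cont X)"
  "f \<in> carrier (Cont X) \<Longrightarrow> g \<in> carrier (Cont X) \<Longrightarrow> add (Cont X) f g \<in> carrier (Cont X)"
  "f \<in> carrier (Cont X) \<Longrightarrow> g \<in> carrier (Cont X) \<Longrightarrow> mult (Cont X) f g \<in> carrier (Cont X)"
  "f \<in> carrier (Cont X) \<Longrightarrow> scale (Cont X) c f \<in> carrier (Cont X)"
  "f \<in> carrier (Cont X) \<Longrightarrow> star (Cont X) f \<in> carrier (Cont X)"
  using star_closed_ContD by blast+

lemma Cont_apply: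
  assumes "x \<in> X"
  shows "unit (Cont X) x = 1" "add (Cont X) f g x = f x + g x" "mult (Cont X) f g x = f x * g x"
    "scale (Cont X) c f x = c * f x" "star (Cont X) f x = cnj (f x)"
  using assms by (simp_all add: Cont_simps)

context cont_rep
begin

text \<open>The difference of the squared norms is \<open>\<parallel>\<pi>(h) v\<parallel>\<^sup>2\<close> with \<open>h = (|f|\<^sup>2 - |g|\<^sup>2)\<^sup>1\<^sup>/\<^sup>2\<close>.\<close>

lemma rep_norm_mono:
  assumes f: "f \<in> carrier (Cont X)" and g: "g \<in> carrier (Cont X)"
    and le: "\<And>x. x \<in> X \<Longrightarrow> cmod (g x) \<le> cmod (f x)"
  shows "norm (blinfun_apply (\<pi> g) v) \<le> norm (blinfun_apply (\<pi> f) v)"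
proof -
  define h where "h = (\<lambda>x\<in>X. complex_of_real (sqrt ((cmod (f x))\<^sup>2 - (cmod (g x))\<^sup>2)))"
  have h: "h \<in> carrier (Cont X)"
    unfolding h_def using Cont_continuous[OF f] Cont_continuous[OF g]
    by (intro Cont_I continuous_intros)
  let ?sq = "\<lambda>f. mult (Cont X) (star (Cont X) f) f"
  have "add (Cont X) (?sq g) (?sq h) = ?sq f"
  proof (rule Cont_eqI)
    fix x assume x: "x \<in> X"
    have sq: "cnj z * z = complex_of_real ((cmod z)\<^sup>2)" for z
      by (metis complex_norm_square mult.commute)
    have "(cmod (g x))\<^sup>2 \<le> (cmod (f x))\<^sup>2" using le[OF x] by (simp add: power_mono)
    then have "(cmod (h x))\<^sup>2 = (cmod (f x))\<^sup>2 - (cmod (g x))\<^sup>2" using x by (simp add: h_def)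
    then show "add (Cont X) (?sq g) (?sq h) x = ?sq f x"
      unfolding Cont_apply[OF x] sq by simp
  qed (intro Cont_closed f g h)+
  then have "\<pi> (?sq f) = \<pi> (?sq g) + \<pi> (?sq h)"
    by (metis rep_add Cont_closed(3,5) g h)
  moreover have sq: "cinner v (blinfun_apply (\<pi> (?sq k)) v) = complex_of_real ((norm (blinfun_apply (\<pi> k) v))\<^sup>2)"
    if "k \<in> carrier (Cont X)" for k
    using power2_norm_apply[OF rep_Lop[OF that], of v] that
    by (simp add: rep_mult rep_star Cont_closed)
  ultimately have "complex_of_real ((norm (blinfun_apply (\<pi> f) v))\<^sup>2) =
      complex_of_real ((norm (blinfun_apply (\<pi> g) v))\<^sup>2 + (norm (blinfun_apply (\<pi> h) v))\<^sup>2)"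
    unfolding of_real_add sq[OF f, symmetric] sq[OF g, symmetric] sq[OF h, symmetric]
    by (simp add: blinfun.add_left cinner_add_right)
  then have "(norm (blinfun_apply (\<pi> g) v))\<^sup>2 \<le> (norm (blinfun_apply (\<pi> f) v))\<^sup>2"
    unfolding of_real_eq_iff by simp
  then show ?thesis by simp
qed

lemma rep_norm_le:
  assumes f: "f \<in> carrier (Cont X)" and M: "\<And>x. x \<in> X \<Longrightarrow> cmod (f x) \<le> M" "M \<ge> 0"
  shows "norm (\<pi> f) \<le> M"
proof (rule norm_blinfun_bound[OF M(2)])
  fix v
  let ?M = "scale (Cont X) (complex_of_real M) (unit (Cont X))"
  have "norm (blinfun_apply (\<pi> f) v) \<le> norm (blinfun_apply (\<pi> ?M) v)"
    using M by (intro rep_norm_mono f Cont_closed) (simp add: Cont_apply)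
  also have "\<dots> = M * norm v"
    using M(2) by (simp add: rep_scale Cont_closed rep_unit)
  finally show "norm (blinfun_apply (\<pi> f) v) \<le> M * norm v" .
qed

lemma rep_diff_norm_le:
  assumes "f \<in> carrier (Cont X)" "g \<in> carrier (Cont X)"
    and "\<And>x. x \<in> X \<Longrightarrow> cmod (f x - g x) \<le> M" "M \<ge> 0"
  shows "norm (\<pi> f - \<pi> g) \<le> M"
proof -
  have "\<pi> (add (Cont X) f (scale (Cont X) (-1) g)) = \<pi> f - \<pi> g"
    using assms(1,2) by (simp add: rep_add rep_scale Cont_closed)
  then show ?thesis
    using rep_norm_le[of "add (Cont X) f (scale (Cont X) (-1) g)" M] assms
    by (simp add: Cont_closed Cont_apply)
qed

end

text \<open>
  The operator of a bump function near \<open>x\<close> is nonzero by faithfulness, and its range consists of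
  approximate joint eigenvectors.
\<close>

lemma (in cont_rep) approximate_eigenvector:
  fixes a :: "nat \<Rightarrow> 'x \<Rightarrow> complex"
  assumes inj: "inj_on \<pi> (carrier (Cont X))" and x: "x \<in> X" and \<epsilon>: "\<epsilon> > 0"
    and a: "\<And>k. k < n \<Longrightarrow> a k \<in> carrier (Cont X)"
    and bump: "\<And>U. open U \<Longrightarrow> x \<in> U \<Longrightarrow>
      \<exists>f :: 'x \<Rightarrow> complex. continuous_on X f \<and> f x \<noteq> 0 \<and> (\<forall>y\<in>X - U. f y = 0)"
  shows "\<exists>v. v \<noteq> 0 \<and> (\<forall>k<n. norm (blinfun_apply (\<pi> (a k)) v - a k x *\<^sub>C v) \<le> \<epsilon> * norm v)"
proof -
  have "\<forall>k<n. \<exists>U. open U \<and> x \<in> U \<and> (\<forall>y\<in>X \<inter> U. cmod (a k y - a k x) \<le> \<epsilon>)"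
  proof (intro allI impI)
    fix k assume "k < n"
    then obtain U where "open U" "x \<in> U" "\<forall>y\<in>X. y \<in> U \<longrightarrow> a k y \<in> ball (a k x) \<epsilon>"
      using Cont_continuous[OF a] x \<epsilon> unfolding continuous_on_topological
      by (metis centre_in_ball open_ball)
    then show "\<exists>U. open U \<and> x \<in> U \<and> (\<forall>y\<in>X \<inter> U. cmod (a k y - a k x) \<le> \<epsilon>)"
      by (intro exI[of _ U]) (auto simp: dist_norm norm_minus_commute less_imp_le)
  qed
  then obtain U where U: "\<And>k. k < n \<Longrightarrow> open (U k)" "\<And>k. k < n \<Longrightarrow> x \<in> U k"
    "\<And>k y. k < n \<Longrightarrow> y \<in> X \<Longrightarrow> y \<in> U k \<Longrightarrow> cmod (a k y - a k x) \<le> \<epsilon>"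
    by (metis IntI)
  have "open (\<Inter>k\<in>{..<n}. U k)" using U by (intro open_INT) auto
  then obtain f0 :: "'x \<Rightarrow> complex" where f0: "continuous_on X f0" "f0 x \<noteq> 0"
    "\<And>y k. y \<in> X \<Longrightarrow> k < n \<Longrightarrow> y \<notin> U k \<Longrightarrow> f0 y = 0"
    using bump[of "\<Inter>k\<in>{..<n}. U k"] U(2) by auto
  define f where "f = restrict f0 X"
  have f: "f \<in> carrier (Cont X)" unfolding f_def using f0(1) by (rule Cont_I)
  let ?zero = "scale (Cont X) 0 (unit (Cont X))"
  have "\<pi> f \<noteq> \<pi> ?zero"
  proof
    assume "\<pi> f = \<pi> ?zero"
    then have "f = ?zero" using inj f by (auto simp: Cont_closed dest: inj_onD)
    then have "f x = 0" using x by (simp add: Cont_apply)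
    then show False using f0(2) x by (simp add: f_def)
  qed
  moreover have "\<pi> ?zero = 0" by (rule blinfun_eqI) (simp add: rep_scale Cont_closed)
  ultimately obtain u where u: "blinfun_apply (\<pi> f) u \<noteq> 0"
    by (metis blinfun_eqI zero_blinfun.rep_eq)
  define v where "v = blinfun_apply (\<pi> f) u"
  have "norm (blinfun_apply (\<pi> (a k)) v - a k x *\<^sub>C v) \<le> \<epsilon> * norm v" if k: "k < n" for k
  proof -
    let ?h = "add (Cont X) (a k) (scale (Cont X) (- a k x) (unit (Cont X)))"
    have h: "?h \<in> carrier (Cont X)" using a[OF k] by blast
    have "blinfun_apply (\<pi> (a k)) v - a k x *\<^sub>C v = blinfun_apply (\<pi> (mult (Cont X) ?h f)) u"
      using a[OF k] f h
      by (simp add: rep_mult rep_add rep_scale rep_unit Cont_closed v_def blinfun.add_left)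
    \<comment> \<open>The bump f vanishes off U k, and on U k the function a k stays within
      \<epsilon> of its value at x, so the product is dominated pointwise by \<epsilon> times
      f.\<close>
    also have "norm \<dots> \<le> norm (blinfun_apply (\<pi> (scale (Cont X) (complex_of_real \<epsilon>) f)) u)"
    proof (rule rep_norm_mono)
      fix y assume y: "y \<in> X"
      have "cmod (a k y - a k x) * cmod (f y) \<le> \<epsilon> * cmod (f y)"
        using U(3)[OF k y] f0(3)[OF y k] y by (cases "y \<in> U k") (auto simp: f_def intro: mult_right_mono)
      then show "cmod (mult (Cont X) ?h f y) \<le> cmod (scale (Cont X) (complex_of_real \<epsilon>) f y)"
        using y \<epsilon> by (simp add: Cont_apply norm_mult)
    qed (intro Cont_closed f h)+
    also have "\<dots> = \<epsilon> * norm v" using f \<epsilon> by (simp add: rep_scale v_def)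
    finally show ?thesis .
  qed
  then show ?thesis using u unfolding v_def by blast
qed

section \<open>Evaluation of tensors at a point\<close>

lemma metric_bump:
  fixes x :: "'x::metric_space"
  assumes "open U" "x \<in> U"
  shows "\<exists>f :: 'x \<Rightarrow> complex. continuous_on X f \<and> f x \<noteq> 0 \<and> (\<forall>y\<in>X - U. f y = 0)"
proof -
  obtain r where r: "r > 0" "ball x r \<subseteq> U" using assms by (meson openE)
  have "continuous_on X (\<lambda>y. complex_of_real (max 0 (r - dist x y)))"
    by (intro continuous_intros)
  moreover have "\<forall>y\<in>X - U. complex_of_real (max 0 (r - dist x y)) = 0"
    using r(2) by (auto simp: max_def subset_iff) (metis not_le order_antisym)
  ultimately show ?thesis using r(1) by (intro exI[of _ "\<lambda>y. complex_of_real (max 0 (r - dist x y))"]) simp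
qed

locale cont_tensor = faithful_pair "Cont X" B
  for X :: "'x::metric_space set" and B :: "'b star_algebra"
begin

text \<open>Let R be the sum of tensors and S its value at x. If v is almost a joint eigenvector of
  all a k with eigenvalues a k x, then R maps v tensor y to v tensor S y, up to a small multiple of
  the norm of v.\<close>

lemma norm_eval_le:
  fixes a :: "nat \<Rightarrow> 'x \<Rightarrow> complex"
  assumes x: "x \<in> X" and ab: "\<And>k. k < n \<Longrightarrow> a k \<in> carrier (Cont X) \<and> b k \<in> carrier B"
  shows "norm (\<Sum>k<n. scale Lop (a k x) (rep B (b k))) \<le> norm (\<Sum>k<n. te (a k) (b k))"
proof (rule norm_blinfun_bound)
  let ?R = "\<Sum>k<n. te (a k) (b k)" and ?S = "\<Sum>k<n. scale Lop (a k x) (rep B (b k))"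
  fix y
  \<comment> \<open>Replacing \<open>rep (Cont X) (a k)\<close> by its approximate eigenvalue costs
    \<epsilon> times the norm of v in every term; L is the total weight of these errors.\<close>
  define L where "L = (\<Sum>k<n. norm (blinfun_apply (rep B (b k)) y))"
  have L: "L \<ge> 0" by (simp add: L_def sum_nonneg)
  interpret cont_rep X "rep (Cont X)" by unfold_locales (rule hom_A)
  have bound: "norm (blinfun_apply ?S y) \<le> norm ?R * norm y + \<epsilon> * L" if \<epsilon>: "\<epsilon> > 0" for \<epsilon>
  proof -
    obtain v where v: "v \<noteq> 0"
      "\<And>k. k < n \<Longrightarrow> norm (blinfun_apply (rep (Cont X) (a k)) v - a k x *\<^sub>C v) \<le> \<epsilon> * norm v"
    proof -
      have "inj_on (rep (Cont X)) (carrier (Cont X))" using A(2) by (simp add: faithful_rep_def)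
      note approximate_eigenvector[OF this x \<epsilon> _ metric_bump, of n a]
      then show ?thesis using ab that by blast
    qed
    have "v \<otimes>\<^sub>v blinfun_apply ?S y = (\<Sum>k<n. (a k x *\<^sub>C v) \<otimes>\<^sub>v blinfun_apply (rep B (b k)) y)"
      by (simp add: blinfun.sum_left tensor_vec_sum_right tensor_vec_scale_left tensor_vec_scale_right)
    also have "\<dots> = blinfun_apply ?R (v \<otimes>\<^sub>v y) -
        (\<Sum>k<n. (blinfun_apply (rep (Cont X) (a k)) v - a k x *\<^sub>C v) \<otimes>\<^sub>v blinfun_apply (rep B (b k)) y)"
      using ab by (simp add: blinfun.sum_left te_apply tensor_vec_diff_left sum_subtractf)
    finally have "norm (v \<otimes>\<^sub>v blinfun_apply ?S y) \<le> norm (blinfun_apply ?R (v \<otimes>\<^sub>v y)) +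
        norm (\<Sum>k<n. (blinfun_apply (rep (Cont X) (a k)) v - a k x *\<^sub>C v) \<otimes>\<^sub>v blinfun_apply (rep B (b k)) y)"
      by (simp add: norm_triangle_ineq4)
    also have "\<dots> \<le> norm ?R * norm (v \<otimes>\<^sub>v y) + (\<Sum>k<n. \<epsilon> * norm v * norm (blinfun_apply (rep B (b k)) y))"
      using v(2) by (intro add_mono norm_blinfun order_trans[OF norm_sum] sum_mono)
        (auto intro: mult_right_mono)
    also have "\<dots> = norm v * (norm ?R * norm y + \<epsilon> * L)"
      by (simp add: L_def sum_distrib_left algebra_simps)
    finally show ?thesis using v(1) by simp
  qed
  show "norm (blinfun_apply ?S y) \<le> norm ?R * norm y"
  proof (rule field_le_epsilon)
    fix e :: real assume "e > 0"
    then have "norm (blinfun_apply ?S y) \<le> norm ?R * norm y + e / (L + 1) * L"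
      using L by (intro bound) simp
    also have "e / (L + 1) * L \<le> e" using L \<open>e > 0\<close> by (simp add: field_simps)
    finally show "norm (blinfun_apply ?S y) \<le> norm ?R * norm y + e" by simp
  qed
qed simp

end

section \<open>Polynomials in a unitary operator\<close>

lemma sum_powers_root_of_unity:
  fixes z :: complex
  assumes "z ^ N = 1" "z \<noteq> 1"
  shows "(\<Sum>k<N. z ^ k) = 0"
  using assms by (simp add: geometric_sum)

text \<open>Parseval for the discrete Fourier transform with vector values. Sampling w at the N-th
  roots of unity takes the place of averaging over the circle, and N samples suffice for sums of N
  terms.\<close>

lemma parseval_roots_of_unity:
  fixes v :: "nat \<Rightarrow> 'h::complex_hilbert" and N :: nat
  defines "\<omega> \<equiv> \<lambda>k. cis (2 * pi * real k / real N)"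
  assumes N: "N > 0"
  shows "(\<Sum>k<N. (norm (\<Sum>j<N. cnj (\<omega> k) ^ j *\<^sub>C v j))\<^sup>2) = real N * (\<Sum>j<N. (norm (v j))\<^sup>2)"
proof -
  \<comment> \<open>This symmetry turns the sums over k below into geometric series in k.\<close>
  have \<omega>_pow: "\<omega> k ^ j = \<omega> j ^ k" for k j
    unfolding \<omega>_def Complex.DeMoivre by (rule arg_cong[of _ _ cis]) simp
  have \<omega>_norm: "\<omega> k * cnj (\<omega> k) = 1" for k
    by (simp add: \<omega>_def complex_mult_cnj cis.code)
  have inj: "i = j" if "i < N" "j < N" "\<omega> i = \<omega> j" for i j
    using Complex.bij_betw_roots_unity[OF N] that unfolding bij_betw_def inj_on_def \<omega>_def by auto
  have \<omega>_N: "\<omega> k ^ N = 1" for k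
  proof -
    have "real N * (2 * pi * real k / real N) = 2 * pi * real k" using N by simp
    then show ?thesis unfolding \<omega>_def Complex.DeMoivre by (simp only: cis_multiple_2pi Ints_of_nat)
  qed
  have orth: "(\<Sum>k<N. \<omega> k ^ i * cnj (\<omega> k) ^ j) = (if i = j then of_nat N else 0)"
    if ij: "i < N" "j < N" for i j
  proof -
    have eq: "(\<Sum>k<N. \<omega> k ^ i * cnj (\<omega> k) ^ j) = (\<Sum>k<N. (\<omega> i * cnj (\<omega> j)) ^ k)"
      by (simp add: \<omega>_pow[of _ i] power_mult_distrib)
        (simp add: \<omega>_pow[of _ j] flip: complex_cnj_power)
    show ?thesis
    proof (cases "i = j")
      case True
      then show ?thesis unfolding eq by (simp add: \<omega>_norm)
    next
      case False
      have "\<omega> i * cnj (\<omega> j) \<noteq> 1"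
      proof
        assume "\<omega> i * cnj (\<omega> j) = 1"
        then have "\<omega> i * (\<omega> j * cnj (\<omega> j)) = \<omega> j" by (simp add: mult.left_commute)
        then show False using inj[OF ij] False by (simp add: \<omega>_norm)
      qed
      moreover have "(\<omega> i * cnj (\<omega> j)) ^ N = 1"
        by (simp add: power_mult_distrib \<omega>_N flip: complex_cnj_power)
      ultimately show ?thesis unfolding eq using False sum_powers_root_of_unity by simp
    qed
  qed
  have "complex_of_real (\<Sum>k<N. (norm (\<Sum>j<N. cnj (\<omega> k) ^ j *\<^sub>C v j))\<^sup>2) =
      (\<Sum>k<N. \<Sum>i<N. \<Sum>j<N. \<omega> k ^ i * cnj (\<omega> k) ^ j * cinner (v i) (v j))"
    unfolding of_real_sum cinner_self[symmetric]
  proof (intro sum.cong refl)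
    fix k
    have "cinner (\<Sum>i<N. cnj (\<omega> k) ^ i *\<^sub>C v i) (\<Sum>j<N. cnj (\<omega> k) ^ j *\<^sub>C v j) =
        (\<Sum>j<N. \<Sum>i<N. \<omega> k ^ i * cnj (\<omega> k) ^ j * cinner (v i) (v j))"
      by (simp add: cinner_sum_left cinner_sum_right cinner_scaleC_left cinner_scaleC_right
          sum_distrib_left mult_ac)
    also have "\<dots> = (\<Sum>i<N. \<Sum>j<N. \<omega> k ^ i * cnj (\<omega> k) ^ j * cinner (v i) (v j))"
      by (rule sum.swap)
    finally show "cinner (\<Sum>j<N. cnj (\<omega> k) ^ j *\<^sub>C v j) (\<Sum>j<N. cnj (\<omega> k) ^ j *\<^sub>C v j) =
        (\<Sum>i<N. \<Sum>j<N. \<omega> k ^ i * cnj (\<omega> k) ^ j * cinner (v i) (v j))" .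
  qed
  also have "\<dots> = (\<Sum>i<N. \<Sum>k<N. \<Sum>j<N. \<omega> k ^ i * cnj (\<omega> k) ^ j * cinner (v i) (v j))"
    by (rule sum.swap)
  also have "\<dots> = (\<Sum>i<N. \<Sum>j<N. (\<Sum>k<N. \<omega> k ^ i * cnj (\<omega> k) ^ j) * cinner (v i) (v j))"
    unfolding sum_distrib_right by (intro sum.cong refl sum.swap)
  also have "\<dots> = (\<Sum>i<N. \<Sum>j<N. if i = j then of_nat N * cinner (v i) (v i) else 0)"
    by (intro sum.cong refl) (auto simp: orth)
  also have "\<dots> = complex_of_real (real N * (\<Sum>j<N. (norm (v j))\<^sup>2))"
    by (simp add: cinner_self sum_distrib_left)
  finally show ?thesis unfolding of_real_eq_iff .
qed

text \<open>
  Up to a term bounded independently of \<open>N\<close>, the vector \<open>wave U N w x\<close> is an eigenvector of \<open>U\<close>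
  with eigenvalue \<open>w\<close>, while on average over \<open>w\<close> its squared norm is \<open>N \<parallel>x\<parallel>\<^sup>2\<close>. This bounds
  the norms of polynomials in \<open>U\<close> without the spectral theorem.
\<close>

definition wave :: "('h::complex_hilbert \<Rightarrow>\<^sub>L 'h) \<Rightarrow> nat \<Rightarrow> complex \<Rightarrow> 'h \<Rightarrow> 'h" where
  "wave U N w x = (\<Sum>j<N. cnj w ^ j *\<^sub>C ((blinfun_apply U ^^ j) x))"

lemma norm_isometry_power:
  fixes U :: "'h::complex_hilbert \<Rightarrow>\<^sub>L 'h"
  assumes U: "\<And>x. norm (blinfun_apply U x) = norm x"
  shows "norm ((blinfun_apply U ^^ j) x) = norm x"
  by (induction j) (simp_all add: U)

lemma wave_commute:
  assumes "T \<in> carrier Lop" "\<And>x. blinfun_apply T (blinfun_apply U x) = blinfun_apply U (blinfun_apply T x)"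
  shows "blinfun_apply T (wave U N w x) = wave U N w (blinfun_apply T x)"
proof -
  have "blinfun_apply T ((blinfun_apply U ^^ j) x) = (blinfun_apply U ^^ j) (blinfun_apply T x)" for j
    by (induction j) (simp_all add: assms(2))
  then show ?thesis by (simp add: wave_def blinfun.sum_right Lop_scaleC[OF assms(1)])
qed

text \<open>T commutes with U, so it maps waves of x to waves of T x. The l2 norm over the N-th
  roots of unity turns the assumed bound into N |T x| \<le> (M + \<epsilon>) N |x| + sqrt N C |x|,
  and after division by N the last term vanishes as N grows. Hence C must depend neither on N nor on
  w.\<close>

lemma norm_le_via_waves:
  fixes U T :: "'h::complex_hilbert \<Rightarrow>\<^sub>L 'h"
  assumes U: "\<And>x. norm (blinfun_apply U x) = norm x"
    and T: "T \<in> carrier Lop" "\<And>x. blinfun_apply T (blinfun_apply U x) = blinfun_apply U (blinfun_apply T x)"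
    and M: "M \<ge> 0"
    and bound: "\<And>\<epsilon>. \<epsilon> > 0 \<Longrightarrow> \<exists>C\<ge>0. \<forall>N x. \<forall>w\<in>S1.
      norm (blinfun_apply T (wave U N w x)) \<le> (M + \<epsilon>) * norm (wave U N w x) + C * norm x"
  shows "norm T \<le> M"
proof (rule norm_blinfun_bound[OF M])
  fix x
  have step: "norm (blinfun_apply T x) \<le> (M + \<epsilon>) * norm x" if \<epsilon>: "\<epsilon> > 0" for \<epsilon>
  proof -
    obtain C where C: "C \<ge> 0" "\<And>N w. w \<in> S1 \<Longrightarrow>
        norm (blinfun_apply T (wave U N w x)) \<le> (M + \<epsilon>) * norm (wave U N w x) + C * norm x"
      using bound[OF \<epsilon>] by blast
    define \<omega> where "\<omega> N k = cis (2 * pi * real k / real N)" for N k :: nat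
    \<comment> \<open>In the sum of squares one factor N comes from Parseval and another from the N
      terms of the wave, each of the norm of y.\<close>
    have L2_wave: "L2_set (\<lambda>k. norm (wave U N (\<omega> N k) y)) {..<N} = real N * norm y" if "N > 0" for N y
    proof -
      have "(\<Sum>k<N. (norm (wave U N (\<omega> N k) y))\<^sup>2) = (real N * norm y)\<^sup>2"
        unfolding wave_def \<omega>_def parseval_roots_of_unity[OF that]
        by (simp add: norm_isometry_power[OF U] power2_eq_square)
      then show ?thesis by (simp add: L2_set_def)
    qed
    have N_bound: "norm (blinfun_apply T x) \<le> (M + \<epsilon>) * norm x + C * norm x * (1 / sqrt (real N))" if N: "N > 0" for N
    proof -
      have "real N * norm (blinfun_apply T x) = L2_set (\<lambda>k. norm (blinfun_apply T (wave U N (\<omega> N k) x))) {..<N}"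
        by (simp add: wave_commute[OF T] L2_wave[OF N])
      also have "\<dots> \<le> L2_set (\<lambda>k. (M + \<epsilon>) * norm (wave U N (\<omega> N k) x) + C * norm x) {..<N}"
        by (intro L2_set_mono C) (simp_all add: \<omega>_def)
      also have "\<dots> \<le> L2_set (\<lambda>k. (M + \<epsilon>) * norm (wave U N (\<omega> N k) x)) {..<N} + L2_set (\<lambda>k. C * norm x) {..<N}"
        by (rule L2_set_triangle_ineq)
      also have "\<dots> = (M + \<epsilon>) * (real N * norm x) + sqrt (real N) * (C * norm x)"
        using M \<epsilon> C(1) by (simp add: L2_wave[OF N] L2_set_constant flip: L2_set_right_distrib)
      also have "\<dots> = real N * ((M + \<epsilon>) * norm x + C * norm x * (1 / sqrt (real N)))"
        using N by (simp add: field_simps real_div_sqrt)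
      finally show ?thesis using N by simp
    qed
    have "(\<lambda>n. 1 / sqrt (real (Suc n))) \<longlonglongrightarrow> 0"
      using tendsto_real_sqrt[OF LIMSEQ_Suc[OF lim_1_over_n]] by (simp add: real_sqrt_divide)
    from tendsto_add[OF tendsto_const tendsto_mult_right[OF this], of "(M + \<epsilon>) * norm x" "C * norm x"]
    show ?thesis
      using N_bound[OF zero_less_Suc] by (intro LIMSEQ_le_const) auto
  qed
  show "norm (blinfun_apply T x) \<le> M * norm x"
  proof (rule field_le_epsilon)
    fix e :: real assume "e > 0"
    then have "norm (blinfun_apply T x) \<le> (M + e / (norm x + 1)) * norm x"
      by (intro step) (simp add: add_nonneg_pos)
    also have "\<dots> = M * norm x + e / (norm x + 1) * norm x" by (simp add: algebra_simps)
    also have "e / (norm x + 1) * norm x \<le> e"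
    proof -
      have "norm x / (norm x + 1) \<le> 1" by (rule divide_le_eq_1[THEN iffD2]) (simp add: add_nonneg_pos)
      then show ?thesis using mult_left_mono[of "norm x / (norm x + 1)" 1 e] \<open>e > 0\<close> by simp
    qed
    finally show "norm (blinfun_apply T x) \<le> M * norm x + e" by simp
  qed
qed

section \<open>Laurent polynomials of a unitary operator\<close>

definition circle_var :: "complex \<Rightarrow> complex" where
  "circle_var = (\<lambda>w\<in>S1. w)"

lemma circle_var_apply: "w \<in> S1 \<Longrightarrow> circle_var w = w"
  by (simp add: circle_var_def)

lemma circle_var_Cont [intro, simp]: "circle_var \<in> carrier (Cont S1)"
  unfolding circle_var_def by (intro Cont_I continuous_intros)

locale unitary =
  fixes U :: "'h::complex_hilbert \<Rightarrow>\<^sub>L 'h"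
  assumes U_Lop: "U \<in> carrier Lop"
    and U_adj_U: "adjoint_op U o\<^sub>L U = id_blinfun"
    and U_U_adj: "U o\<^sub>L adjoint_op U = id_blinfun"
begin

lemma norm_U [simp]: "norm (blinfun_apply U x) = norm x"
  by (rule isometry_norm[OF U_Lop U_adj_U])

lemma U_adj_apply [simp]:
  "blinfun_apply U (blinfun_apply (adjoint_op U) x) = x"
  "blinfun_apply (adjoint_op U) (blinfun_apply U x) = x"
  by (metis U_U_adj blinfun_apply_blinfun_compose id_blinfun.rep_eq id_apply,
      metis U_adj_U blinfun_apply_blinfun_compose id_blinfun.rep_eq id_apply)

lemma norm_U_adj [simp]: "norm (blinfun_apply (adjoint_op U) x) = norm x"
  using norm_U[of "blinfun_apply (adjoint_op U) x"] by simp

lemma wave_Suc_left: "wave U (Suc N) w x = x + cnj w *\<^sub>C blinfun_apply U (wave U N w x)"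
  unfolding wave_def
  by (subst sum.lessThan_Suc_shift)
    (simp add: scaleC_sum_right blinfun.sum_right Lop_scaleC[OF U_Lop] scaleC_scaleC del: sum.lessThan_Suc)

text \<open>Applying U and multiplying by \<open>cnj w\<close> shifts the index of the wave by one.
  The difference to the wave consists of the lost first term and the new last one, each of the norm
  of x.\<close>

lemma U_wave_le:
  assumes w: "w \<in> S1"
  shows "norm (blinfun_apply U (wave U N w x) - w *\<^sub>C wave U N w x) \<le> 2 * norm x"
proof -
  have ww: "w * cnj w = 1" using w by (simp add: complex_norm_square[symmetric])
  have "cnj w *\<^sub>C blinfun_apply U (wave U N w x) = wave U (Suc N) w x - x"
    by (simp add: wave_Suc_left)
  also have "\<dots> = wave U N w x + (cnj w ^ N *\<^sub>C (blinfun_apply U ^^ N) x - x)"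
    by (simp add: wave_def)
  finally have "w *\<^sub>C cnj w *\<^sub>C blinfun_apply U (wave U N w x) =
      w *\<^sub>C (wave U N w x + (cnj w ^ N *\<^sub>C (blinfun_apply U ^^ N) x - x))" by simp
  then have "blinfun_apply U (wave U N w x) - w *\<^sub>C wave U N w x =
      w *\<^sub>C (cnj w ^ N *\<^sub>C (blinfun_apply U ^^ N) x - x)"
    by (simp add: scaleC_scaleC ww scaleC_add_right)
  also have "norm \<dots> \<le> norm (cnj w ^ N *\<^sub>C (blinfun_apply U ^^ N) x) + norm x"
    using w norm_triangle_ineq4[of "cnj w ^ N *\<^sub>C (blinfun_apply U ^^ N) x" x] by simp
  also have "\<dots> = 2 * norm x"
    using w by (simp add: norm_power norm_isometry_power)
  finally show ?thesis .
qed

text \<open>Relates a Laurent polynomial on the circle to its value at U. The operator is built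
  along an expression; that it depends on the function alone comes out of the norm estimate.\<close>

inductive laurent :: "(complex \<Rightarrow> complex) \<Rightarrow> ('h \<Rightarrow>\<^sub>L 'h) \<Rightarrow> bool" where
  unit: "laurent (unit (Cont S1)) id_blinfun"
| var: "laurent circle_var U"
| cnj_var: "laurent (star (Cont S1) circle_var) (adjoint_op U)"
| add: "laurent f S \<Longrightarrow> laurent g T \<Longrightarrow> laurent (add (Cont S1) f g) (S + T)"
| scale: "laurent f S \<Longrightarrow> laurent (scale (Cont S1) c f) (scale Lop c S)"
| mult: "laurent f S \<Longrightarrow> laurent g T \<Longrightarrow> laurent (mult (Cont S1) f g) (S o\<^sub>L T)"

lemma laurent_carrier:
  assumes "laurent f T"
  shows "f \<in> carrier (Cont S1)" "T \<in> carrier Lop"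
    "blinfun_apply T (blinfun_apply U x) = blinfun_apply U (blinfun_apply T x)"
proof -
  have "f \<in> carrier (Cont S1) \<and> T \<in> carrier Lop \<and>
      (\<forall>x. blinfun_apply T (blinfun_apply U x) = blinfun_apply U (blinfun_apply T x))"
    using assms
    by (induction rule: laurent.induct)
      (auto simp: U_Lop Lop_adjoint Lop_scaleC blinfun.add_left blinfun.add_right)
  then show "f \<in> carrier (Cont S1)" "T \<in> carrier Lop"
    "blinfun_apply T (blinfun_apply U x) = blinfun_apply U (blinfun_apply T x)" by blast+
qed

lemma laurent_star: "laurent f T \<Longrightarrow> laurent (star (Cont S1) f) (adjoint_op T)"
proof (induction rule: laurent.induct)
  case unit
  have "star (Cont S1) (unit (Cont S1)) = unit (Cont S1)"
    by (rule Cont_eqI) (auto simp: Cont_apply)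
  then show ?case using laurent.unit by simp
next
  case var
  show ?case by (rule laurent.cnj_var)
next
  case cnj_var
  have "star (Cont S1) (star (Cont S1) circle_var) = circle_var"
    by (rule Cont_eqI) (auto simp: Cont_apply)
  then show ?case using laurent.var by (simp add: U_Lop)
next
  case (add f S g T)
  note l = laurent_carrier[OF add.hyps(1)] laurent_carrier[OF add.hyps(2)]
  have "star (Cont S1) (add (Cont S1) f g) = add (Cont S1) (star (Cont S1) f) (star (Cont S1) g)"
    using l by (intro Cont_eqI Cont_closed) (auto simp: Cont_apply)
  then show ?case using laurent.add[OF add.IH] l by (simp add: adjoint_add)
next
  case (scale f S c)
  note l = laurent_carrier[OF scale.hyps]
  have "star (Cont S1) (scale (Cont S1) c f) = scale (Cont S1) (cnj c) (star (Cont S1) f)"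
    using l by (intro Cont_eqI Cont_closed) (auto simp: Cont_apply)
  then show ?case using laurent.scale[OF scale.IH] l by (simp add: adjoint_scale)
next
  case (mult f S g T)
  note l = laurent_carrier[OF mult.hyps(1)] laurent_carrier[OF mult.hyps(2)]
  have "star (Cont S1) (mult (Cont S1) f g) = mult (Cont S1) (star (Cont S1) g) (star (Cont S1) f)"
    using l by (intro Cont_eqI Cont_closed) (auto simp: Cont_apply)
  then show ?case using laurent.mult[OF mult.IH(2) mult.IH(1)] l by (simp add: adjoint_compose)
qed

lemma Cont_S1_bounded:
  assumes "f \<in> carrier (Cont S1)"
  obtains K where "K \<ge> 0" "\<And>w. w \<in> S1 \<Longrightarrow> cmod (f w) \<le> K"
proof -
  have "bounded (f ` S1)"
    using Cont_continuous[OF assms] by (intro compact_imp_bounded compact_continuous_image) auto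
  then obtain K where K: "\<forall>y\<in>f ` S1. cmod y \<le> K" unfolding bounded_iff by blast
  show ?thesis
  proof (rule that[of "max 0 K"])
    show "cmod (f w) \<le> max 0 K" if "w \<in> S1" for w using K that by (meson imageI max.coboundedI2)
  qed simp
qed

text \<open>The defect of a product on a wave y is
  \<open>S (T y - g w y) + g w (S y - f w y)\<close>, so bounds on defects pass through every rule.
  C depends on the derivation but not on N, w or x.\<close>

lemma laurent_wave:
  assumes "laurent f T"
  shows "\<exists>C\<ge>0. \<forall>N x. \<forall>w\<in>S1. norm (blinfun_apply T (wave U N w x) - f w *\<^sub>C wave U N w x) \<le> C * norm x"
  using assms
proof (induction rule: laurent.induct)
  case unit
  show ?case by (intro exI[of _ 0]) (simp add: Cont_apply)
next
  case var
  show ?case using U_wave_le by (intro exI[of _ 2]) (simp add: circle_var_apply)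
next
  case cnj_var
  have "norm (blinfun_apply (adjoint_op U) (wave U N w x) - cnj w *\<^sub>C wave U N w x) \<le> 2 * norm x"
    if w: "w \<in> S1" for N w x
  proof -
    let ?y = "wave U N w x"
    have ww: "cnj w * w = 1" using w by (simp add: complex_norm_square[symmetric] mult.commute)
    have "blinfun_apply (adjoint_op U) ?y - cnj w *\<^sub>C ?y =
        cnj w *\<^sub>C blinfun_apply (adjoint_op U) (w *\<^sub>C ?y - blinfun_apply U ?y)"
      by (simp add: blinfun.diff_right Lop_scaleC[OF Lop_adjoint[OF U_Lop]] cvec.scale_right_diff_distrib
          scaleC_scaleC ww)
    then have "norm (blinfun_apply (adjoint_op U) ?y - cnj w *\<^sub>C ?y) = norm (blinfun_apply U ?y - w *\<^sub>C ?y)"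
      using w by (simp add: norm_minus_commute)
    then show ?thesis using U_wave_le[OF w] by simp
  qed
  then show ?case by (intro exI[of _ 2]) (simp add: Cont_apply circle_var_apply)
next
  case (add f S g T)
  then obtain C D where C: "C \<ge> 0" "\<And>N x w. w \<in> S1 \<Longrightarrow> norm (blinfun_apply S (wave U N w x) - f w *\<^sub>C wave U N w x) \<le> C * norm x"
    and D: "D \<ge> 0" "\<And>N x w. w \<in> S1 \<Longrightarrow> norm (blinfun_apply T (wave U N w x) - g w *\<^sub>C wave U N w x) \<le> D * norm x"
    by blast
  have "norm (blinfun_apply (S + T) (wave U N w x) - add (Cont S1) f g w *\<^sub>C wave U N w x) \<le> (C + D) * norm x"
    if w: "w \<in> S1" for N x w
  proof -
    let ?y = "wave U N w x"
    have "blinfun_apply (S + T) ?y - add (Cont S1) f g w *\<^sub>C ?y =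
        (blinfun_apply S ?y - f w *\<^sub>C ?y) + (blinfun_apply T ?y - g w *\<^sub>C ?y)"
      using w by (simp add: Cont_apply blinfun.add_left scaleC_add_left)
    also have "norm \<dots> \<le> C * norm x + D * norm x"
      by (intro order_trans[OF norm_triangle_ineq] add_mono C D w)
    finally show ?thesis by (simp add: algebra_simps)
  qed
  then show ?case using C(1) D(1) by (intro exI[of _ "C + D"]) simp
next
  case (scale f S c)
  then obtain C where C: "C \<ge> 0" "\<And>N x w. w \<in> S1 \<Longrightarrow> norm (blinfun_apply S (wave U N w x) - f w *\<^sub>C wave U N w x) \<le> C * norm x"
    by blast
  have "norm (blinfun_apply (scale Lop c S) (wave U N w x) - scale (Cont S1) c f w *\<^sub>C wave U N w x) \<le> (cmod c * C) * norm x"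
    if w: "w \<in> S1" for N x w
  proof -
    let ?y = "wave U N w x"
    have "blinfun_apply (scale Lop c S) ?y - scale (Cont S1) c f w *\<^sub>C ?y = c *\<^sub>C (blinfun_apply S ?y - f w *\<^sub>C ?y)"
      using w by (simp add: Cont_apply cvec.scale_right_diff_distrib scaleC_scaleC)
    then show ?thesis using C(2)[OF w] by (simp add: mult.assoc mult_left_mono)
  qed
  then show ?case using C(1) by (intro exI[of _ "cmod c * C"]) simp
next
  case (mult f S g T)
  then obtain C D where C: "C \<ge> 0" "\<And>N x w. w \<in> S1 \<Longrightarrow> norm (blinfun_apply S (wave U N w x) - f w *\<^sub>C wave U N w x) \<le> C * norm x"
    and D: "D \<ge> 0" "\<And>N x w. w \<in> S1 \<Longrightarrow> norm (blinfun_apply T (wave U N w x) - g w *\<^sub>C wave U N w x) \<le> D * norm x"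
    by blast
  obtain K where K: "K \<ge> 0" "\<And>w. w \<in> S1 \<Longrightarrow> cmod (g w) \<le> K"
    using Cont_S1_bounded laurent_carrier(1)[OF mult.hyps(2)] by blast
  have "norm (blinfun_apply (S o\<^sub>L T) (wave U N w x) - mult (Cont S1) f g w *\<^sub>C wave U N w x) \<le> (norm S * D + K * C) * norm x"
    if w: "w \<in> S1" for N x w
  proof -
    let ?y = "wave U N w x"
    have "blinfun_apply (S o\<^sub>L T) ?y - mult (Cont S1) f g w *\<^sub>C ?y =
        blinfun_apply S (blinfun_apply T ?y - g w *\<^sub>C ?y) + g w *\<^sub>C (blinfun_apply S ?y - f w *\<^sub>C ?y)"
      using w laurent_carrier(2)[OF mult.hyps(1)]
      by (simp add: Cont_apply blinfun.diff_right Lop_scaleC cvec.scale_right_diff_distrib scaleC_scaleC mult.commute)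
    also have "norm \<dots> \<le> norm S * (D * norm x) + K * (C * norm x)"
    proof (rule norm_triangle_le, rule add_mono)
      show "norm (blinfun_apply S (blinfun_apply T ?y - g w *\<^sub>C ?y)) \<le> norm S * (D * norm x)"
        using norm_blinfun[of S "blinfun_apply T ?y - g w *\<^sub>C ?y"] mult_left_mono[OF D(2)[OF w, of N x], of "norm S"]
        by simp
      show "norm (g w *\<^sub>C (blinfun_apply S ?y - f w *\<^sub>C ?y)) \<le> K * (C * norm x)"
        unfolding norm_scaleC by (rule mult_mono[OF K(2)[OF w] C(2)[OF w] K(1)]) simp
    qed
    finally show ?thesis by (simp add: algebra_simps)
  qed
  then show ?case using C(1) D(1) K(1) by (intro exI[of _ "norm S * D + K * C"]) simp
qed

text \<open>T acts on waves as the scalar f w up to an error bounded by a multiple of the norm of x.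
  The functional calculus rests on the resulting bound by the supremum on the circle.\<close>

lemma norm_laurent_le:
  assumes l: "laurent f T" and M: "\<And>w. w \<in> S1 \<Longrightarrow> cmod (f w) \<le> M"
  shows "norm T \<le> M"
proof (rule norm_le_via_waves[OF norm_U laurent_carrier(2,3)[OF l]])
  have "(1::complex) \<in> S1" by simp
  from order_trans[OF norm_ge_zero M[OF this]] show "M \<ge> 0" .
  obtain C where C: "C \<ge> 0" "\<And>N x w. w \<in> S1 \<Longrightarrow>
      norm (blinfun_apply T (wave U N w x) - f w *\<^sub>C wave U N w x) \<le> C * norm x"
    using laurent_wave[OF l] by blast
  fix \<epsilon> :: real assume "\<epsilon> > 0"
  have "norm (blinfun_apply T (wave U N w x)) \<le> (M + \<epsilon>) * norm (wave U N w x) + C * norm x" if w: "w \<in> S1" for N x w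
  proof -
    have "norm (blinfun_apply T (wave U N w x)) \<le> norm (f w *\<^sub>C wave U N w x) + C * norm x"
      using norm_triangle_ineq2[of "blinfun_apply T (wave U N w x)" "f w *\<^sub>C wave U N w x"] C(2)[OF w, of N x]
      by linarith
    also have "norm (f w *\<^sub>C wave U N w x) \<le> (M + \<epsilon>) * norm (wave U N w x)"
      using M[OF w] \<open>\<epsilon> > 0\<close> by (simp add: mult_right_mono)
    finally show ?thesis by simp
  qed
  then show "\<exists>C\<ge>0. \<forall>N x. \<forall>w\<in>S1.
      norm (blinfun_apply T (wave U N w x)) \<le> (M + \<epsilon>) * norm (wave U N w x) + C * norm x"
    using C(1) by blast
qed

text \<open>Links Stone-Weierstrass, which approximates by real polynomials on the plane, to
  polynomials in w and \<open>cnj w\<close>.\<close>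

lemma laurent_real_polynomial:
  assumes "real_polynomial_function g"
  shows "\<exists>T. laurent (\<lambda>w\<in>S1. complex_of_real (g w)) T"
  using assms
proof (induction rule: real_polynomial_function.induct)
  case (linear h)
  \<comment> \<open>A real linear functional on the plane has the form 2 Re (c w), and its values at
    1 and \<i> determine c.\<close>
  define c where "c = (complex_of_real (h 1) - \<i> * complex_of_real (h \<i>)) / 2"
  have h: "complex_of_real (h w) = c * w + cnj c * cnj w" for w
  proof -
    interpret h: bounded_linear h by (rule linear)
    have "w = Re w *\<^sub>R 1 + Im w *\<^sub>R \<i>" by (simp add: complex_eq_iff)
    then have "h w = h (Re w *\<^sub>R 1 + Im w *\<^sub>R \<i>)" by simp
    also have "\<dots> = Re w * h 1 + Im w * h \<i>"
      by (simp only: linear_simps(1,5)[OF linear]) simp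
    finally show ?thesis by (simp add: c_def complex_eq_iff field_simps)
  qed
  have "(\<lambda>w\<in>S1. complex_of_real (h w)) =
      add (Cont S1) (scale (Cont S1) c circle_var) (scale (Cont S1) (cnj c) (star (Cont S1) circle_var))"
    by (auto simp: h Cont_simps circle_var_def)
  then show ?case using laurent.add[OF laurent.scale[OF laurent.var] laurent.scale[OF laurent.cnj_var]] by metis
next
  case (const c)
  have "(\<lambda>w\<in>S1. complex_of_real c) = scale (Cont S1) (complex_of_real c) (unit (Cont S1))"
    by (auto simp: Cont_simps)
  then show ?case using laurent.scale[OF laurent.unit] by metis
next
  case (add f g)
  then obtain S T where "laurent (\<lambda>w\<in>S1. complex_of_real (f w)) S" "laurent (\<lambda>w\<in>S1. complex_of_real (g w)) T" by blast
  moreover have "(\<lambda>w\<in>S1. complex_of_real (f w + g w)) =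
      add (Cont S1) (\<lambda>w\<in>S1. complex_of_real (f w)) (\<lambda>w\<in>S1. complex_of_real (g w))"
    by (auto simp: Cont_simps)
  ultimately show ?case using laurent.add by metis
next
  case (mult f g)
  then obtain S T where "laurent (\<lambda>w\<in>S1. complex_of_real (f w)) S" "laurent (\<lambda>w\<in>S1. complex_of_real (g w)) T" by blast
  moreover have "(\<lambda>w\<in>S1. complex_of_real (f w * g w)) =
      mult (Cont S1) (\<lambda>w\<in>S1. complex_of_real (f w)) (\<lambda>w\<in>S1. complex_of_real (g w))"
    by (auto simp: Cont_simps)
  ultimately show ?case using laurent.mult by metis
qed

lemma laurent_dense:
  assumes f: "f \<in> carrier (Cont S1)" and \<epsilon>: "\<epsilon> > 0"
  shows "\<exists>p T. laurent p T \<and> (\<forall>w\<in>S1. cmod (f w - p w) \<le> \<epsilon>)"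
proof -
  have cont: "continuous_on S1 (\<lambda>w. Re (f w))" "continuous_on S1 (\<lambda>w. Im (f w))"
    using Cont_continuous[OF f] by (auto intro: continuous_intros)
  obtain g where g: "real_polynomial_function g" "\<And>w. w \<in> S1 \<Longrightarrow> \<bar>Re (f w) - g w\<bar> < \<epsilon> / 2"
    using Stone_Weierstrass_real_polynomial_function[OF _ cont(1), of "\<epsilon> / 2"] \<epsilon> by auto
  obtain h where h: "real_polynomial_function h" "\<And>w. w \<in> S1 \<Longrightarrow> \<bar>Im (f w) - h w\<bar> < \<epsilon> / 2"
    using Stone_Weierstrass_real_polynomial_function[OF _ cont(2), of "\<epsilon> / 2"] \<epsilon> by auto
  obtain S T where ST: "laurent (\<lambda>w\<in>S1. complex_of_real (g w)) S" "laurent (\<lambda>w\<in>S1. complex_of_real (h w)) T"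
    using laurent_real_polynomial g(1) h(1) by blast
  let ?p = "add (Cont S1) (\<lambda>w\<in>S1. complex_of_real (g w)) (scale (Cont S1) \<i> (\<lambda>w\<in>S1. complex_of_real (h w)))"
  have "laurent ?p (S + scale Lop \<i> T)" using ST by (intro laurent.intros)
  moreover have "cmod (f w - ?p w) \<le> \<epsilon>" if w: "w \<in> S1" for w
  proof -
    have "cmod (f w - ?p w) \<le> \<bar>Re (f w - ?p w)\<bar> + \<bar>Im (f w - ?p w)\<bar>" by (rule cmod_le)
    also have "\<dots> = \<bar>Re (f w) - g w\<bar> + \<bar>Im (f w) - h w\<bar>" using w by (simp add: Cont_apply)
    finally show ?thesis using g(2)[OF w] h(2)[OF w] by linarith
  qed
  ultimately show ?thesis by blast
qed

end

section \<open>The tensor product of the restriction map with the identity\<close>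

lemma unital_star_hom_comp:
  "unital_star_hom A B f \<Longrightarrow> unital_star_hom B C g \<Longrightarrow> unital_star_hom A C (\<lambda>x. g (f x))"
  unfolding unital_star_hom_def by simp

lemma (in faithful_pair) te_unit_right_hom: "unital_star_hom A Lop (\<lambda>a. te a (unit B))"
  unfolding unital_star_hom_def Lop_simps
  using rep_A rep_B
  by (auto simp: tensor_elem_def tensor_op_add_left tensor_op_scale_left tensor_op_compose tensor_op_adjoint)

lemma (in faithful_pair) te_unit_left_hom: "unital_star_hom B Lop (\<lambda>b. te (unit A) b)"
  unfolding unital_star_hom_def Lop_simps
  using rep_A rep_B
  by (auto simp: tensor_elem_def tensor_op_add_right tensor_op_scale_right tensor_op_compose tensor_op_adjoint)

lemma (in faithful_pair) te_split:
  assumes "a \<in> carrier A" "b \<in> carrier B"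
  shows "te a b = te (unit A) b o\<^sub>L te a (unit B)" "te a b = te a (unit B) o\<^sub>L te (unit A) b"
  using rep_A rep_B assms by (auto simp: tensor_elem_def tensor_op_compose)

lemma unitary_circle_var:
  assumes "unital_star_hom (Cont S1) Lop \<pi>"
  shows "unitary (\<pi> circle_var)"
proof -
  interpret cont_rep S1 \<pi> by unfold_locales (rule assms)
  have sq: "cnj w * w = 1" "w * cnj w = 1" if "w \<in> S1" for w :: complex
    using that by (simp_all add: complex_norm_square[symmetric] mult.commute[of "cnj w"])
  have "mult (Cont S1) (star (Cont S1) circle_var) circle_var = unit (Cont S1)"
    by (rule Cont_eqI[of _ S1]) (auto simp: Cont_apply circle_var_apply sq)
  moreover have "mult (Cont S1) circle_var (star (Cont S1) circle_var) = unit (Cont S1)"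
    by (rule Cont_eqI[of _ S1]) (auto simp: Cont_apply circle_var_apply sq)
  ultimately show ?thesis
    by unfold_locales (simp_all add: rep_Lop rep_unit Cont_closed flip: rep_star rep_mult)
qed

locale circle_rep = cont_rep S1 \<pi> for \<pi> :: "(complex \<Rightarrow> complex) \<Rightarrow> ('h::complex_hilbert \<Rightarrow>\<^sub>L 'h)"
begin

sublocale unitary "\<pi> circle_var"
  by (rule unitary_circle_var[OF hom])

lemma laurent_rep: "laurent p T \<Longrightarrow> T = \<pi> p"
  by (induction rule: laurent.induct)
    (auto simp: rep_unit rep_star rep_add rep_scale rep_mult laurent_carrier(1))

text \<open>Uniform approximation of f by a Laurent polynomial adds an error proportional to the
  norm of the wave, which is why \<open>norm_le_via_waves\<close> leaves room for \<epsilon>. C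
  depends on \<epsilon> through the polynomial.\<close>

lemma rep_wave_le:
  assumes f: "f \<in> carrier (Cont S1)" and \<epsilon>: "\<epsilon> > 0"
  shows "\<exists>C\<ge>0. \<forall>N x. \<forall>w\<in>S1. norm (blinfun_apply (\<pi> f) (wave (\<pi> circle_var) N w x) -
    f w *\<^sub>C wave (\<pi> circle_var) N w x) \<le> \<epsilon> * norm (wave (\<pi> circle_var) N w x) + C * norm x"
proof -
  obtain p where l: "laurent p (\<pi> p)" and p: "\<And>w. w \<in> S1 \<Longrightarrow> cmod (f w - p w) \<le> \<epsilon> / 2"
    using laurent_dense[OF f, of "\<epsilon> / 2"] laurent_rep \<epsilon> by (metis half_gt_zero)
  obtain C where C: "C \<ge> 0" "\<And>N x w. w \<in> S1 \<Longrightarrow> norm (blinfun_apply (\<pi> p) (wave (\<pi> circle_var) N w x) -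
      p w *\<^sub>C wave (\<pi> circle_var) N w x) \<le> C * norm x"
    using laurent_wave[OF l] by blast
  have d: "norm (\<pi> f - \<pi> p) \<le> \<epsilon> / 2"
    using p \<epsilon> by (intro rep_diff_norm_le f laurent_carrier(1)[OF l]) auto
  have "norm (blinfun_apply (\<pi> f) (wave (\<pi> circle_var) N w x) -
    f w *\<^sub>C wave (\<pi> circle_var) N w x) \<le> \<epsilon> * norm (wave (\<pi> circle_var) N w x) + C * norm x"
    if w: "w \<in> S1" for N x w
  proof -
    let ?y = "wave (\<pi> circle_var) N w x"
    have *: "norm ((f w - p w) *\<^sub>C ?y) \<le> \<epsilon> / 2 * norm ?y"
      unfolding norm_scaleC by (rule mult_right_mono[OF p[OF w] norm_ge_zero])
    have "blinfun_apply (\<pi> f) ?y - f w *\<^sub>C ?y = blinfun_apply (\<pi> f - \<pi> p) ?y +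
        ((blinfun_apply (\<pi> p) ?y - p w *\<^sub>C ?y) - (f w - p w) *\<^sub>C ?y)"
      by (simp add: blinfun.diff_left cvec.scale_left_diff_distrib)
    also have "norm \<dots> \<le> \<epsilon> / 2 * norm ?y + (C * norm x + \<epsilon> / 2 * norm ?y)"
    proof (rule norm_triangle_le, rule add_mono, goal_cases)
      case 2
      show ?case
        by (rule order_trans[OF norm_triangle_ineq4 add_mono[OF C(2)[OF w] *]])
    next
      case 1
      show ?case
        by (rule order_trans[OF norm_blinfun mult_right_mono[OF d norm_ge_zero]])
    qed
    finally show ?thesis by simp
  qed
  then show ?thesis using C(1) by blast
qed

end

locale circle_tensor = cont_tensor S1 B for B :: "'b star_algebra"
begin

sublocale circle_rep "\<lambda>f. te f (unit B)"
  by unfold_locales (rule te_unit_right_hom)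

text \<open>On a wave of z tensor 1 the operator a tensor 1 is almost the scalar a w. So the sum
  acts almost as 1 tensor its value at w, whose norm is at most M.\<close>

lemma norm_le_eval:
  fixes a :: "nat \<Rightarrow> complex \<Rightarrow> complex"
  assumes ab: "\<And>k. k < n \<Longrightarrow> a k \<in> carrier (Cont S1) \<and> b k \<in> carrier B"
    and M: "\<And>w. w \<in> S1 \<Longrightarrow> norm (\<Sum>k<n. scale Lop (a k w) (rep B (b k))) \<le> M"
  shows "norm (\<Sum>k<n. te (a k) (b k)) \<le> M"
proof (rule norm_le_via_waves[OF norm_U])
  let ?R = "\<Sum>k<n. te (a k) (b k)" and ?U = "te circle_var (unit B)"
  have unitA: "unit (Cont S1) \<in> carrier (Cont S1)" and unitB: "unit B \<in> carrier B"
    using A(1) B(1) by (auto simp: star_closed_def)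
  define R where "R k = te (unit (Cont S1)) (b k)" for k
  have R: "R k \<in> carrier Lop" if "k < n" for k
    unfolding R_def using ab[OF that] unitA by (intro te_Lop) auto
  have split: "te (a k) (b k) = R k o\<^sub>L te (a k) (unit B)" if "k < n" for k
    unfolding R_def using ab[OF that] te_split(1) by blast
  show "?R \<in> carrier Lop" using ab by (intro Lop_sum te_Lop) auto
  have "blinfun_apply (te (a k) (b k)) (blinfun_apply ?U x) = blinfun_apply ?U (blinfun_apply (te (a k) (b k)) x)"
    if k: "k < n" for k x
  proof -
    have ak: "a k \<in> carrier (Cont S1)" "b k \<in> carrier B" using ab[OF k] by auto
    have "te (a k) (unit B) o\<^sub>L ?U = ?U o\<^sub>L te (a k) (unit B)"
      using ak by (simp flip: rep_mult) (simp add: Cont_simps mult.commute)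
    note 1 = compose_eqD[OF this]
    have "R k o\<^sub>L ?U = ?U o\<^sub>L R k"
      unfolding R_def using te_split[OF circle_var_Cont ak(2)] by simp
    note 2 = compose_eqD[OF this]
    show ?thesis unfolding split[OF k] by (simp add: 1 2)
  qed
  then show "blinfun_apply ?R (blinfun_apply ?U x) = blinfun_apply ?U (blinfun_apply ?R x)" for x
    by (simp add: blinfun.sum_left blinfun.sum_right)
  have "(1::complex) \<in> S1" by simp
  from order_trans[OF norm_ge_zero M[OF this]] show M0: "M \<ge> 0" .
  fix \<epsilon> :: real assume \<epsilon>: "\<epsilon> > 0"
  define L where "L = (\<Sum>k<n. norm (R k))"
  have L: "L \<ge> 0" by (simp add: L_def sum_nonneg)
  \<comment> \<open>Errors \<delta> in all the functions a k, weighted by the norms of the R k, add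
    up to at most \<epsilon>; L + 1 keeps the denominator positive.\<close>
  define \<delta> where "\<delta> = \<epsilon> / (L + 1)"
  have \<delta>: "\<delta> > 0" "L * \<delta> \<le> \<epsilon>" using L \<epsilon> by (simp_all add: \<delta>_def field_simps)
  have "\<forall>k. \<exists>C. k < n \<longrightarrow> C \<ge> 0 \<and> (\<forall>N x. \<forall>w\<in>S1. norm (blinfun_apply (te (a k) (unit B)) (wave ?U N w x) -
      a k w *\<^sub>C wave ?U N w x) \<le> \<delta> * norm (wave ?U N w x) + C * norm x)"
    using rep_wave_le[OF _ \<delta>(1)] ab by meson
  then obtain C where C: "\<And>k. k < n \<Longrightarrow> C k \<ge> 0"
    "\<And>k N x w. k < n \<Longrightarrow> w \<in> S1 \<Longrightarrow> norm (blinfun_apply (te (a k) (unit B)) (wave ?U N w x) -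
      a k w *\<^sub>C wave ?U N w x) \<le> \<delta> * norm (wave ?U N w x) + C k * norm x"
    by metis
  define D where "D = (\<Sum>k<n. norm (R k) * C k)"
  have D: "D \<ge> 0" unfolding D_def using C(1) by (intro sum_nonneg mult_nonneg_nonneg) auto
  have "norm (blinfun_apply ?R (wave ?U N w x)) \<le> (M + \<epsilon>) * norm (wave ?U N w x) + D * norm x"
    if w: "w \<in> S1" for N x w
  proof -
    let ?y = "wave ?U N w x"
    define err where "err k = blinfun_apply (te (a k) (unit B)) ?y - a k w *\<^sub>C ?y" for k
    let ?S = "\<Sum>k<n. scale Lop (a k w) (rep B (b k))"
    have S: "?S \<in> carrier Lop" using ab rep_B by (intro Lop_sum Lop_scale) auto
    \<comment> \<open>The induction carries membership in \<open>Lop\<close> along, because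
      additivity of \<open>tensor_op\<close> is stated for complex linear operators.\<close>
    have eval: "(\<Sum>k<n. scale Lop (a k w) (R k)) = tensor_op id_blinfun ?S"
    proof -
      have "(\<Sum>k<m. scale Lop (a k w) (R k)) = tensor_op id_blinfun (\<Sum>k<m. scale Lop (a k w) (rep B (b k))) \<and>
          (\<Sum>k<m. scale Lop (a k w) (rep B (b k))) \<in> carrier Lop" if "m \<le> n" for m
        using that
      proof (induction m)
        case 0
        have "tensor_op id_blinfun (0 :: 'b ell2 \<Rightarrow>\<^sub>L 'b ell2) =
            (0 :: ((complex \<Rightarrow> complex) \<times> 'b) ell2 \<Rightarrow>\<^sub>L _)"
          using norm_tensor_op_id_le[OF Lop_zero] by simp
        then show ?case by simp
      next
        case (Suc m)
        then have "rep B (b m) \<in> carrier Lop" using ab rep_B by auto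
        then show ?case using Suc rep_A
          by (auto simp: tensor_op_add_right tensor_op_scale_right Lop_scale R_def tensor_elem_def)
      qed
      then show ?thesis by blast
    qed
    have "blinfun_apply ?R ?y = (\<Sum>k<n. blinfun_apply (R k) (a k w *\<^sub>C ?y + err k))"
      unfolding blinfun.sum_left by (intro sum.cong) (auto simp: split err_def)
    also have "\<dots> = blinfun_apply (\<Sum>k<n. scale Lop (a k w) (R k)) ?y + (\<Sum>k<n. blinfun_apply (R k) (err k))"
      using R by (simp add: blinfun.sum_left blinfun.add_right sum.distrib Lop_scaleC)
    also have "norm \<dots> \<le> M * norm ?y + (\<Sum>k<n. norm (R k) * (\<delta> * norm ?y + C k * norm x))"
    proof (intro norm_triangle_le add_mono)
      show "norm (blinfun_apply (\<Sum>k<n. scale Lop (a k w) (R k)) ?y) \<le> M * norm ?y"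
        unfolding eval
        by (rule order_trans[OF norm_blinfun mult_right_mono[OF order_trans[OF norm_tensor_op_id_le[OF S] M[OF w]] norm_ge_zero]])
      show "norm (\<Sum>k<n. blinfun_apply (R k) (err k)) \<le> (\<Sum>k<n. norm (R k) * (\<delta> * norm ?y + C k * norm x))"
      proof (rule order_trans[OF norm_sum], rule sum_mono)
        fix k assume "k \<in> {..<n}"
        then have "norm (err k) \<le> \<delta> * norm ?y + C k * norm x" unfolding err_def using C(2) w by simp
        from mult_left_mono[OF this norm_ge_zero]
        show "norm (blinfun_apply (R k) (err k)) \<le> norm (R k) * (\<delta> * norm ?y + C k * norm x)"
          by (rule order_trans[OF norm_blinfun])
      qed
    qed
    also have "\<dots> = M * norm ?y + L * \<delta> * norm ?y + D * norm x"
      by (simp add: L_def D_def sum.distrib distrib_left sum_distrib_right mult.assoc)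
    also have "\<dots> \<le> M * norm ?y + \<epsilon> * norm ?y + D * norm x"
      using mult_right_mono[OF \<delta>(2) norm_ge_zero] by simp
    finally show ?thesis by (simp add: algebra_simps)
  qed
  then show "\<exists>C\<ge>0. \<forall>N x. \<forall>w\<in>S1. norm (blinfun_apply ?R (wave ?U N w x)) \<le>
      (M + \<epsilon>) * norm (wave ?U N w x) + C * norm x"
    using D by blast
qed

text \<open>The one-term case of evaluation. In the functional calculus it compares the supremum of
  a Laurent polynomial with an operator norm.\<close>

lemma cmod_le_norm_te:
  assumes "f \<in> carrier (Cont S1)" "w \<in> S1"
  shows "cmod (f w) \<le> norm (te f (unit B))"
proof -
  have unitB: "unit B \<in> carrier B" using B(1) by (auto simp: star_closed_def)
  have "norm (\<Sum>k<1::nat. scale Lop (f w) (rep B (unit B))) \<le> norm (\<Sum>k<1::nat. te f (unit B))"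
    using assms unitB by (intro norm_eval_le) auto
  then have le: "norm (scale Lop (f w) (id_blinfun :: 'b ell2 \<Rightarrow>\<^sub>L _)) \<le> norm (te f (unit B))"
    using rep_B by simp
  show ?thesis
    \<comment> \<open>An arbitrary basis vector serves as the unit vector on which the scalar f w
      shows its modulus.\<close>
    using norm_blinfun[of "scale Lop (f w) id_blinfun" "ket (undefined :: 'b)"] le by (simp add: norm_ket)
qed

end

section \<open>Restriction to the circle, on functions and on tensors\<close>

lemma jstar_apply: "w \<in> S1 \<Longrightarrow> jstar a w = a w"
  by (simp add: jstar_def pullback_def)

lemma jstar_hom: "unital_star_hom (Cont D2) (Cont S1) jstar"
proof -
  have sub: "S1 \<subseteq> D2" by auto
  have Cont: "jstar a \<in> carrier (Cont S1)" if "a \<in> carrier (Cont D2)" for a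
    unfolding jstar_def pullback_def
    by (rule Cont_I) (rule continuous_on_subset[OF Cont_continuous[OF that] sub])
  have w: "w \<in> D2" if "w \<in> S1" for w using sub that by blast
  show ?thesis
    unfolding unital_star_hom_def
    by (intro conjI ballI allI Cont Cont_eqI[of _ S1] Cont_closed; (assumption | simp only: Cont_apply jstar_apply w)?)
qed

context ell2_iso
begin

text \<open>Contractivity passes through point values: their supremum on the circle bounds the norm
  over the circle, and each of them is also a value over the disk.\<close>

sublocale tm: tensor_map "Cont D2" "Lop :: ('h \<Rightarrow>\<^sub>L 'h) star_algebra" "Cont S1" jstar
proof -
  interpret D: cont_tensor D2 "Lop :: ('h \<Rightarrow>\<^sub>L 'h) star_algebra"
    by unfold_locales (auto simp: star_closed_Cont star_closed_Lop rep_Lop intro: rep_Cont)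
  interpret C: circle_tensor "Lop :: ('h \<Rightarrow>\<^sub>L 'h) star_algebra"
    by unfold_locales (auto simp: star_closed_Cont star_closed_Lop rep_Lop intro: rep_Cont)
  show "tensor_map (Cont D2) (Lop :: ('h \<Rightarrow>\<^sub>L 'h) star_algebra) (Cont S1) jstar"
  proof unfold_locales
    show "unital_star_hom (Cont D2) (Cont S1) jstar" by (rule jstar_hom)
    fix n :: nat and a and b :: "nat \<Rightarrow> ('h \<Rightarrow>\<^sub>L 'h)"
    assume ab: "\<And>k. k < n \<Longrightarrow> a k \<in> carrier (Cont D2) \<and> b k \<in> carrier Lop"
    show "norm (\<Sum>k<n. C.te (jstar (a k)) (b k)) \<le> norm (\<Sum>k<n. D.te (a k) (b k))"
    proof (rule C.norm_le_eval)
      show "jstar (a k) \<in> carrier (Cont S1) \<and> b k \<in> carrier Lop" if "k < n" for k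
        using ab[OF that] jstar_hom unfolding unital_star_hom_def by blast
      fix w :: complex assume w: "w \<in> S1"
      then have "w \<in> D2" by simp
      from D.norm_eval_le[OF this ab]
      show "norm (\<Sum>k<n. scale Lop (jstar (a k) w) (rep Lop (b k))) \<le> norm (\<Sum>k<n. D.te (a k) (b k))"
        by (simp add: jstar_apply[OF w])
    qed
  qed
qed

sublocale circle: circle_tensor "Lop :: ('h \<Rightarrow>\<^sub>L 'h) star_algebra"
  by unfold_locales

end

section \<open>Extending the scalar loop over the disk\<close>

text \<open>Let h enumerate I. Composition of coefficients with h is a coisometry c with explicit
  formula; its adjoint is the isometry and sends the n-th basis vector to the one with index h
  n.\<close>

lemma exists_isometry_onto:
  fixes I :: "nat set"
  assumes I: "infinite I"
  shows "\<exists>v\<in>carrier Lop. adjoint_op v o\<^sub>L v = id_blinfun \<and>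
    v o\<^sub>L adjoint_op v = multop (\<lambda>i. if i \<in> I then 1 else 0)"
proof -
  obtain h :: "nat \<Rightarrow> nat" where h: "bij_betw h UNIV I"
    using I countableI_type bij_betw_from_nat_into by blast
  then have inj: "inj h" and ran: "range h = I" by (auto simp: bij_betw_def)
  have le: "L2_set (\<lambda>n. cmod (ell2_coeff x (h n))) F \<le> norm x" if "finite F" for F and x :: "nat ell2"
  proof -
    have "L2_set (\<lambda>n. cmod (ell2_coeff x (h n))) F = L2_set (\<lambda>i. cmod (ell2_coeff x i)) (h ` F)"
      unfolding L2_set_def using inj by (simp add: sum.reindex inj_on_def)
    also have "\<dots> \<le> norm x" using that by (intro ell2_L2_set_le_norm) simp
    finally show ?thesis .
  qed
  have "(\<lambda>n. (cmod (ell2_coeff x (h n)))\<^sup>2) summable_on UNIV" for x :: "nat ell2"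
  proof (rule nonneg_bdd_above_summable_on)
    show "bdd_above (sum (\<lambda>n. (cmod (ell2_coeff x (h n)))\<^sup>2) ` {F. F \<subseteq> UNIV \<and> finite F})"
      using le[of _ x] unfolding L2_set_def by (intro bdd_aboveI2[of _ _ "(norm x)\<^sup>2"]) (auto dest: sqrt_le_D)
  qed simp
  note coeff = ell2_coeff_Abs[OF this]
  define f where "f x = Abs_ell2 (\<lambda>n. ell2_coeff x (h n))" for x :: "nat ell2"
  have f: "ell2_coeff (f x) n = ell2_coeff x (h n)" for x n
    by (simp add: f_def coeff)
  have "bounded_linear f"
  proof (rule bounded_linear_intro)
    show "norm (f x) \<le> norm x * 1" for x
      by (simp, rule ell2_norm_leI) (simp add: f le)
  qed (auto intro!: ell2_eqI simp: f ell2_coeff_simps)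
  define c where "c = Blinfun f"
  have c: "ell2_coeff (blinfun_apply c x) n = ell2_coeff x (h n)" for x n
    using \<open>bounded_linear f\<close> by (simp add: c_def bounded_linear_Blinfun_apply f)
  have cL: "c \<in> carrier Lop"
    by (auto simp: Lop_iff c ell2_coeff_simps intro!: ell2_eqI)
  have c_ket: "blinfun_apply c (ket (h n)) = ket n" for n
    using inj by (intro ell2_eqI) (auto simp: c ell2_coeff_ket inj_def)
  have c_ket0: "blinfun_apply c (ket i) = 0" if "i \<notin> I" for i
    using that ran by (intro ell2_eqI) (auto simp: c ell2_coeff_ket zero_ell2.rep_eq)
  have adj: "ell2_coeff (blinfun_apply (adjoint_op c) y) i = cinner (blinfun_apply c (ket i)) y" for y i
    by (simp add: cinner_adjoint_op[OF cL] flip: cinner_ket)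
  have bd: "bounded (range (\<lambda>i. if i \<in> I then 1 else 0 :: complex))"
    by (rule boundedI[of _ 1]) auto
  have "c o\<^sub>L adjoint_op c = id_blinfun"
    by (intro blinfun_eqI ell2_eqI) (simp add: c adj c_ket cinner_ket)
  moreover have "adjoint_op c o\<^sub>L c = multop (\<lambda>i. if i \<in> I then 1 else 0)"
  proof (intro blinfun_eqI ell2_eqI)
    fix x i
    show "ell2_coeff (blinfun_apply (adjoint_op c o\<^sub>L c) x) i =
        ell2_coeff (blinfun_apply (multop (\<lambda>i. if i \<in> I then 1 else 0)) x) i"
    proof (cases "i \<in> I")
      case True
      then obtain n where "i = h n" using ran by blast
      then show ?thesis using True bd by (simp add: adj c_ket cinner_ket c)
    next
      case False
      then show ?thesis using bd by (simp add: adj c_ket0)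
    qed
  qed
  ultimately show ?thesis using cL by (intro bexI[of _ "adjoint_op c"]) auto
qed

text \<open>
  With respect to the decomposition of the space into the ranges of \<open>p\<close> and \<open>q\<close>, this is the
  matrix with rows \<open>(Z, -S)\<close> and \<open>(S, Z*)\<close>. It extends \<open>diag(z, 1/z)\<close> from the circle, where \<open>S = 0\<close>,
  over the disk.
\<close>

definition rotation ::
    "('h::complex_hilbert \<Rightarrow>\<^sub>L 'h) \<Rightarrow> ('h \<Rightarrow>\<^sub>L 'h) \<Rightarrow> ('h \<Rightarrow>\<^sub>L 'h) \<Rightarrow> ('h \<Rightarrow>\<^sub>L 'h) \<Rightarrow> ('h \<Rightarrow>\<^sub>L 'h)" where
  "rotation Z S p q = (p o\<^sub>L ((Z o\<^sub>L adjoint_op p) - (S o\<^sub>L adjoint_op q))) +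
     (q o\<^sub>L ((adjoint_op Z o\<^sub>L adjoint_op q) + (S o\<^sub>L adjoint_op p)))"

text \<open>The isometries p and q identify two copies of the space with complementary orthogonal
  ranges, and the entries sit between p, q and their adjoints. What remains is the 2 x 2 computation
  with commuting entries, where the squared modulus of Z and the square of S add up to 1.\<close>

lemma unitary_rotation:
  assumes L: "Z \<in> carrier Lop" "S \<in> carrier Lop" "p \<in> carrier Lop" "q \<in> carrier Lop"
    and ZS: "(adjoint_op Z o\<^sub>L Z) + (S o\<^sub>L S) = id_blinfun" "(Z o\<^sub>L adjoint_op Z) + (S o\<^sub>L S) = id_blinfun"
      "adjoint_op S = S" "S o\<^sub>L Z = Z o\<^sub>L S"
    and pq: "adjoint_op p o\<^sub>L p = id_blinfun" "adjoint_op q o\<^sub>L q = id_blinfun" "adjoint_op p o\<^sub>L q = 0"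
      "(p o\<^sub>L adjoint_op p) + (q o\<^sub>L adjoint_op q) = id_blinfun"
  shows "unitary (rotation Z S p q)"
proof
  note L' = L L[THEN Lop_adjoint]
  show "rotation Z S p q \<in> carrier Lop"
    unfolding rotation_def by (intro Lop_add Lop_compose Lop_diff L')
  have adj: "adjoint_op (rotation Z S p q) =
      (((p o\<^sub>L adjoint_op Z) - (q o\<^sub>L S)) o\<^sub>L adjoint_op p) + (((q o\<^sub>L Z) + (p o\<^sub>L S)) o\<^sub>L adjoint_op q)"
    unfolding rotation_def using L'
    by (simp add: adjoint_add adjoint_diff adjoint_compose Lop_add Lop_compose Lop_diff ZS(3))
  have "adjoint_op (S o\<^sub>L Z) = adjoint_op (Z o\<^sub>L S)" by (simp only: ZS(4))
  then have SZ': "S o\<^sub>L adjoint_op Z = adjoint_op Z o\<^sub>L S"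
    using L by (simp add: adjoint_compose ZS(3))
  have "adjoint_op (adjoint_op p o\<^sub>L q) = 0" by (simp add: pq(3))
  then have "adjoint_op q o\<^sub>L p = 0" using L' by (simp add: adjoint_compose)
  from arg_cong[OF this, of "\<lambda>T. blinfun_apply T x" for x]
  have qp: "blinfun_apply (adjoint_op q) (blinfun_apply p x) = 0" for x by simp
  from arg_cong[OF pq(3), of "\<lambda>T. blinfun_apply T x" for x]
  have pq': "blinfun_apply (adjoint_op p) (blinfun_apply q x) = 0" for x by simp
  \<comment> \<open>Each relation between the entries becomes a rewrite rule on vectors;
    \<open>resolve\<close> does the same for the ranges by eliminating the projection onto the range
    of q.\<close>
  have sum_eq: "blinfun_apply (A o\<^sub>L B) x = x - blinfun_apply (C o\<^sub>L D) x"
    if "(A o\<^sub>L B) + (C o\<^sub>L D) = id_blinfun" for A B C D :: "'a \<Rightarrow>\<^sub>L 'a" and x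
    using arg_cong[OF that, of "\<lambda>T. blinfun_apply T x"] by (simp add: blinfun.add_left algebra_simps)
  note rules = compose_idD[OF pq(1)] compose_idD[OF pq(2)] qp pq' compose_eqD[OF ZS(4)] compose_eqD[OF SZ']
    sum_eq[OF ZS(1), simplified] sum_eq[OF ZS(2), simplified]
  have resolve: "blinfun_apply q (blinfun_apply (adjoint_op q) x) = x - blinfun_apply p (blinfun_apply (adjoint_op p) x)" for x
    using arg_cong[OF pq(4), of "\<lambda>T. blinfun_apply T x"] by (simp add: blinfun.add_left algebra_simps)
  show "adjoint_op (rotation Z S p q) o\<^sub>L rotation Z S p q = id_blinfun"
    unfolding adj by (rule blinfun_eqI) (simp add: rotation_def rules blinfun.bilinear_simps resolve)
  show "rotation Z S p q o\<^sub>L adjoint_op (rotation Z S p q) = id_blinfun"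
    unfolding adj by (rule blinfun_eqI) (simp add: rotation_def rules blinfun.bilinear_simps resolve)
qed

lemma min_tensor_simps:
  "add (A \<otimes>\<^sub>m\<^sub>i\<^sub>n B) = (+)" "scale (A \<otimes>\<^sub>m\<^sub>i\<^sub>n B) = scale Lop"
  "mult (A \<otimes>\<^sub>m\<^sub>i\<^sub>n B) = (o\<^sub>L)" "star (A \<otimes>\<^sub>m\<^sub>i\<^sub>n B) = adjoint_op"
  "unit (A \<otimes>\<^sub>m\<^sub>i\<^sub>n B) = id_blinfun"
  by (simp_all add: min_tensor_def Lop_simps)

lemma star_hom_zero:
  assumes "unital_star_hom Lop Lop f"
  shows "f 0 = 0"
proof -
  have "f (0 + 0) = f 0 + f 0"
    using assms Lop_zero unfolding unital_star_hom_def Lop_simps by blast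
  then show ?thesis by simp
qed

lemma unitary_compose:
  assumes "unitary S" "unitary T"
  shows "unitary (S o\<^sub>L T)"
proof -
  interpret S: unitary S by (rule assms)
  interpret T: unitary T by (rule assms)
  show ?thesis
    by unfold_locales (auto simp: adjoint_compose S.U_Lop T.U_Lop intro!: blinfun_eqI Lop_compose)
qed

section \<open>The coordinate functions and constant operators over the disk\<close>

context ell2_iso
begin

abbreviation "teD \<equiv> tensor_elem (Cont D2) (Lop :: ('h \<Rightarrow>\<^sub>L 'h) star_algebra)"
abbreviation "teC \<equiv> tensor_elem (Cont S1) (Lop :: ('h \<Rightarrow>\<^sub>L 'h) star_algebra)"
abbreviation "tensorD \<equiv> carrier (Cont D2 \<otimes>\<^sub>m\<^sub>i\<^sub>n (Lop :: ('h \<Rightarrow>\<^sub>L 'h) star_algebra))"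
abbreviation "restr \<equiv> tm.graph.hom"

text \<open>Isometries are built from index sets on l2 over \<open>nat\<close>; this carries them to
  H and into the algebra over the disk as constant functions.\<close>

definition \<tau>D where "\<tau>D T = teD (unit (Cont D2)) (V o\<^sub>L T o\<^sub>L W)"
definition \<tau>C where "\<tau>C T = teC (unit (Cont S1)) (V o\<^sub>L T o\<^sub>L W)"

lemma \<tau>D_hom: "unital_star_hom Lop Lop \<tau>D"
  unfolding \<tau>D_def by (rule unital_star_hom_comp[OF star_hom_from tm.AB.te_unit_left_hom])

lemma \<tau>C_hom: "unital_star_hom Lop Lop \<tau>C"
  unfolding \<tau>C_def by (rule unital_star_hom_comp[OF star_hom_from tm.A'B.te_unit_left_hom])

lemma VW_Lop: "T \<in> carrier Lop \<Longrightarrow> V o\<^sub>L T o\<^sub>L W \<in> carrier Lop"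
  using star_hom_from unfolding unital_star_hom_def by blast

lemmas subalgebra = tm.graph.subalgebra[unfolded tm.fst_span]

lemma tensorD_closed:
  "S \<in> tensorD \<Longrightarrow> S \<in> carrier Lop"
  "S \<in> tensorD \<Longrightarrow> T \<in> tensorD \<Longrightarrow> S + T \<in> tensorD"
  "S \<in> tensorD \<Longrightarrow> scale Lop c S \<in> tensorD"
  "S \<in> tensorD \<Longrightarrow> T \<in> tensorD \<Longrightarrow> S o\<^sub>L T \<in> tensorD"
  "S \<in> tensorD \<Longrightarrow> adjoint_op S \<in> tensorD"
  using subalgebra[of S S] subalgebra(2,4)[of S T] by blast+

lemma teD_tensorD: "a \<in> carrier (Cont D2) \<Longrightarrow> b \<in> carrier Lop \<Longrightarrow> teD a b \<in> tensorD"
  unfolding tm.fst_span[symmetric]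
  by (rule closure_subset[THEN subsetD], rule image_eqI[of _ fst "(teD a b, teC (jstar a) b)"], simp,
      rule span_base) (auto simp: tm.elementary_def)

lemma tensorD_diff: "S \<in> tensorD \<Longrightarrow> T \<in> tensorD \<Longrightarrow> S - T \<in> tensorD"
  using tensorD_closed(2)[of S "scale Lop (-1) T"] tensorD_closed(3)[of T "-1"] by simp

lemma restr_ops:
  "S \<in> tensorD \<Longrightarrow> T \<in> tensorD \<Longrightarrow> restr (S + T) = restr S + restr T"
  "S \<in> tensorD \<Longrightarrow> restr (scale Lop c S) = scale Lop c (restr S)"
  "S \<in> tensorD \<Longrightarrow> T \<in> tensorD \<Longrightarrow> restr (S o\<^sub>L T) = restr S o\<^sub>L restr T"
  "S \<in> tensorD \<Longrightarrow> restr (adjoint_op S) = adjoint_op (restr S)"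
  using tm.graph_hom[unfolded unital_star_hom_def min_tensor_simps] by blast+

lemma restr_diff: "S \<in> tensorD \<Longrightarrow> T \<in> tensorD \<Longrightarrow> restr (S - T) = restr S - restr T"
  using restr_ops(1)[of S "scale Lop (-1) T"] restr_ops(2)[of T "-1"] tensorD_closed(3)[of T "-1"] by simp

definition ZD where "ZD = teD (\<lambda>z\<in>D2. z) id_blinfun"
definition SD where "SD = teD (\<lambda>z\<in>D2. complex_of_real (sqrt (1 - (cmod z)\<^sup>2))) id_blinfun"
definition ZC where "ZC = teC circle_var id_blinfun"

lemma ZC_unitary: "unitary ZC"
  using unitary_circle_var[OF tm.A'B.te_unit_right_hom] by (simp add: ZC_def Lop_simps)

lemma disk_functions:
  "(\<lambda>z\<in>D2. z) \<in> carrier (Cont D2)"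
  "(\<lambda>z\<in>D2. complex_of_real (sqrt (1 - (cmod z)\<^sup>2))) \<in> carrier (Cont D2)"
  by (intro Cont_I continuous_intros)+

lemma restr_simps:
  "restr ZD = ZC" "restr SD = 0" "T \<in> carrier Lop \<Longrightarrow> restr (\<tau>D T) = \<tau>C T"
proof -
  have "jstar (\<lambda>z\<in>D2. z) = circle_var"
    by (auto simp: jstar_def pullback_def circle_var_def)
  then show "restr ZD = ZC"
    unfolding ZD_def ZC_def by (simp add: tm.graph_hom_te disk_functions)
  \<comment> \<open>The record has no field for zero, so the zero function is written as 0 times the
    unit.\<close>
  have "jstar (\<lambda>z\<in>D2. complex_of_real (sqrt (1 - (cmod z)\<^sup>2))) = scale (Cont S1) 0 (unit (Cont S1))"
    by (auto simp: jstar_def pullback_def Cont_simps)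
  then have "restr SD = scale Lop 0 (teC (unit (Cont S1)) id_blinfun)"
    unfolding SD_def by (simp add: tm.graph_hom_te disk_functions tm.A'B.te_scale_left Cont_closed)
  also have "\<dots> = 0" by (rule blinfun_eqI) simp
  finally show "restr SD = 0" .
  have "jstar (unit (Cont D2)) = unit (Cont S1)" using jstar_hom unfolding unital_star_hom_def by blast
  then show "restr (\<tau>D T) = \<tau>C T" if "T \<in> carrier Lop"
    unfolding \<tau>D_def \<tau>C_def using that by (simp add: tm.graph_hom_te Cont_closed VW_Lop)
qed

lemma in_tensorD: "ZD \<in> tensorD" "SD \<in> tensorD" "T \<in> carrier Lop \<Longrightarrow> \<tau>D T \<in> tensorD"
  unfolding ZD_def SD_def \<tau>D_def by (intro teD_tensorD disk_functions Cont_closed Lop_id VW_Lop; assumption)+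

lemma ZD_SD:
  "(adjoint_op ZD o\<^sub>L ZD) + (SD o\<^sub>L SD) = id_blinfun" "(ZD o\<^sub>L adjoint_op ZD) + (SD o\<^sub>L SD) = id_blinfun"
  "adjoint_op SD = SD" "SD o\<^sub>L ZD = ZD o\<^sub>L SD"
proof -
  define z s :: "complex \<Rightarrow> complex" where "z = (\<lambda>z\<in>D2. z)" and "s = (\<lambda>z\<in>D2. complex_of_real (sqrt (1 - (cmod z)\<^sup>2)))"
  have zs: "z \<in> carrier (Cont D2)" "s \<in> carrier (Cont D2)"
    unfolding z_def s_def by (rule disk_functions)+
  have z: "z w = w" and s: "s w = complex_of_real (sqrt (1 - (cmod w)\<^sup>2))" if "w \<in> D2" for w
    using that by (simp_all add: z_def s_def)
  interpret cont_rep D2 "\<lambda>f. teD f id_blinfun"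
    using tm.AB.te_unit_right_hom by unfold_locales (simp add: Lop_simps)
  have ZS: "ZD = teD z id_blinfun" "SD = teD s id_blinfun" by (simp_all add: ZD_def SD_def z_def s_def)
  have sq: "cnj w * w + s w * s w = 1" "w * cnj w + s w * s w = 1" if w: "w \<in> D2" for w
  proof -
    have "(cmod w)\<^sup>2 \<le> 1" using w by (simp add: power_le_one)
    then have "s w * s w = complex_of_real (1 - (cmod w)\<^sup>2)"
      by (simp add: s[OF w] flip: of_real_mult)
    moreover have "w * cnj w = complex_of_real ((cmod w)\<^sup>2)" by (simp only: complex_norm_square)
    ultimately show "cnj w * w + s w * s w = 1" "w * cnj w + s w * s w = 1"
      by (simp_all add: mult.commute[of "cnj w"])
  qed
  note ops = rep_star[symmetric] rep_mult[symmetric] rep_add[symmetric] zs Cont_closed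
  have "add (Cont D2) (mult (Cont D2) (star (Cont D2) z) z) (mult (Cont D2) s s) = unit (Cont D2)"
    by (intro Cont_eqI[of _ D2] Cont_closed zs) (simp only: Cont_apply z sq)
  then show "(adjoint_op ZD o\<^sub>L ZD) + (SD o\<^sub>L SD) = id_blinfun"
    unfolding ZS by (simp add: ops rep_unit)
  have "add (Cont D2) (mult (Cont D2) z (star (Cont D2) z)) (mult (Cont D2) s s) = unit (Cont D2)"
    by (intro Cont_eqI[of _ D2] Cont_closed zs) (simp only: Cont_apply z sq)
  then show "(ZD o\<^sub>L adjoint_op ZD) + (SD o\<^sub>L SD) = id_blinfun"
    unfolding ZS by (simp add: ops rep_unit)
  have "star (Cont D2) s = s"
    by (intro Cont_eqI[of _ D2] Cont_closed zs) (simp add: Cont_apply s)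
  then show "adjoint_op SD = SD" unfolding ZS by (simp add: ops)
  have "mult (Cont D2) s z = mult (Cont D2) z s"
    by (intro Cont_eqI[of _ D2] Cont_closed zs) (simp add: Cont_apply)
  then show "SD o\<^sub>L ZD = ZD o\<^sub>L SD" unfolding ZS by (simp add: ops)
qed

section \<open>The three partial loops and their product\<close>

definition res3 :: "nat \<Rightarrow> (nat ell2 \<Rightarrow>\<^sub>L nat ell2)" where
  "res3 i = multop (\<lambda>n. if n mod 3 = i then 1 else 0)"

lemma bounded_indicator:
  "bounded (range (\<lambda>n. if P n then 1 else 0 :: complex))"
  "bounded (range (\<lambda>n. if P n then 0 else 1 :: complex))"
  by (rule boundedI[of _ 1]; auto)+

lemma res3_Lop [intro, simp]: "res3 i \<in> carrier Lop"
  unfolding res3_def by (intro multop_Lop bounded_indicator(1))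

lemma res3_simps:
  "i \<noteq> j \<Longrightarrow> res3 i o\<^sub>L res3 j = 0" "res3 0 + res3 1 + res3 2 = id_blinfun"
proof -
  show "res3 i o\<^sub>L res3 j = 0" if "i \<noteq> j"
    using that unfolding res3_def
    by (intro blinfun_eqI ell2_eqI) (auto simp: ell2_coeff_multop[OF bounded_indicator(1)] zero_ell2.rep_eq)
  have "n mod 3 = 0 \<or> n mod 3 = 1 \<or> n mod 3 = 2" for n :: nat by presburger
  then show "res3 0 + res3 1 + res3 2 = id_blinfun"
    unfolding res3_def
    by (intro blinfun_eqI ell2_eqI)
      (force simp: ell2_coeff_multop[OF bounded_indicator(1)] plus_ell2.rep_eq blinfun.add_left)
qed

text \<open>
  \<open>g\<close> restricts on the circle to \<open>1/z\<close> on the basis vectors in the residue class of \<open>i\<close> modulo 3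
  and to \<open>z\<close> on the others, so that the product over the three classes is \<open>z\<close> everywhere.
\<close>

lemma exists_partial_extension:
  assumes i: "i < 3"
  shows "\<exists>g\<in>tensorD. unitary g \<and> (\<forall>x. blinfun_apply (restr g) x = blinfun_apply ZC x +
    blinfun_apply (adjoint_op ZC - ZC) (blinfun_apply (\<tau>C (res3 i)) x))"
proof -
  have inf: "infinite {n::nat. n mod 3 = i}" "infinite {n::nat. n mod 3 \<noteq> i}"
  proof -
    have "\<exists>n\<ge>m. n mod 3 = k" if "k < 3" for m k :: nat
      using that by (intro exI[of _ "3 * m + k"]) simp
    then have inf: "infinite {n::nat. n mod 3 = k}" if "k < 3" for k
      unfolding infinite_nat_iff_unbounded_le using that by blast
    show "infinite {n::nat. n mod 3 = i}" using inf[OF i] .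
    have "(i + 1) mod 3 \<noteq> i" using i by presburger
    then have "{n::nat. n mod 3 = (i + 1) mod 3} \<subseteq> {n. n mod 3 \<noteq> i}" by auto
    then show "infinite {n::nat. n mod 3 \<noteq> i}" using inf[of "(i + 1) mod 3"] infinite_super by auto
  qed
  obtain v where v: "v \<in> carrier Lop" "adjoint_op v o\<^sub>L v = id_blinfun"
    "v o\<^sub>L adjoint_op v = multop (\<lambda>n. if n mod 3 \<noteq> i then 1 else 0)"
    using exists_isometry_onto[OF inf(2)] by auto
  obtain w where w: "w \<in> carrier Lop" "adjoint_op w o\<^sub>L w = id_blinfun" "w o\<^sub>L adjoint_op w = res3 i"
    using exists_isometry_onto[OF inf(1)] by (auto simp: res3_def)
  have vw: "(v o\<^sub>L adjoint_op v) + (w o\<^sub>L adjoint_op w) = id_blinfun"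
    unfolding v(3) w(3) res3_def
    by (intro blinfun_eqI ell2_eqI) (simp add: blinfun.add_left plus_ell2.rep_eq ell2_coeff_multop[OF bounded_indicator(1)])
  \<comment> \<open>The projections onto the ranges have product 0; cancelling w on the right and v
    on the left leaves the claim.\<close>
  have vw0: "adjoint_op v o\<^sub>L w = 0"
  proof (rule blinfun_eqI)
    fix x
    have "blinfun_apply (v o\<^sub>L adjoint_op v) (blinfun_apply (w o\<^sub>L adjoint_op w) y) = 0" for y
      unfolding v(3) w(3) res3_def
      by (intro ell2_eqI) (simp add: ell2_coeff_multop[OF bounded_indicator(1)] zero_ell2.rep_eq)
    from this[of "blinfun_apply w x"]
    have "blinfun_apply v (blinfun_apply (adjoint_op v) (blinfun_apply w x)) = 0"
      by (simp add: compose_idD[OF w(2)])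
    then have "blinfun_apply (adjoint_op v) (blinfun_apply v (blinfun_apply (adjoint_op v) (blinfun_apply w x))) = 0"
      by (simp add: blinfun.zero_right)
    then show "blinfun_apply (adjoint_op v o\<^sub>L w) x = blinfun_apply 0 x"
      by (simp add: compose_idD[OF v(2)])
  qed
  note D = \<tau>D_hom[unfolded unital_star_hom_def Lop_simps] and C = \<tau>C_hom[unfolded unital_star_hom_def Lop_simps]
  note vwL = v(1) w(1) v(1)[THEN Lop_adjoint] w(1)[THEN Lop_adjoint]
  \<comment> \<open>The first isometry carries z and the second 1/z, so 1/z lands on the range of w,
    the residue class of i.\<close>
  define g where "g = rotation ZD SD (\<tau>D v) (\<tau>D w)"
  have T0: "\<tau>D 0 = 0"
    by (rule star_hom_zero[OF \<tau>D_hom])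
  have U: "unitary g"
    unfolding g_def
  proof (rule unitary_rotation[OF _ _ _ _ ZD_SD])
    show "ZD \<in> carrier Lop" "SD \<in> carrier Lop" "\<tau>D v \<in> carrier Lop" "\<tau>D w \<in> carrier Lop"
      using in_tensorD v(1) w(1) tensorD_closed(1) by blast+
    show "adjoint_op (\<tau>D v) o\<^sub>L \<tau>D v = id_blinfun" "adjoint_op (\<tau>D w) o\<^sub>L \<tau>D w = id_blinfun"
      "adjoint_op (\<tau>D v) o\<^sub>L \<tau>D w = 0"
      using D vwL v(2) w(2) vw0 T0 by metis+
    show "(\<tau>D v o\<^sub>L adjoint_op (\<tau>D v)) + (\<tau>D w o\<^sub>L adjoint_op (\<tau>D w)) = id_blinfun"
      using D vwL vw Lop_compose by metis
  qed
  have mem: "g \<in> tensorD"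
    unfolding g_def rotation_def
    by (intro tensorD_closed(2,4,5) tensorD_diff in_tensorD v(1) w(1))
  have restr: "restr g = rotation ZC 0 (\<tau>C v) (\<tau>C w)"
    unfolding g_def rotation_def
    by (simp add: restr_ops restr_diff tensorD_closed(2,4,5) tensorD_diff in_tensorD restr_simps v(1) w(1))
  have commute: "\<tau>C T o\<^sub>L ZC = ZC o\<^sub>L \<tau>C T" if "T \<in> carrier Lop" for T
    using tm.A'B.te_split[OF circle_var_Cont VW_Lop[OF that]] by (simp add: \<tau>C_def ZC_def Lop_simps)
  interpret Z: unitary ZC by (rule ZC_unitary)
  have commute': "\<tau>C T o\<^sub>L adjoint_op ZC = adjoint_op ZC o\<^sub>L \<tau>C T" if "T \<in> carrier Lop" for T
  proof (rule blinfun_eqI)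
    fix x
    have "blinfun_apply ZC (blinfun_apply (\<tau>C T) (blinfun_apply (adjoint_op ZC) x)) = blinfun_apply (\<tau>C T) x"
      using compose_eqD[OF commute[OF that], of "blinfun_apply (adjoint_op ZC) x"] by simp
    then have "blinfun_apply (adjoint_op ZC) (blinfun_apply ZC (blinfun_apply (\<tau>C T) (blinfun_apply (adjoint_op ZC) x))) =
        blinfun_apply (adjoint_op ZC) (blinfun_apply (\<tau>C T) x)" by simp
    then show "blinfun_apply (\<tau>C T o\<^sub>L adjoint_op ZC) x = blinfun_apply (adjoint_op ZC o\<^sub>L \<tau>C T) x" by simp
  qed
  have ww: "\<tau>C w o\<^sub>L adjoint_op (\<tau>C w) = \<tau>C (res3 i)"
    using C vwL w(3) by metis
  have "(\<tau>C v o\<^sub>L adjoint_op (\<tau>C v)) + (\<tau>C w o\<^sub>L adjoint_op (\<tau>C w)) = id_blinfun"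
    using C vwL vw Lop_compose by metis
  then have vv: "\<tau>C v o\<^sub>L adjoint_op (\<tau>C v) = id_blinfun - \<tau>C (res3 i)"
    unfolding ww by (simp add: eq_diff_eq)
  have "blinfun_apply (restr g) x = blinfun_apply ZC x +
    blinfun_apply (adjoint_op ZC - ZC) (blinfun_apply (\<tau>C (res3 i)) x)" for x
  proof -
    \<comment> \<open>\<open>ZC\<close> and its adjoint commute with constant operators, so they can
      be pulled out in front of the two range projections.\<close>
    have "blinfun_apply (restr g) x = blinfun_apply ZC (blinfun_apply (\<tau>C v o\<^sub>L adjoint_op (\<tau>C v)) x) +
        blinfun_apply (adjoint_op ZC) (blinfun_apply (\<tau>C w o\<^sub>L adjoint_op (\<tau>C w)) x)"
      unfolding restr rotation_def
      by (simp add: blinfun.bilinear_simps compose_eqD[OF commute[OF v(1)]] compose_eqD[OF commute'[OF w(1)]])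
    then show ?thesis unfolding vv ww by (simp add: blinfun.bilinear_simps)
  qed
  then show ?thesis using mem U by blast
qed

lemma exists_unitary_extension: "\<exists>u\<in>tensorD. unitary u \<and> restr u = ZC"
proof -
  obtain g where g: "\<And>i. i < 3 \<Longrightarrow> g i \<in> tensorD" "\<And>i. i < 3 \<Longrightarrow> unitary (g i)"
    "\<And>i x. i < 3 \<Longrightarrow> blinfun_apply (restr (g i)) x = blinfun_apply ZC x +
      blinfun_apply (adjoint_op ZC - ZC) (blinfun_apply (\<tau>C (res3 i)) x)"
    using exists_partial_extension by metis
  define u where "u = g 0 o\<^sub>L (g 1 o\<^sub>L g 2)"
  have mem: "g 0 \<in> tensorD" "g 1 \<in> tensorD" "g 2 \<in> tensorD" using g(1) by simp_all
  note C = \<tau>C_hom[unfolded unital_star_hom_def Lop_simps]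
  interpret Z: unitary ZC by (rule ZC_unitary)
  have commute: "\<tau>C T o\<^sub>L ZC = ZC o\<^sub>L \<tau>C T" if "T \<in> carrier Lop" for T
    using tm.A'B.te_split[OF circle_var_Cont VW_Lop[OF that]] by (simp add: \<tau>C_def ZC_def Lop_simps)
  note cz = compose_eqD[OF commute[OF res3_Lop]]
  have cz': "blinfun_apply (\<tau>C (res3 i)) (blinfun_apply (adjoint_op ZC) x) =
      blinfun_apply (adjoint_op ZC) (blinfun_apply (\<tau>C (res3 i)) x)" for i x
    using cz[of i "blinfun_apply (adjoint_op ZC) x"] by (metis Z.U_adj_apply)
  have T0: "\<tau>C 0 = 0"
    by (rule star_hom_zero[OF \<tau>C_hom])
  have ee: "blinfun_apply (\<tau>C (res3 i)) (blinfun_apply (\<tau>C (res3 j)) x) = 0" if "i \<noteq> j" for i j x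
  proof -
    have "\<tau>C (res3 i) o\<^sub>L \<tau>C (res3 j) = 0" using C res3_simps(1)[OF that] T0 res3_Lop by metis
    from arg_cong[OF this, of "\<lambda>T. blinfun_apply T x"] show ?thesis by simp
  qed
  have sum: "blinfun_apply (\<tau>C (res3 2)) x = x - blinfun_apply (\<tau>C (res3 0)) x - blinfun_apply (\<tau>C (res3 1)) x" for x
  proof -
    have "\<tau>C (res3 0) + \<tau>C (res3 1) + \<tau>C (res3 2) = id_blinfun"
      using C res3_simps(2) res3_Lop Lop_add by metis
    from arg_cong[OF this, of "\<lambda>T. blinfun_apply T x"] show ?thesis
      by (simp add: blinfun.add_left algebra_simps)
  qed
  have "restr u = restr (g 0) o\<^sub>L (restr (g 1) o\<^sub>L restr (g 2))"
    unfolding u_def using mem by (simp add: restr_ops tensorD_closed(4))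
  \<comment> \<open>Write Z for \<open>ZC\<close> and E_i for the projections. Products of different
    E_i vanish, so the product expands to \<open>Z^3 + Z^2 (Z* - Z) (E_0 + E_1 + E_2)\<close>, which
    is Z because the E_i add up to 1. E_2 is eliminated last, once the cross terms are gone.\<close>
  also have "\<dots> = ZC"
    by (rule blinfun_eqI) (simp add: g(3) blinfun.bilinear_simps cz cz' ee, simp add: sum blinfun.bilinear_simps)
  finally have "restr u = ZC" .
  moreover have "unitary u" unfolding u_def using g(2) by (intro unitary_compose) simp_all
  moreover have "u \<in> tensorD" unfolding u_def using mem by (intro tensorD_closed(4))
  ultimately show ?thesis by blast
qed

text \<open>The functional calculus of u extends the assignment of p(u) to p tensor 1, where f
  tensor 1 over the circle serves as an isometric copy of C(S^1) among operators. It is contractive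
  since the norm of p(u) is at most the supremum of |p|, which is at most the norm of p tensor 1.
  Restriction sends u to z tensor 1, hence p(u) to p tensor 1, and continuity carries this to all
  f.\<close>

theorem exists_extension:
  "\<exists>\<phi>. unital_star_hom (Cont S1) (Cont D2 \<otimes>\<^sub>m\<^sub>i\<^sub>n (Lop :: ('h \<Rightarrow>\<^sub>L 'h) star_algebra)) \<phi> \<and>
    (\<forall>a\<in>carrier (Cont S1). restr (\<phi> a) = teC a id_blinfun)"
proof -
  obtain u where u: "u \<in> tensorD" "unitary u" "restr u = ZC"
    using exists_unitary_extension unfolding Bex_def by (elim exE conjE) (rule that)
  interpret u: unitary u by (rule u(2))
  define \<rho> where "\<rho> f = teC f id_blinfun" for f
  interpret \<rho>: cont_rep S1 \<rho>
    using tm.A'B.te_unit_right_hom unfolding \<rho>_def by unfold_locales (simp add: Lop_simps)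
  define G where "G = {(\<rho> f, T) | f T. u.laurent f T}"
  have G_I: "(\<rho> f, T) \<in> G" if "u.laurent f T" for f T
    using that unfolding G_def by blast
  interpret G: contractive_star_graph G
  proof
    show "(id_blinfun, id_blinfun) \<in> G"
      using G_I[OF u.laurent.unit] by (simp add: \<rho>.rep_unit)
    fix S T S' T' c
    assume "(S, T) \<in> G"
    then obtain f where f: "S = \<rho> f" "u.laurent f T" unfolding G_def by blast
    note fC = u.laurent_carrier[OF f(2)]
    show "S \<in> carrier Lop \<and> T \<in> carrier Lop" using fC f(1) \<rho>.rep_Lop by simp
    show "(scale Lop c S, scale Lop c T) \<in> G"
      using G_I[OF u.laurent.scale[OF f(2)], of c] by (simp add: f(1) \<rho>.rep_scale[OF fC(1)])
    show "(adjoint_op S, adjoint_op T) \<in> G"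
      using G_I[OF u.laurent_star[OF f(2)]] by (simp add: f(1) \<rho>.rep_star[OF fC(1)])
    show "norm T \<le> norm S"
      using u.norm_laurent_le[OF f(2)] circle.cmod_le_norm_te[OF fC(1)] by (simp add: f(1) \<rho>_def Lop_simps)
    assume "(S', T') \<in> G"
    then obtain f' where f': "S' = \<rho> f'" "u.laurent f' T'" unfolding G_def by blast
    note fC' = u.laurent_carrier[OF f'(2)]
    show "(S + S', T + T') \<in> G"
      using G_I[OF u.laurent.add[OF f(2) f'(2)]] by (simp add: f(1) f'(1) \<rho>.rep_add[OF fC(1) fC'(1)])
    show "(S o\<^sub>L S', T o\<^sub>L T') \<in> G"
      using G_I[OF u.laurent.mult[OF f(2) f'(2)]] by (simp add: f(1) f'(1) \<rho>.rep_mult[OF fC(1) fC'(1)])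
  qed
  \<comment> \<open>Uniform density of Laurent polynomials puts every f tensor 1 into the domain of
    the extended map.\<close>
  have dense: "\<rho> f \<in> closure (fst ` G)" if f: "f \<in> carrier (Cont S1)" for f
    unfolding closure_approachable
  proof (intro allI impI)
    fix e :: real assume e: "e > 0"
    obtain p T where p: "u.laurent p T" "\<forall>w\<in>S1. cmod (f w - p w) \<le> e / 2"
      using u.laurent_dense[OF f, of "e / 2"] e by auto
    have "norm (\<rho> f - \<rho> p) \<le> e / 2"
      using p e by (intro \<rho>.rep_diff_norm_le f u.laurent_carrier(1)[OF p(1)]) auto
    then have "dist (\<rho> p) (\<rho> f) < e" using e by (simp add: dist_norm norm_minus_commute)
    moreover have "\<rho> p \<in> fst ` G" using imageI[OF G_I[OF p(1)], of fst] by simp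
    ultimately show "\<exists>y\<in>fst ` G. dist y (\<rho> f) < e" by blast
  qed
  have lau: "T \<in> tensorD \<and> restr T = \<rho> f" if "u.laurent f T" for f T
    using that
  proof (induction rule: u.laurent.induct)
    case unit
    have "id_blinfun \<in> fst ` span tm.elementary" using imageI[OF tm.graph.G_id, of fst] by simp
    then have "id_blinfun \<in> tensorD" unfolding tm.fst_span[symmetric] by (rule closure_subset[THEN subsetD])
    then show ?case using tm.graph.hom_base[OF tm.graph.G_id] by (simp add: \<rho>.rep_unit)
  next
    case var
    show ?case using u by (simp add: \<rho>_def ZC_def)
  next
    case cnj_var
    show ?case using u by (simp add: restr_ops \<rho>.rep_star tensorD_closed(5)) (simp add: \<rho>_def ZC_def)
  qed (auto simp: restr_ops \<rho>.rep_add \<rho>.rep_scale \<rho>.rep_mult u.laurent_carrier(1)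
      intro: tensorD_closed(2,3,4))
  have closed: "closed tensorD" unfolding tm.fst_span[symmetric] by simp
  have snd_G: "closure (snd ` G) \<subseteq> tensorD"
    using lau unfolding G_def by (intro closure_minimal closed) auto
  have restr_hom: "restr (G.hom S) = S" if S: "S \<in> closure (fst ` G)" for S
  proof -
    obtain s t where st: "\<And>n. (s n, t n) \<in> G" "s \<longlonglongrightarrow> S" "t \<longlonglongrightarrow> G.hom S"
      using G.hom_graph[OF S] unfolding G.closure_iff by blast
    have t: "t n \<in> tensorD \<and> restr (t n) = s n" for n
    proof -
      obtain f where "s n = \<rho> f" "u.laurent f (t n)" using st(1)[of n] unfolding G_def by blast
      then show ?thesis using lau by simp
    qed
    \<comment> \<open>Continuity of \<open>restr\<close> is available on its closed carrier, so the
      limit has to be placed there first.\<close>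
    have "G.hom S \<in> tensorD" using G.closure_fst_snd(2)[OF G.hom_graph[OF S]] snd_G by blast
    then have "(\<lambda>n. restr (t n)) \<longlonglongrightarrow> restr (G.hom S)"
      using tm.graph.continuous_on_hom t st(3) unfolding tm.fst_span
      by (intro continuous_on_tendsto_compose[of tensorD restr]) auto
    then show ?thesis using st(2) t LIMSEQ_unique by auto
  qed
  have hom_G: "unital_star_hom (Lop\<lparr>carrier := closure (fst ` G)\<rparr>) (Cont D2 \<otimes>\<^sub>m\<^sub>i\<^sub>n (Lop :: ('h \<Rightarrow>\<^sub>L 'h) star_algebra)) G.hom"
    using G.unital_star_hom_hom snd_G unfolding unital_star_hom_def min_tensor_def by auto
  have "unital_star_hom (Cont S1) (Lop\<lparr>carrier := closure (fst ` G)\<rparr>) \<rho>"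
    using \<rho>.hom dense unfolding unital_star_hom_def by auto
  from unital_star_hom_comp[OF this hom_G]
  have "unital_star_hom (Cont S1) (Cont D2 \<otimes>\<^sub>m\<^sub>i\<^sub>n (Lop :: ('h \<Rightarrow>\<^sub>L 'h) star_algebra)) (\<lambda>f. G.hom (\<rho> f))" .
  moreover have "restr (G.hom (\<rho> a)) = teC a id_blinfun" if "a \<in> carrier (Cont S1)" for a
    using restr_hom[OF dense[OF that]] by (simp add: \<rho>_def)
  ultimately show ?thesis by blast
qed

end

theorem theorem2p6:
  assumes "separable_space (euclidean :: 'h::complex_hilbert topology)"
    and "infinite_dimensional TYPE('h)"
  shows "\<exists>\<phi>. unital_star_hom (Cont S1) (Cont D2 \<otimes>\<^sub>m\<^sub>i\<^sub>n (Lop :: ('h \<Rightarrow>\<^sub>L 'h) star_algebra)) \<phi> \<and>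
    (\<forall>a\<in>carrier (Cont S1).
       tensor_hom (Cont D2) (Lop :: ('h \<Rightarrow>\<^sub>L 'h) star_algebra) (Cont S1) Lop jstar (\<lambda>T. T) (\<phi> a) =
       tensor_elem (Cont S1) Lop a (id_blinfun :: 'h \<Rightarrow>\<^sub>L 'h))"
proof -
  obtain W :: "'h \<Rightarrow>\<^sub>L nat ell2" and V where
    "\<forall>x. blinfun_apply V (blinfun_apply W x) = x" "\<forall>y. blinfun_apply W (blinfun_apply V y) = y"
    "\<forall>x y. cinner (blinfun_apply V y) x = cinner y (blinfun_apply W x)"
    using ell2_isomorphism[OF assms] by blast
  \<comment> \<open>The locale depends on chosen coordinates W and V. The statement does not, since
    \<open>tm.tensor_hom_eq\<close> identifies \<open>restr\<close> with the map described in
    \<open>tensor_hom\<close>.\<close>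
  then interpret ell2_iso W V by unfold_locales auto
  show ?thesis
    using exists_extension unfolding tm.tensor_hom_eq .
qed

end
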